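(* Let $f_1,\dots,f_r$ be homogeneous polynomials on $\mathbb{C}^{n+1}$ and assume that the divisor $f_1\cdots f_r=0$ has strictly ordinary singularities outside $0\in\mathbb{C}^{n+1}$. Then: (a) If $p=2$, or $r\in\{p+1,p+2\}$, then $\mathcal{L}^p_{td}(f_1,\dots,f_r)=\mathcal{L}^p_{\mathcal{F}}(f_1,\dots,f_r)$. (b) If $2<p\le n-2$ and $r>p+2$ then $\mathcal{L}^p_{td}(f_1,\dots,f_r)$ is an irreducible component of $\mathcal{L}^p_{\mathcal{F}}(f_1,\dots,f_r)$. In particular, if $\mathcal{L}^p_{\mathcal{F}}(f_1,\dots,f_r)$ is irreducible then $\mathcal{L}^p_{td}(f_1,\dots,f_r)=\mathcal{L}^p_{\mathcal{F}}(f_1,\dots,f_r)$.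
   Context: A hypersurface $(f_1\cdots f_r=0)\subset\mathbb{C}^{N}$ (here $N=n+1$; $f_1\cdots f_r$ reduced, $f_i(0)=0$) has strictly ordinary singularities outside $0$ if each $(f_i=0)\setminus\{0\}$ is smooth, $0$ being an isolated singularity of $f_i$, and the hypersurface is normal crossing outside the origin. Equivalently, for all $1\le i_1<\dots<i_k\le r$: if $k\ge N$ then $(f_{i_1}=\dots=f_{i_k}=0)=\{0\}$; if $1\le k<N$ then $df_{i_1}(z)\wedge\dots\wedge df_{i_k}(z)\neq0$ for all $z\in(f_{i_1}=\dots=f_{i_k}=0)\setminus\{0\}$. $\mathcal{L}^p(f_1,\dots,f_r)$ is the projectivization of the vector space of $p$-forms $\eta$ on $\mathbb{C}^{n+1}$ of the form $\eta=\sum_{1\le i_1<\dots<i_p\le r}\lambda_{i_1\dots i_p}\frac{df_{i_1}}{f_{i_1}}\wedge\dots\wedge\frac{df_{i_p}}{f_{i_p}}$ with $\lambda_{i_1\dots i_p}\in\mathbb{C}$. (Elements are written as forms, up to non-zero scalars.) $\mathcal{L}^p_R(f_1,\dots,f_r)$ is the subspace of those with $i_R\eta=0$, where $R$ is the radial vector field on $\mathbb{C}^{n+1}$ and $i_R$ is the interior product. A $p$-form is integrable if outside its poles and its zero set it is locally of the form $\omega_1\wedge\dots\wedge\omega_p$ with holomorphic $1$-forms $\omega_j$ satisfying $d\omega_j\wedge\omega_1\wedge\dots\wedge\omega_p=0$ for all $j$ (for closed forms the last condition is automatic). $\mathcal{L}^p_{\mathcal{F}}(f_1,\dots,f_r)=\{\eta\in\mathcal{L}^p_R(f_1,\dots,f_r):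 \eta\text{ is integrable}\}$, an algebraic subset of $\mathcal{L}^p_R(f_1,\dots,f_r)$. $\mathcal{L}^p_{td}(f_1,\dots,f_r)$ is the set of $\eta\in\mathcal{L}^p_R(f_1,\dots,f_r)$ that are totally decomposable into logarithmic forms, i.e. $\eta=\theta_1\wedge\dots\wedge\theta_p$ with $\theta_1,\dots,\theta_p\in\mathcal{L}^1(f_1,\dots,f_r)$.
   Formalization: In (a) the case p=2 is stated with the extra bound p≤n-2 (n≥4): for n=2,3 and r≥5 the claim fails, e.g. θ1∧θ2+θ3∧θ4 with independent logarithmic θ_j killed by i_R; the other cases cut off (n≤1 or r≤2) have both sets empty. Also p≥1 is assumed. *)

theory Defs
  imports "HOL-Analysis.Analysis" "HOL-Library.Function_Algebras"
begin

section \<open>Polynomials and projective algebraic sets\<close>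

text \<open>Coordinate-free polynomial functions on a complex vector space; on \<open>complex^'m\<close> the linear
  functionals are the combinations of the coordinates. On an infinite-dimensional space these are
  the polynomials in finitely many linear functionals, so their restrictions to a
  finite-dimensional subspace are exactly its polynomial functions.\<close>

inductive polynomial_fun :: "(complex \<Rightarrow> 'v::ab_group_add \<Rightarrow> 'v) \<Rightarrow> ('v \<Rightarrow> complex) \<Rightarrow> bool"
  for scl where
  linear: "Vector_Spaces.linear scl (*) \<phi> \<Longrightarrow> polynomial_fun scl \<phi>"
| const: "polynomial_fun scl (\<lambda>_. c)"
| add: "polynomial_fun scl P \<Longrightarrow> polynomial_fun scl Q \<Longrightarrow> polynomial_fun scl (\<lambda>x. P x + Q x)"
| mult: "polynomial_fun scl P \<Longrightarrow> polynomial_fun scl Q \<Longrightarrow> polynomial_fun scl (\<lambda>x. P x * Q x)"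

definition homogeneous_poly ::
    "(complex \<Rightarrow> 'v::ab_group_add \<Rightarrow> 'v) \<Rightarrow> nat \<Rightarrow> ('v \<Rightarrow> complex) \<Rightarrow> bool" where
  "homogeneous_poly scl d P \<longleftrightarrow>
     polynomial_fun scl P \<and> (\<forall>c x. P (scl c x) = c ^ d * P x)"

definition proj_pt :: "(complex \<Rightarrow> 'v \<Rightarrow> 'v) \<Rightarrow> 'v \<Rightarrow> 'v set" where
  "proj_pt scl x = {scl c x | c. c \<noteq> 0}"

definition projectivization :: "(complex \<Rightarrow> 'v::zero \<Rightarrow> 'v) \<Rightarrow> 'v set \<Rightarrow> 'v set set" where
  "projectivization scl V = proj_pt scl ` (V - {0})"

definition zariski_closed ::
    "(complex \<Rightarrow> 'v::ab_group_add \<Rightarrow> 'v) \<Rightarrow> 'v set \<Rightarrow> 'v set set \<Rightarrow> bool" where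
  "zariski_closed scl V Z \<longleftrightarrow>
     (\<exists>S. (\<forall>P\<in>S. \<exists>d. homogeneous_poly scl d P) \<and>
          Z = proj_pt scl ` {x \<in> V - {0}. \<forall>P\<in>S. P x = 0})"

definition zariski_irreducible ::
    "(complex \<Rightarrow> 'v::ab_group_add \<Rightarrow> 'v) \<Rightarrow> 'v set \<Rightarrow> 'v set set \<Rightarrow> bool" where
  "zariski_irreducible scl V X \<longleftrightarrow>
     X \<noteq> {} \<and> X \<subseteq> projectivization scl V \<and>
     (\<forall>A B. zariski_closed scl V A \<and> zariski_closed scl V B \<and> X \<subseteq> A \<union> B
        \<longrightarrow> X \<subseteq> A \<or> X \<subseteq> B)"

text \<open>A maximal irreducible subset of \<open>Y\<close>; it is automatically closed in \<open>Y\<close>.\<close>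

definition irreducible_component ::
    "(complex \<Rightarrow> 'v::ab_group_add \<Rightarrow> 'v) \<Rightarrow> 'v set \<Rightarrow> 'v set set \<Rightarrow> 'v set set \<Rightarrow> bool" where
  "irreducible_component scl V X Y \<longleftrightarrow>
     X \<subseteq> Y \<and> zariski_irreducible scl V X \<and>
     (\<forall>X'. X \<subseteq> X' \<and> X' \<subseteq> Y \<and> zariski_irreducible scl V X' \<longrightarrow> X' = X)"

section \<open>Differential forms\<close>

text \<open>A \<open>p\<close>-form maps a point to a function of a sequence of vectors \<open>v\<close>, of which only
  \<open>v 0, \<dots>, v (p - 1)\<close> matter.\<close>

type_synonym 'm multicovector = "(nat \<Rightarrow> complex^'m) \<Rightarrow> complex"
type_synonym 'm form = "complex^'m \<Rightarrow> 'm multicovector"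

definition scale_form :: "complex \<Rightarrow> 'm form \<Rightarrow> 'm form" where
  "scale_form c \<eta> = (\<lambda>z v. c * \<eta> z v)"

lemma vector_space_scale_form: "vector_space scale_form"
  by unfold_locales (auto simp: scale_form_def fun_eq_iff algebra_simps)

definition alternating :: "nat \<Rightarrow> ('m::finite) multicovector \<Rightarrow> bool" where
  "alternating p \<phi> \<longleftrightarrow>
     (\<forall>v w. (\<forall>i<p. v i = w i) \<longrightarrow> \<phi> v = \<phi> w) \<and>
     (\<forall>v. \<forall>i<p. Vector_Spaces.linear (*s) (*) (\<lambda>x. \<phi> (v(i := x)))) \<and>
     (\<forall>v. \<forall>i<p. \<forall>j<p. i \<noteq> j \<and> v i = v j \<longrightarrow> \<phi> v = 0)"

text \<open>Normalized so that \<open>\<alpha>\<^sub>0 \<and> \<dots> \<and> \<alpha>\<^sub>p\<^sub>-\<^sub>1\<close> is the determinant of \<open>\<alpha>\<^sub>i(v\<^sub>j)\<close>, as in \<open>wedge1\<close> below.\<close>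

definition wedge ::
    "nat \<Rightarrow> nat \<Rightarrow> 'm multicovector \<Rightarrow> 'm multicovector \<Rightarrow> 'm multicovector" where
  "wedge q p \<alpha> \<beta> v =
     (\<Sum>\<pi> | \<pi> permutes {..<q + p}.
        of_int (sign \<pi>) * \<alpha> (\<lambda>j. v (\<pi> j)) * \<beta> (\<lambda>j. v (\<pi> (q + j)))) / (fact q * fact p)"

definition wedge1 :: "nat \<Rightarrow> (nat \<Rightarrow> 'm multicovector) \<Rightarrow> 'm multicovector" where
  "wedge1 p \<alpha> v =
     (\<Sum>\<pi> | \<pi> permutes {..<p}. of_int (sign \<pi>) * (\<Prod>i<p. \<alpha> i (\<lambda>_. v (\<pi> i))))"

definition differential :: "(complex^'m::finite \<Rightarrow> complex) \<Rightarrow> 'm form" where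
  "differential g z v = frechet_derivative g (at z) (v 0)"

definition ext_deriv :: "nat \<Rightarrow> ('m::finite) form \<Rightarrow> 'm form" where
  "ext_deriv q \<omega> z v =
     (\<Sum>i\<le>q. (-1) ^ i *
        frechet_derivative (\<lambda>y. \<omega> y (\<lambda>j. if j < i then v j else v (Suc j))) (at z) (v i))"

definition interior_product :: "(complex^'m \<Rightarrow> complex^'m) \<Rightarrow> 'm form \<Rightarrow> 'm form" where
  "interior_product X \<eta> z v = \<eta> z (case_nat (X z) v)"

definition radial_field :: "complex^'m \<Rightarrow> complex^'m" where
  "radial_field z = z"

definition holomorphic_fun_on :: "(complex^'m::finite) set \<Rightarrow> (complex^'m \<Rightarrow> complex) \<Rightarrow> bool" where
  "holomorphic_fun_on U g \<longleftrightarrow>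
     (\<forall>z\<in>U. \<exists>g'. (g has_derivative g') (at z) \<and> (\<forall>c v. g' (c *s v) = c * g' v))"

definition holomorphic_form_on :: "(complex^'m::finite) set \<Rightarrow> nat \<Rightarrow> 'm form \<Rightarrow> bool" where
  "holomorphic_form_on U p \<alpha> \<longleftrightarrow>
     (\<forall>z\<in>U. alternating p (\<alpha> z)) \<and> (\<forall>v. holomorphic_fun_on U (\<lambda>z. \<alpha> z v))"

text \<open>Here \<open>\<eta>\<close> is a meromorphic form with poles in the hypersurface \<open>D\<close>; its values on \<open>D\<close> are
  irrelevant. A point \<open>z\<close> is not a pole iff \<open>\<eta>\<close> has a holomorphic extension \<open>\<alpha>\<close> to a
  neighbourhood \<open>U\<close> of \<open>z\<close>, and then \<open>z\<close> lies outside the zero set iff \<open>\<alpha> z \<noteq> 0\<close>.\<close>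

definition integrable_form :: "(complex^'m::finite) set \<Rightarrow> nat \<Rightarrow> 'm form \<Rightarrow> bool" where
  "integrable_form D p \<eta> \<longleftrightarrow>
     (\<forall>U \<alpha> z. open U \<and> z \<in> U \<and> holomorphic_form_on U p \<alpha> \<and> (\<forall>y \<in> U - D. \<alpha> y = \<eta> y) \<and> \<alpha> z \<noteq> 0
       \<longrightarrow> (\<exists>W \<omega>. open W \<and> z \<in> W \<and> W \<subseteq> U \<and>
              (\<forall>j<p. holomorphic_form_on W 1 (\<omega> j)) \<and>
              (\<forall>y\<in>W. \<alpha> y = wedge1 p (\<lambda>j. \<omega> j y)) \<and>
              (\<forall>j<p. \<forall>y\<in>W. wedge 2 p (ext_deriv 1 (\<omega> j) y) (wedge1 p (\<lambda>i. \<omega> i y)) = 0)))"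

section \<open>Strictly ordinary singularities\<close>

definition reduced_poly :: "(complex^'m::finite \<Rightarrow> complex) \<Rightarrow> bool" where
  "reduced_poly F \<longleftrightarrow>
     (\<forall>g h. polynomial_fun (*s) g \<and> polynomial_fun (*s) h \<and> (\<forall>z. F z = (g z)\<^sup>2 * h z)
        \<longrightarrow> g constant_on UNIV)"

text \<open>The functions are \<open>f 0, \<dots>, f (r - 1)\<close>, and a multi-index \<open>i\<^sub>1 < \<dots> < i\<^sub>k\<close> is given by the
  set \<open>I\<close> of its entries; \<open>CARD('m)\<close> is the dimension of the ambient space.\<close>

definition strictly_ordinary :: "(nat \<Rightarrow> complex^'m::finite \<Rightarrow> complex) \<Rightarrow> nat \<Rightarrow> bool" where
  "strictly_ordinary f r \<longleftrightarrow>
     (\<forall>i<r. f i 0 = 0) \<and> reduced_poly (\<lambda>z. \<Prod>i<r. f i z) \<and>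
     (\<forall>I \<subseteq> {..<r}. I \<noteq> {} \<longrightarrow>
        (card I \<ge> CARD('m) \<longrightarrow> {z. \<forall>i\<in>I. f i z = 0} = {0}) \<and>
        (card I < CARD('m) \<longrightarrow>
           (\<forall>z \<in> {z. \<forall>i\<in>I. f i z = 0} - {0}.
              wedge1 (card I) (\<lambda>j. differential (f (sorted_list_of_set I ! j)) z) \<noteq> 0)))"

section \<open>Spaces of logarithmic forms\<close>

definition polar_divisor :: "(nat \<Rightarrow> complex^'m \<Rightarrow> complex) \<Rightarrow> nat \<Rightarrow> (complex^'m) set" where
  "polar_divisor f r = {z. \<exists>i<r. f i z = 0}"

text \<open>A meromorphic form is represented by its restriction to the complement of the divisor,
  extended by 0, so that equality of the representing functions is equality of meromorphic forms.\<close>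

definition log_form ::
    "(nat \<Rightarrow> complex^'m::finite \<Rightarrow> complex) \<Rightarrow> nat \<Rightarrow> nat \<Rightarrow> (nat set \<Rightarrow> complex) \<Rightarrow> 'm form" where
  "log_form f r p c = (\<lambda>z v. if z \<in> polar_divisor f r then 0 else
     (\<Sum>I | I \<subseteq> {..<r} \<and> card I = p.
        c I * wedge1 p (\<lambda>j w. differential (f (sorted_list_of_set I ! j)) z w
                               / f (sorted_list_of_set I ! j) z) v))"

definition log_forms :: "(nat \<Rightarrow> complex^'m::finite \<Rightarrow> complex) \<Rightarrow> nat \<Rightarrow> nat \<Rightarrow> 'm form set" where
  "log_forms f r p = range (log_form f r p)"

definition log_forms_R :: "(nat \<Rightarrow> complex^'m::finite \<Rightarrow> complex) \<Rightarrow> nat \<Rightarrow> nat \<Rightarrow> 'm form set" where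
  "log_forms_R f r p = {\<eta> \<in> log_forms f r p. interior_product radial_field \<eta> = 0}"

definition L_F :: "(nat \<Rightarrow> complex^'m::finite \<Rightarrow> complex) \<Rightarrow> nat \<Rightarrow> nat \<Rightarrow> 'm form set set" where
  "L_F f r p = proj_pt scale_form `
     {\<eta> \<in> log_forms_R f r p - {0}. integrable_form (polar_divisor f r) p \<eta>}"

definition L_td :: "(nat \<Rightarrow> complex^'m::finite \<Rightarrow> complex) \<Rightarrow> nat \<Rightarrow> nat \<Rightarrow> 'm form set set" where
  "L_td f r p = proj_pt scale_form `
     {\<eta> \<in> log_forms_R f r p - {0}.
        \<exists>\<theta>. (\<forall>j<p. \<theta> j \<in> log_forms f r 1 - {0}) \<and> \<eta> = (\<lambda>z. wedge1 p (\<lambda>j. \<theta> j z))}"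

end

theory Submission
  imports Defs "HOL-Complex_Analysis.Conformal_Mappings"
begin

text \<open>A logarithmic form \<open>\<eta> = \<Sum>\<^sub>I c\<^sub>I df\<^sub>I/f\<^sub>I\<close> is, at a point \<open>z\<close> off the divisor, the pullback of one fixed
alternating form \<open>c\<close> on \<open>\<complex>\<^sup>r\<close> under the linear map \<open>v \<mapsto> (df\<^sub>k(z)(v) / f\<^sub>k(z))\<^sub>k\<close>. For \<open>p \<le> n\<close> total
decomposability of \<open>\<eta>\<close> means that \<open>c\<close> itself is a product of linear forms. Integrability means
that every pullback is such a product: the Frobenius condition comes for free because logarithmic
differentials are closed, and it extends across the divisor by continuity
(\<open>integrable_wedge_of_log_forms\<close>). So \<open>L_td\<close> is contained in \<open>L_F\<close>, and the theorem asks how far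
decomposability of the pullbacks forces decomposability of \<open>c\<close>. Decomposability is tested by the
quadratic Pluecker relations, in the form of exchange relations between the columns of two
determinants.

The passage from pullbacks to \<open>c\<close> happens near a common zero \<open>z\<^sub>0 \<noteq> 0\<close> of functions \<open>f\<^sub>i\<close>, \<open>i \<in> I\<close>.
By normal crossings the vanishing \<open>f\<^sub>i\<close> are part of a coordinate system, so that along a suitable curve
ending in \<open>z\<^sub>0\<close> there are tangent vectors whose images in \<open>\<complex>\<^sup>r\<close> tend to the unit vectors
\<open>e\<^sub>i\<close> (\<open>log_frame_exists\<close>). Passing to the limit, \<open>\<eta>\<close> determines the coefficients \<open>c\<^sub>I\<close>
(\<open>log_form_inj\<close>), \<open>i\<^sub>R \<eta> = 0\<close> says that \<open>c\<close> is annihilated by the vector of degrees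
(\<open>coef_seq_contraction\<close>), and integrability of \<open>\<eta>\<close> gives all those exchange relations for \<open>c\<close> that
involve at most \<open>n\<close> indices (\<open>exchange_coef_seq_limit\<close>). That at most \<open>n\<close> of the functions always
have a common zero other than \<open>0\<close> (\<open>common_zero\<close>) is the maximum principle: otherwise a level set
\<open>f\<^sub>k = 1\<close> inside a cone cut out by the others would be a compact complex submanifold of positive
dimension in \<open>\<complex>\<^bsup>n+1\<^esup>\<close>.

What is left is linear algebra. A nonzero coefficient \<open>c\<^sub>v\<close> yields a decomposable form that
agrees with \<open>c\<close> on all index tuples differing from \<open>v\<close> in at most one place (\<open>adapted_rows_agree\<close>).
For \<open>r \<le> p + 2\<close> the contraction with the degrees determines the other coefficients
(\<open>agree_of_contraction\<close>); for \<open>p > n\<close> nothing is to be shown, since then only the zero form satisfies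
\<open>i\<^sub>R \<eta> = 0\<close> (\<open>log_forms_R_high_degree\<close>). In general the exchange relations with at most \<open>p + 2\<close> indices
determine them one place at a time, provided that the coefficients used as pivots do not vanish
(\<open>agree_of_exchange\<close>); for \<open>p = 2\<close> the only pivot, up to order, is \<open>c\<^sub>v\<close>.
For \<open>p > 2\<close> it follows that \<open>L_F\<close> is covered by \<open>L_td\<close> and the closed set where some coefficient
vanishes. Since \<open>L_td\<close> is closed (exchange relations), irreducible (it is parametrized by matrices
whose rows annihilate the degrees) and contains a point with all coefficients nonzero, it is a
component of \<open>L_F\<close> (\<open>L_td_component\<close>).\<close>

section \<open>Determinants and the exchange relation\<close>

text \<open>The determinant with columns \<open>x 0, \<dots>, x (p - 1)\<close>, written as the permutation sum that defines
\<open>wedge1\<close>. Columns are values of \<open>x\<close>, so that replacing a column is a function update.\<close>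

definition cdet :: "nat \<Rightarrow> (nat \<Rightarrow> nat \<Rightarrow> complex) \<Rightarrow> complex" where
  "cdet p x = (\<Sum>\<pi> | \<pi> permutes {..<p}. of_int (sign \<pi>) * (\<Prod>i<p. x (\<pi> i) i))"

definition unit_vec :: "nat \<Rightarrow> nat \<Rightarrow> complex" where
  "unit_vec k = (\<lambda>i. if i = k then 1 else 0)"

lemma wedge1_eq_cdet: "wedge1 p \<alpha> v = cdet p (\<lambda>j i. \<alpha> i (\<lambda>_. v j))"
  by (simp add: wedge1_def cdet_def)

text \<open>The part of being alternating that makes sense without a linear structure on the arguments. It is
used both for sequences of tangent vectors and for sequences of indices.\<close>

definition alternating_seq :: "nat \<Rightarrow> ((nat \<Rightarrow> 'a) \<Rightarrow> complex) \<Rightarrow> bool" where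
  "alternating_seq p \<phi> \<longleftrightarrow>
     (\<forall>v w. (\<forall>i<p. v i = w i) \<longrightarrow> \<phi> v = \<phi> w) \<and>
     (\<forall>v \<pi>. \<pi> permutes {..<p} \<longrightarrow> \<phi> (v \<circ> \<pi>) = of_int (sign \<pi>) * \<phi> v) \<and>
     (\<forall>v i j. i < p \<and> j < p \<and> i \<noteq> j \<and> v i = v j \<longrightarrow> \<phi> v = 0)"

lemma alternating_seq_cong:
  "alternating_seq p \<phi> \<Longrightarrow> (\<And>i. i < p \<Longrightarrow> v i = w i) \<Longrightarrow> \<phi> v = \<phi> w"
  unfolding alternating_seq_def by blast

lemma alternating_seq_permute:
  "alternating_seq p \<phi> \<Longrightarrow> \<pi> permutes {..<p} \<Longrightarrow> \<phi> (v \<circ> \<pi>) = of_int (sign \<pi>) * \<phi> v"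
  unfolding alternating_seq_def by blast

lemma alternating_seq_repeat:
  "alternating_seq p \<phi> \<Longrightarrow> i < p \<Longrightarrow> j < p \<Longrightarrow> i \<noteq> j \<Longrightarrow> v i = v j \<Longrightarrow> \<phi> v = 0"
  unfolding alternating_seq_def by blast

lemma alternating_seq_not_inj:
  assumes "alternating_seq p \<phi>" "\<not> inj_on v {..<p}"
  shows "\<phi> v = 0"
proof -
  obtain i j where "i < p" "j < p" "i \<noteq> j" "v i = v j" using assms(2) by (auto simp: inj_on_def)
  then show ?thesis by (rule alternating_seq_repeat[OF assms(1)])
qed

lemma alternating_seq_compose: "alternating_seq p \<phi> \<Longrightarrow> alternating_seq p (\<lambda>x. \<phi> (\<lambda>j. g (x j)))"
  unfolding alternating_seq_def
proof (intro conjI allI impI)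
  fix v w :: "nat \<Rightarrow> 'b"
  assume "(\<forall>v w. (\<forall>i<p. v i = w i) \<longrightarrow> \<phi> v = \<phi> w) \<and>
     (\<forall>v \<pi>. \<pi> permutes {..<p} \<longrightarrow> \<phi> (v \<circ> \<pi>) = of_int (sign \<pi>) * \<phi> v) \<and>
     (\<forall>v i j. i < p \<and> j < p \<and> i \<noteq> j \<and> v i = v j \<longrightarrow> \<phi> v = 0)"
  then have *: "\<And>v w. (\<forall>i<p. v i = w i) \<Longrightarrow> \<phi> v = \<phi> w"
    "\<And>v \<pi>. \<pi> permutes {..<p} \<Longrightarrow> \<phi> (v \<circ> \<pi>) = of_int (sign \<pi>) * \<phi> v"
    "\<And>v i j. i < p \<and> j < p \<and> i \<noteq> j \<and> v i = v j \<Longrightarrow> \<phi> v = 0" by blast+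
  show "\<phi> (\<lambda>j. g (v j)) = \<phi> (\<lambda>j. g (w j))" if "\<forall>i<p. v i = w i" using that by (intro *(1)) auto
  show "\<phi> (\<lambda>j. g ((v \<circ> \<pi>) j)) = of_int (sign \<pi>) * \<phi> (\<lambda>j. g (v j))" if "\<pi> permutes {..<p}" for \<pi>
    using *(2)[OF that, of "\<lambda>j. g (v j)"] by (simp add: comp_def)
  show "\<phi> (\<lambda>j. g (v j)) = 0" if "i < p \<and> j < p \<and> i \<noteq> j \<and> v i = v j" for i j
    using that by (intro *(3)[of i j]) auto
qed

lemma alternating_seq_scale: "alternating_seq p \<phi> \<Longrightarrow> alternating_seq p (\<lambda>x. c * \<phi> x)"
  unfolding alternating_seq_def by (auto simp: algebra_simps)

lemma alternating_seq_sum: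
  "(\<And>a. a \<in> S \<Longrightarrow> alternating_seq p (\<phi> a)) \<Longrightarrow> alternating_seq p (\<lambda>x. \<Sum>a\<in>S. \<phi> a x)"
  unfolding alternating_seq_def
  by (auto simp: sum_distrib_left intro!: sum.cong sum.neutral)

lemma alternating_seq_cdet: "alternating_seq p (cdet p)"
  unfolding alternating_seq_def
proof (intro conjI allI impI)
  fix v w :: "nat \<Rightarrow> nat \<Rightarrow> complex"
  assume eq: "\<forall>i<p. v i = w i"
  have "v (\<pi> i) = w (\<pi> i)" if "\<pi> permutes {..<p}" "i < p" for \<pi> i
    using eq that permutes_in_image[OF that(1), of i] by auto
  then show "cdet p v = cdet p w"
    unfolding cdet_def by (auto intro!: sum.cong prod.cong)
next
  fix v :: "nat \<Rightarrow> nat \<Rightarrow> complex" and \<pi>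
  assume pi: "\<pi> permutes {..<p}"
  have perm: "permutation \<sigma>" if "\<sigma> permutes {..<p}" for \<sigma>
    using that permutes_imp_permutation by blast
  have "cdet p v = (\<Sum>\<sigma> | \<sigma> permutes {..<p}. of_int (sign (\<pi> \<circ> \<sigma>)) * (\<Prod>i<p. v ((\<pi> \<circ> \<sigma>) i) i))"
    unfolding cdet_def by (rule setum_permutations_compose_left[OF pi])
  also have "\<dots> = (\<Sum>\<sigma> | \<sigma> permutes {..<p}. of_int (sign \<pi>) * (of_int (sign \<sigma>) * (\<Prod>i<p. v (\<pi> (\<sigma> i)) i)))"
    by (intro sum.cong) (auto simp: sign_compose perm pi)
  also have "\<dots> = of_int (sign \<pi>) * cdet p (v \<circ> \<pi>)"
    by (simp add: cdet_def sum_distrib_left)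
  finally show "cdet p (v \<circ> \<pi>) = of_int (sign \<pi>) * cdet p v"
    by (metis mult.assoc mult_1 of_int_1 of_int_mult sign_idempotent)
next
  fix v :: "nat \<Rightarrow> nat \<Rightarrow> complex" and a b
  assume ab: "a < p \<and> b < p \<and> a \<noteq> b \<and> v a = v b"
  let ?t = "Transposition.transpose a b"
  have t: "?t permutes {..<p}" using ab by (simp add: permutes_swap_id)
  have perm: "permutation \<sigma>" if "\<sigma> permutes {..<p}" for \<sigma>
    using that permutes_imp_permutation by blast
  have inv: "v (?t i) = v i" for i using ab by (simp add: Transposition.transpose_def)
  have "cdet p v = (\<Sum>\<sigma> | \<sigma> permutes {..<p}. of_int (sign (?t \<circ> \<sigma>)) * (\<Prod>i<p. v ((?t \<circ> \<sigma>) i) i))"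
    unfolding cdet_def by (rule setum_permutations_compose_left[OF t])
  also have "\<dots> = (\<Sum>\<sigma> | \<sigma> permutes {..<p}. - (of_int (sign \<sigma>) * (\<Prod>i<p. v (\<sigma> i) i)))"
    using ab by (intro sum.cong) (auto simp: sign_compose perm t inv sign_swap_id)
  also have "\<dots> = - cdet p v"
    by (simp add: cdet_def sum_negf)
  finally show "cdet p v = 0" by simp
qed

lemmas cdet_cong = alternating_seq_cong[OF alternating_seq_cdet]
lemmas cdet_permute = alternating_seq_permute[OF alternating_seq_cdet]
lemmas cdet_repeat = alternating_seq_repeat[OF alternating_seq_cdet]

lemma cdet_cong_entries:
  assumes "\<And>i j. i < p \<Longrightarrow> j < p \<Longrightarrow> x j i = y j i"
  shows "cdet p x = cdet p y"
proof -
  have "\<pi> i < p" if "\<pi> permutes {..<p}" "i < p" for \<pi> i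
    using permutes_in_image[OF that(1), of i] that by auto
  then show ?thesis unfolding cdet_def using assms by (auto intro!: sum.cong prod.cong)
qed

lemma cdet_upd_sum:
  assumes j: "j < p" and b: "\<And>i. i < p \<Longrightarrow> b i = (\<Sum>l\<in>L. a l * g l i)"
  shows "cdet p (x(j := b)) = (\<Sum>l\<in>L. a l * cdet p (x(j := g l)))"
proof -
  have term_eq: "of_int (sign \<pi>) * (\<Prod>i<p. (x(j := b)) (\<pi> i) i) =
      (\<Sum>l\<in>L. a l * (of_int (sign \<pi>) * (\<Prod>i<p. (x(j := g l)) (\<pi> i) i)))"
    if pi: "\<pi> permutes {..<p}" for \<pi>
  proof -
    define i0 where "i0 = inv \<pi> j"
    have i0: "\<pi> i0 = j" "i0 < p"
      using permutes_inverses(1)[OF pi] permutes_in_image[OF permutes_inv[OF pi], of j] j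
      by (auto simp: i0_def)
    have other: "\<pi> i \<noteq> j" if "i \<noteq> i0" for i
      using i0(1) that permutes_inj[OF pi] by (metis injD)
    have split: "(\<Prod>i<p. (x(j := c)) (\<pi> i) i) = c i0 * (\<Prod>i\<in>{..<p} - {i0}. x (\<pi> i) i)" for c
    proof -
      have "(\<Prod>i<p. (x(j := c)) (\<pi> i) i)
          = (x(j := c)) (\<pi> i0) i0 * (\<Prod>i\<in>{..<p} - {i0}. (x(j := c)) (\<pi> i) i)"
        by (rule prod.remove) (use i0 in auto)
      also have "(\<Prod>i\<in>{..<p} - {i0}. (x(j := c)) (\<pi> i) i) = (\<Prod>i\<in>{..<p} - {i0}. x (\<pi> i) i)"
        by (rule prod.cong) (use other in auto)
      finally show ?thesis using i0 by simp
    qed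
    show ?thesis unfolding split b[OF i0(2)]
      by (simp add: sum_distrib_left sum_distrib_right mult_ac)
  qed
  show ?thesis unfolding cdet_def
    by (simp add: term_eq sum_distrib_left del: fun_upd_apply) (rule sum.swap)
qed

lemma cdet_expand_column:
  assumes "j < p"
  shows "cdet p (x(j := b)) = (\<Sum>k<p. b k * cdet p (x(j := unit_vec k)))"
  by (rule cdet_upd_sum[OF assms]) (simp add: unit_vec_def if_distrib sum.delta cong: if_cong)

lemma cdet_unit: "cdet p unit_vec = 1"
proof -
  have zero: "(\<Prod>i<p. unit_vec (\<pi> i) i) = 0" if "\<pi> permutes {..<p}" "\<pi> \<noteq> id" for \<pi>
  proof -
    obtain i where "\<pi> i \<noteq> i" using \<open>\<pi> \<noteq> id\<close> by (auto simp: fun_eq_iff)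
    moreover from this have "i < p" using permutes_not_in[OF that(1), of i] by auto
    ultimately show ?thesis by (intro prod_zero) (auto simp: unit_vec_def intro!: bexI[of _ i])
  qed
  have "cdet p unit_vec = (\<Sum>\<pi>\<in>{id}. of_int (sign \<pi>) * (\<Prod>i<p. unit_vec (\<pi> i) i))"
    unfolding cdet_def
    by (rule sum.mono_neutral_right) (use zero in \<open>auto simp: finite_permutations permutes_id\<close>)
  then show ?thesis by (simp add: unit_vec_def)
qed

lemma cdet_unit_column:
  assumes "c < p"
  shows "cdet p (unit_vec(c := y)) = y c"
proof -
  have "cdet p (unit_vec(c := y)) = (\<Sum>k<p. y k * cdet p (unit_vec(c := unit_vec k)))"
    by (rule cdet_expand_column[OF assms])
  also have "\<dots> = (\<Sum>k<p. if k = c then y k else 0)"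
  proof (rule sum.cong[OF refl])
    fix k assume k: "k \<in> {..<p}"
    show "y k * cdet p (unit_vec(c := unit_vec k)) = (if k = c then y k else 0)"
    proof (cases "k = c")
      case True
      then show ?thesis using cdet_unit[of p] by (simp add: fun_upd_triv)
    next
      case False
      have "cdet p (unit_vec(c := unit_vec k)) = 0"
        by (rule cdet_repeat[of k p c]) (use k False assms in auto)
      then show ?thesis using False by simp
    qed
  qed
  finally show ?thesis using assms by (simp add: sum.delta)
qed

text \<open>Reduction of a multilinear statement to basis vectors: entries are moved into the spanning set
\<open>B\<close> one slot at a time. Multilinear functions are compared on unit vectors in this way.\<close>

lemma vanish_by_slots:
  fixes P :: "(nat \<Rightarrow> 'a) \<Rightarrow> bool"
  assumes base: "\<And>u. (\<And>j. j < p \<Longrightarrow> u j \<in> B) \<Longrightarrow> P u"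
    and step: "\<And>u j. (\<And>i. i < p \<Longrightarrow> u i \<in> A) \<Longrightarrow> j < p \<Longrightarrow> (\<And>b. b \<in> B \<Longrightarrow> P (u(j := b))) \<Longrightarrow> P u"
    and "B \<subseteq> A" and "\<And>i. i < p \<Longrightarrow> u i \<in> A"
  shows "P u"
proof -
  have "\<forall>u. (\<forall>i<p. u i \<in> A) \<and> (\<forall>j. q \<le> j \<and> j < p \<longrightarrow> u j \<in> B) \<longrightarrow> P u" if "q \<le> p" for q
    using that
  proof (induction q)
    case 0
    then show ?case using base by auto
  next
    case (Suc q)
    show ?case
    proof (intro allI impI)
      fix u assume u: "(\<forall>i<p. u i \<in> A) \<and> (\<forall>j. Suc q \<le> j \<and> j < p \<longrightarrow> u j \<in> B)"
      show "P u"
      proof (rule step[of u q])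
        fix b assume "b \<in> B"
        then show "P (u(q := b))" using Suc u \<open>B \<subseteq> A\<close> by auto
      qed (use u Suc.prems in auto)
    qed
  qed
  moreover have "(\<forall>i<p. u i \<in> A) \<and> (\<forall>j. p \<le> j \<and> j < p \<longrightarrow> u j \<in> B)"
    using assms(4) by auto
  ultimately show ?thesis using order_refl by blast
qed

lemma permutes_of_inj:
  assumes "inj_on \<sigma> {..<p}" "\<sigma> ` {..<p} \<subseteq> {..<p::nat}"
  obtains \<pi> where "\<pi> permutes {..<p}" "\<And>i. i < p \<Longrightarrow> \<pi> i = \<sigma> i"
proof
  let ?\<pi> = "\<lambda>i. if i < p then \<sigma> i else i"
  have "\<sigma> ` {..<p} = {..<p}" using assms by (simp add: endo_inj_surj)
  then have "bij_betw ?\<pi> {..<p} {..<p}"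
    using assms(1) by (auto simp: bij_betw_def inj_on_def image_iff)
  then show "?\<pi> permutes {..<p}" by (rule bij_imp_permutes) auto
qed auto

text \<open>The Pluecker relation in exchange form: entry \<open>u j\<close> is traded against every entry of \<open>v\<close>. An
alternating form is decomposable iff it satisfies all of these relations.\<close>

definition exchange_at :: "nat \<Rightarrow> ((nat \<Rightarrow> 'a) \<Rightarrow> complex) \<Rightarrow> (nat \<Rightarrow> 'a) \<Rightarrow> (nat \<Rightarrow> 'a) \<Rightarrow> nat \<Rightarrow> bool" where
  "exchange_at p \<phi> v u j \<longleftrightarrow> \<phi> v * \<phi> u = (\<Sum>i<p. \<phi> (v(i := u j)) * \<phi> (u(j := v i)))"

lemma alternating_seq_selection:
  fixes \<phi> :: "(nat \<Rightarrow> 'a) \<Rightarrow> complex"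
  assumes \<phi>: "alternating_seq p \<phi>"
    and u: "\<And>j. j < p \<Longrightarrow> u j = v (\<sigma> j)" and \<sigma>: "\<sigma> ` {..<p} \<subseteq> {..<p}"
  shows "\<phi> u = \<phi> v * cdet p (\<lambda>j. unit_vec (\<sigma> j))"
proof (cases "inj_on \<sigma> {..<p}")
  case True
  then obtain \<pi> where \<pi>: "\<pi> permutes {..<p}" "\<And>i. i < p \<Longrightarrow> \<pi> i = \<sigma> i"
    using permutes_of_inj \<sigma> by blast
  have "\<phi> u = \<phi> (v \<circ> \<pi>)" by (rule alternating_seq_cong[OF \<phi>]) (simp add: u \<pi>)
  moreover have "cdet p (\<lambda>j. unit_vec (\<sigma> j)) = cdet p (unit_vec \<circ> \<pi>)"
    by (rule cdet_cong) (simp add: \<pi>)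
  ultimately show ?thesis
    using alternating_seq_permute[OF \<phi> \<pi>(1)] cdet_permute[OF \<pi>(1), of unit_vec] cdet_unit[of p] by simp
next
  case False
  then obtain a b where ab: "a < p" "b < p" "a \<noteq> b" "\<sigma> a = \<sigma> b" by (auto simp: inj_on_def)
  have "\<phi> u = 0" by (rule alternating_seq_repeat[OF \<phi> ab(1-3)]) (simp add: u ab)
  moreover have "cdet p (\<lambda>j. unit_vec (\<sigma> j)) = 0" by (rule cdet_repeat[OF ab(1-3)]) (simp add: ab)
  ultimately show ?thesis by simp
qed

text \<open>Both sides are multilinear in the columns of \<open>v\<close>, so these may be taken to be unit vectors. If
they form a permutation, the sum on the right expands the determinant of \<open>u\<close> along column \<open>j\<close>; if a
unit vector is repeated, the two surviving terms cancel.\<close>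

lemma exchange_cdet: "exchange_at p (cdet p) v u j" if "j < p"
proof (rule vanish_by_slots[where p = p and A = UNIV and B = "unit_vec ` {..<p}" and P = "\<lambda>v. exchange_at p (cdet p) v u j"])
  fix v :: "nat \<Rightarrow> nat \<Rightarrow> complex" assume "\<And>j. j < p \<Longrightarrow> v j \<in> unit_vec ` {..<p}"
  then have "\<forall>j<p. \<exists>k<p. v j = unit_vec k" by auto
  then obtain \<sigma> where \<sigma>: "\<And>j. j < p \<Longrightarrow> \<sigma> j < p \<and> v j = unit_vec (\<sigma> j)" by metis
  show "exchange_at p (cdet p) v u j"
  proof (cases "inj_on \<sigma> {..<p}")
    case True
    then obtain \<pi> where \<pi>: "\<pi> permutes {..<p}" "\<And>i. i < p \<Longrightarrow> \<pi> i = \<sigma> i"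
      using permutes_of_inj \<sigma> by (metis image_subsetI lessThan_iff)
    have v: "cdet p v = of_int (sign \<pi>)"
      using cdet_cong[of p v "unit_vec \<circ> \<pi>"] \<sigma> \<pi> cdet_permute[OF \<pi>(1), of unit_vec] cdet_unit[of p] by simp
    have vi: "cdet p (v(i := u j)) = of_int (sign \<pi>) * u j (\<pi> i)" if i: "i < p" for i
    proof -
      have "cdet p (v(i := u j)) = cdet p (unit_vec(\<pi> i := u j) \<circ> \<pi>)"
        proof (rule cdet_cong)
        fix k assume k: "k < p"
        have "\<pi> k = \<pi> i \<longleftrightarrow> k = i" using inj_eq[OF permutes_inj[OF \<pi>(1)]] .
        moreover have "v k = unit_vec (\<pi> k)" using \<sigma>[OF k] \<pi>(2)[OF k] by simp
        ultimately show "(v(i := u j)) k = (unit_vec(\<pi> i := u j) \<circ> \<pi>) k" by simp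
      qed
      also have "\<dots> = of_int (sign \<pi>) * cdet p (unit_vec(\<pi> i := u j))"
        by (rule cdet_permute[OF \<pi>(1)])
      also have "cdet p (unit_vec(\<pi> i := u j)) = u j (\<pi> i)"
        by (rule cdet_unit_column) (use \<sigma> \<pi> i in auto)
      finally show ?thesis .
    qed
    have "(\<Sum>i<p. cdet p (v(i := u j)) * cdet p (u(j := v i)))
        = of_int (sign \<pi>) * (\<Sum>i<p. u j (\<pi> i) * cdet p (u(j := unit_vec (\<pi> i))))"
      unfolding sum_distrib_left by (rule sum.cong) (use vi \<sigma> \<pi> in auto)
    also have "(\<Sum>i<p. u j (\<pi> i) * cdet p (u(j := unit_vec (\<pi> i))))
        = (\<Sum>k<p. u j k * cdet p (u(j := unit_vec k)))"
      by (rule sum.reindex_bij_betw[OF permutes_imp_bij[OF \<pi>(1)]])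
    also have "\<dots> = cdet p (u(j := u j))" by (rule cdet_expand_column[OF that, symmetric])
    finally show ?thesis by (simp only: exchange_at_def v fun_upd_triv)
  next
    case False
    then obtain a b where ab: "a < p" "b < p" "a \<noteq> b" "\<sigma> a = \<sigma> b" by (auto simp: inj_on_def)
    have vab: "v a = v b" using \<sigma> ab by simp
    have v: "cdet p v = 0" by (rule cdet_repeat[OF ab(1-3) vab])
    have other: "cdet p (v(i := u j)) = 0" if "i \<noteq> a" "i \<noteq> b" for i
      by (rule cdet_repeat[OF ab(1-3)]) (use that vab in auto)
    have t: "Transposition.transpose a b permutes {..<p}" using ab by (simp add: permutes_swap_id)
    have "v(a := u j) \<circ> Transposition.transpose a b = v(b := u j)"
      using vab ab by (auto simp: fun_eq_iff Transposition.transpose_def)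
    then have swap: "cdet p (v(b := u j)) = - cdet p (v(a := u j))"
      using cdet_permute[OF t, of "v(a := u j)"] ab by (simp add: sign_swap_id)
    have "(\<Sum>i<p. cdet p (v(i := u j)) * cdet p (u(j := v i)))
        = (\<Sum>i\<in>{a, b}. cdet p (v(i := u j)) * cdet p (u(j := v i)))"
      by (rule sum.mono_neutral_right) (use ab other in auto)
    also have "\<dots> = 0" using ab swap vab by simp
    finally show ?thesis using v by (simp add: exchange_at_def)
  qed
next
  fix v :: "nat \<Rightarrow> nat \<Rightarrow> complex" and s
  assume s: "s < p" and "\<And>b. b \<in> unit_vec ` {..<p} \<Longrightarrow> exchange_at p (cdet p) (v(s := b)) u j"
  then have hyp: "cdet p (v(s := unit_vec k)) * cdet p u =
      (\<Sum>i<p. cdet p (v(s := unit_vec k, i := u j)) * cdet p (u(j := (v(s := unit_vec k)) i)))"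
    if "k < p" for k using that by (auto simp: exchange_at_def)
  have "cdet p v * cdet p u = (\<Sum>k<p. v s k * (cdet p (v(s := unit_vec k)) * cdet p u))"
    using cdet_expand_column[OF s, of v "v s"] by (simp add: sum_distrib_left mult_ac)
  also have "\<dots> = (\<Sum>k<p. \<Sum>i<p. v s k * (cdet p (v(s := unit_vec k, i := u j)) * cdet p (u(j := (v(s := unit_vec k)) i))))"
    by (intro sum.cong refl) (simp add: hyp sum_distrib_left)
  also have "\<dots> = (\<Sum>i<p. \<Sum>k<p. v s k * (cdet p (v(s := unit_vec k, i := u j)) * cdet p (u(j := (v(s := unit_vec k)) i))))"
    by (rule sum.swap)
  also have "\<dots> = (\<Sum>i<p. cdet p (v(i := u j)) * cdet p (u(j := v i)))"
  proof (rule sum.cong[OF refl])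
    fix i assume i: "i \<in> {..<p}"
    show "(\<Sum>k<p. v s k * (cdet p (v(s := unit_vec k, i := u j)) * cdet p (u(j := (v(s := unit_vec k)) i))))
        = cdet p (v(i := u j)) * cdet p (u(j := v i))"
    proof (cases "i = s")
      case True
      have "cdet p (u(j := v s)) = (\<Sum>k<p. v s k * cdet p (u(j := unit_vec k)))"
        by (rule cdet_expand_column[OF that])
      then show ?thesis using True by (simp add: sum_distrib_left mult_ac)
    next
      case False
      have "cdet p (v(i := u j)) = cdet p (v(i := u j, s := v s))"
        using False by (auto intro!: cdet_cong)
      also have "\<dots> = (\<Sum>k<p. v s k * cdet p (v(i := u j, s := unit_vec k)))"
        by (rule cdet_expand_column[OF s])
      finally show ?thesis using False by (simp add: sum_distrib_left mult_ac fun_upd_twist)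
    qed
  qed
  finally show "exchange_at p (cdet p) v u j" by (simp add: exchange_at_def)
qed auto

lemma exchange_cdet_compose:
  assumes "j < p"
  shows "exchange_at p (\<lambda>x. cdet p (\<lambda>k. g (x k))) v u j"
proof -
  have upd: "(\<lambda>k. g ((x(i := b)) k)) = (\<lambda>k. g (x k))(i := g b)" for x i b by auto
  show ?thesis
    using exchange_cdet[OF assms, of "\<lambda>k. g (v k)" "\<lambda>k. g (u k)"] unfolding exchange_at_def upd by simp
qed

text \<open>The exchange relations imply decomposability: repeated exchange moves all entries of \<open>u\<close> into \<open>v\<close>, and collects the determinant of the coordinates \<open>\<phi> (v(i := u j)) / \<phi> v\<close> of \<open>u\<close> with
respect to \<open>v\<close>.\<close>

lemma exchange_normal_form:
  fixes \<phi> :: "(nat \<Rightarrow> 'a) \<Rightarrow> complex"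
  assumes \<phi>: "alternating_seq p \<phi>"
    and ex: "\<And>u j. (\<And>i. i < p \<Longrightarrow> u i \<in> A) \<Longrightarrow> j < p \<Longrightarrow> exchange_at p \<phi> v u j"
    and v: "\<phi> v \<noteq> 0" "\<And>i. i < p \<Longrightarrow> v i \<in> A" and u: "\<And>i. i < p \<Longrightarrow> u i \<in> A"
  shows "\<phi> u = \<phi> v * cdet p (\<lambda>j i. \<phi> (v(i := u j)) / \<phi> v)"
proof -
  define X where "X = (\<lambda>a i. \<phi> (v(i := a)) / \<phi> v)"
  have Xv: "X (v k) i = unit_vec k i" if "i < p" "k < p" for i k
  proof (cases "i = k")
    case True then show ?thesis using v by (simp add: X_def unit_vec_def)
  next
    case False
    have "\<phi> (v(i := v k)) = 0" by (rule alternating_seq_repeat[OF \<phi>, of i k]) (use that False in auto)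
    then show ?thesis using False by (simp add: X_def unit_vec_def)
  qed
  have "\<phi> u = \<phi> v * cdet p (\<lambda>j. X (u j))"
  proof (rule vanish_by_slots[where p = p and A = A and B = "v ` {..<p}" and P = "\<lambda>u. \<phi> u = \<phi> v * cdet p (\<lambda>j. X (u j))"])
    fix u assume "\<And>j. j < p \<Longrightarrow> u j \<in> v ` {..<p}"
    then have "\<forall>j<p. \<exists>k<p. u j = v k" by auto
    then obtain \<sigma> where \<sigma>: "\<And>j. j < p \<Longrightarrow> \<sigma> j < p \<and> u j = v (\<sigma> j)" by metis
    have "\<phi> u = \<phi> v * cdet p (\<lambda>j. unit_vec (\<sigma> j))"
      by (rule alternating_seq_selection[OF \<phi>]) (use \<sigma> in auto)
    also have "cdet p (\<lambda>j. unit_vec (\<sigma> j)) = cdet p (\<lambda>j. X (u j))"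
      by (rule cdet_cong_entries) (use \<sigma> Xv in auto)
    finally show "\<phi> u = \<phi> v * cdet p (\<lambda>j. X (u j))" .
  next
    fix u j assume uA: "\<And>i. i < p \<Longrightarrow> u i \<in> A" and j: "j < p"
      and "\<And>b. b \<in> v ` {..<p} \<Longrightarrow> \<phi> (u(j := b)) = \<phi> v * cdet p (\<lambda>k. X ((u(j := b)) k))"
    then have hyp: "\<phi> (u(j := v i)) = \<phi> v * cdet p ((\<lambda>k. X (u k))(j := unit_vec i))" if i: "i < p" for i
    proof -
      have "cdet p (\<lambda>k. X ((u(j := v i)) k)) = cdet p ((\<lambda>k. X (u k))(j := unit_vec i))"
        by (rule cdet_cong_entries) (use i Xv in auto)
      with that show ?thesis using \<open>\<And>b. b \<in> v ` {..<p} \<Longrightarrow> _\<close> by auto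
    qed
    have "\<phi> v * \<phi> u = (\<Sum>i<p. \<phi> (v(i := u j)) * \<phi> (u(j := v i)))"
      using ex[OF uA j] by (simp add: exchange_at_def)
    also have "\<dots> = \<phi> v * (\<phi> v * (\<Sum>i<p. X (u j) i * cdet p ((\<lambda>k. X (u k))(j := unit_vec i))))"
      unfolding sum_distrib_left by (rule sum.cong) (use v(1) in \<open>auto simp: hyp X_def\<close>)
    also have "(\<Sum>i<p. X (u j) i * cdet p ((\<lambda>k. X (u k))(j := unit_vec i))) = cdet p ((\<lambda>k. X (u k))(j := X (u j)))"
      by (rule cdet_expand_column[OF j, symmetric])
    also have "(\<lambda>k. X (u k))(j := X (u j)) = (\<lambda>k. X (u k))" by auto
    finally show "\<phi> u = \<phi> v * cdet p (\<lambda>j. X (u j))" using v(1) by simp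
  qed (use v u in auto)
  then show ?thesis by (simp add: X_def)
qed

text \<open>Cramer's rule, as the exchange relation against the identity matrix with one column replaced.\<close>

lemma cramer_columns:
  assumes "c < p"
  shows "cdet p x * b c = (\<Sum>i<p. cdet p (x(i := b)) * x i c)"
proof -
  show ?thesis using exchange_cdet[OF assms, of x "unit_vec(c := b)"] by (simp add: exchange_at_def cdet_unit_column[OF assms])
qed

lemma cdet_nonzero_imp_dual:
  fixes \<beta> :: "nat \<Rightarrow> (complex^'m::finite) \<Rightarrow> complex"
  assumes lin: "\<And>i. i < p \<Longrightarrow> Vector_Spaces.linear (*s) (*) (\<beta> i)"
    and nz: "cdet p (\<lambda>j i. \<beta> i (v j)) \<noteq> 0"
  shows "\<exists>w. \<forall>i<p. \<forall>j<p. \<beta> i (w j) = (if i = j then 1 else 0)"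
proof -
  let ?x = "\<lambda>j i. \<beta> i (v j)"
  define w where "w = (\<lambda>j. \<Sum>i<p. (cdet p (?x(i := unit_vec j)) / cdet p ?x) *s v i)"
  have "\<beta> c (w j) = (if c = j then 1 else 0)" if "c < p" "j < p" for c j
  proof -
    interpret Vector_Spaces.linear "(*s)" "(*)" "\<beta> c" by (rule lin[OF that(1)])
    have "\<beta> c (w j) = (\<Sum>i<p. (cdet p (?x(i := unit_vec j)) / cdet p ?x) * \<beta> c (v i))"
      by (simp add: w_def sum scale)
    also have "\<dots> = (\<Sum>i<p. cdet p (?x(i := unit_vec j)) * ?x i c) / cdet p ?x"
      by (simp add: sum_divide_distrib)
    also have "\<dots> = unit_vec j c"
      unfolding cramer_columns[OF that(1), of ?x "unit_vec j", symmetric] using nz by simp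
    finally show ?thesis by (simp add: unit_vec_def)
  qed
  then show ?thesis by blast
qed

lemma alternating_cdet_rows: "alternating_seq p (\<lambda>k. cdet p (\<lambda>j i. L i (k j)))"
  using alternating_seq_compose[OF alternating_seq_cdet, where g = "\<lambda>l i. L i l"] by simp

lemma cdet_zero_column:
  assumes "j < p" "\<And>i. i < p \<Longrightarrow> x j i = 0"
  shows "cdet p x = 0"
  using cdet_upd_sum[OF assms(1), where b = "x j" and L = "{} :: nat set" and x = x] assms(2) by simp

section \<open>Constant alternating forms\<close>

text \<open>The form with coefficients \<open>c\<close> on \<open>\<complex>\<^sup>r\<close>. A logarithmic form arises from it by inserting
the logarithmic differentials.\<close>

definition lform :: "nat \<Rightarrow> nat \<Rightarrow> (nat set \<Rightarrow> complex) \<Rightarrow> (nat \<Rightarrow> nat \<Rightarrow> complex) \<Rightarrow> complex" where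
  "lform p r c u =
     (\<Sum>J | J \<subseteq> {..<r} \<and> card J = p. c J * cdet p (\<lambda>j i. u j (sorted_list_of_set J ! i)))"

text \<open>The value on unit vectors: the coefficients of \<open>c\<close>, extended from increasing to arbitrary index
sequences by antisymmetry.\<close>

definition coef_seq :: "nat \<Rightarrow> nat \<Rightarrow> (nat set \<Rightarrow> complex) \<Rightarrow> (nat \<Rightarrow> nat) \<Rightarrow> complex" where
  "coef_seq p r c k = lform p r c (\<lambda>j. unit_vec (k j))"

definition minors :: "nat \<Rightarrow> (nat \<Rightarrow> nat \<Rightarrow> complex) \<Rightarrow> nat set \<Rightarrow> complex" where
  "minors p L J = cdet p (\<lambda>j i. L i (sorted_list_of_set J ! j))"

lemma finite_subsets_card [simp]: "finite {J. J \<subseteq> {..<r} \<and> card J = p}" for r :: nat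
  by (rule finite_subset[of _ "Pow {..<r}"]) auto

lemma sorted_list_nth_less:
  assumes "J \<subseteq> {..<r::nat}" "i < card J"
  shows "sorted_list_of_set J ! i \<in> J" "sorted_list_of_set J ! i < r"
proof -
  have "finite J" using finite_subset[OF assms(1)] by simp
  then show "sorted_list_of_set J ! i \<in> J"
    using assms(2) nth_mem[of i "sorted_list_of_set J"] by simp
  then show "sorted_list_of_set J ! i < r" using assms by auto
qed

lemma sorted_list_nth_surj:
  assumes "J \<subseteq> {..<r::nat}" "k \<in> J"
  obtains i where "i < card J" "sorted_list_of_set J ! i = k"
proof -
  have "finite J" using finite_subset[OF assms(1)] by simp
  then have "k \<in> set (sorted_list_of_set J)" using assms by simp
  then have "\<exists>i<card J. sorted_list_of_set J ! i = k" by (simp add: in_set_conv_nth)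
  then show ?thesis using that by blast
qed

lemma sorted_list_nth_inj:
  assumes "J \<subseteq> {..<r::nat}" "i < card J" "j < card J" "sorted_list_of_set J ! i = sorted_list_of_set J ! j"
  shows "i = j"
  using assms nth_eq_iff_index_eq[of "sorted_list_of_set J" i j] by simp

lemma alternating_lform: "alternating_seq p (lform p r c)"
proof -
  have "alternating_seq p (\<lambda>u. \<Sum>J | J \<subseteq> {..<r} \<and> card J = p. c J * cdet p (\<lambda>j i. u j (sorted_list_of_set J ! i)))"
    by (rule alternating_seq_sum, rule alternating_seq_scale, rule alternating_seq_compose[OF alternating_seq_cdet])
  then show ?thesis by (simp add: lform_def[abs_def])
qed

lemma alternating_coef_seq: "alternating_seq p (coef_seq p r c)"
  using alternating_seq_compose[OF alternating_lform, where g = unit_vec] by (simp add: coef_seq_def[abs_def])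

lemma lform_upd_sum:
  assumes j: "j < p" and b: "\<And>k. k < r \<Longrightarrow> b k = (\<Sum>l\<in>L. a l * g l k)"
  shows "lform p r c (u(j := b)) = (\<Sum>l\<in>L. a l * lform p r c (u(j := g l)))"
proof -
  have upd: "(\<lambda>k i. (u(j := y)) k (\<sigma> i)) = (\<lambda>k i. u k (\<sigma> i))(j := \<lambda>i. y (\<sigma> i))"
    for y :: "nat \<Rightarrow> complex" and \<sigma> :: "nat \<Rightarrow> nat" by auto
  have "lform p r c (u(j := b)) = (\<Sum>J | J \<subseteq> {..<r} \<and> card J = p. \<Sum>l\<in>L.
      a l * (c J * cdet p (\<lambda>k i. (u(j := g l)) k (sorted_list_of_set J ! i))))"
    unfolding lform_def
  proof (rule sum.cong[OF refl])
    fix J assume "J \<in> {J. J \<subseteq> {..<r} \<and> card J = p}"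
    then have J: "J \<subseteq> {..<r}" "card J = p" by auto
    have "cdet p (\<lambda>k i. (u(j := b)) k (sorted_list_of_set J ! i))
        = (\<Sum>l\<in>L. a l * cdet p (\<lambda>k i. (u(j := g l)) k (sorted_list_of_set J ! i)))"
      by (simp only: upd[of _ "\<lambda>i. sorted_list_of_set J ! i"], rule cdet_upd_sum[OF j])
         (use J sorted_list_nth_less b in auto)
    then show "c J * cdet p (\<lambda>k i. (u(j := b)) k (sorted_list_of_set J ! i)) =
        (\<Sum>l\<in>L. a l * (c J * cdet p (\<lambda>k i. (u(j := g l)) k (sorted_list_of_set J ! i))))"
      by (simp add: sum_distrib_left mult_ac)
  qed
  also have "\<dots> = (\<Sum>l\<in>L. \<Sum>J | J \<subseteq> {..<r} \<and> card J = p.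
      a l * (c J * cdet p (\<lambda>k i. (u(j := g l)) k (sorted_list_of_set J ! i))))"
    by (rule sum.swap)
  finally show ?thesis by (simp add: lform_def sum_distrib_left)
qed

lemma sum_unit_vec: "k < r \<Longrightarrow> (\<Sum>l<r. b l * unit_vec l k) = b k" for b :: "nat \<Rightarrow> complex"
  by (simp add: unit_vec_def if_distrib sum.delta' cong: if_cong)

lemma lform_expand_slot:
  assumes "j < p"
  shows "lform p r c u = (\<Sum>l<r. u j l * lform p r c (u(j := unit_vec l)))"
  using lform_upd_sum[OF assms, where r = r and b = "u j" and L = "{..<r}" and a = "u j" and g = unit_vec and c = c and u = u]
  by (simp add: sum_unit_vec)

lemma coef_seq_sorted:
  assumes J: "J \<subseteq> {..<r}" "card J = p"
  shows "coef_seq p r c (\<lambda>i. sorted_list_of_set J ! i) = c J"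
proof -
  have "coef_seq p r c (\<lambda>i. sorted_list_of_set J ! i) = (\<Sum>I | I \<subseteq> {..<r} \<and> card I = p.
      if I = J then c J else 0)"
    unfolding coef_seq_def lform_def
  proof (rule sum.cong[OF refl])
    fix I assume "I \<in> {I. I \<subseteq> {..<r} \<and> card I = p}"
    then have I: "I \<subseteq> {..<r}" "card I = p" by auto
    let ?x = "\<lambda>j i. unit_vec (sorted_list_of_set J ! j) (sorted_list_of_set I ! i)"
    show "c I * cdet p ?x = (if I = J then c J else 0)"
    proof (cases "I = J")
      case True
      have "cdet p ?x = cdet p unit_vec"
        by (rule cdet_cong_entries) (use True J sorted_list_nth_inj in \<open>auto simp: unit_vec_def\<close>)
      then show ?thesis using True cdet_unit by simp
    next
      case False
      then obtain k where k: "k \<in> I" "k \<notin> J"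
        using I J card_subset_eq[of J I] finite_subset[OF J(1)] by auto
      obtain i0 where i0: "i0 < p" "sorted_list_of_set I ! i0 = k"
        using sorted_list_nth_surj[OF I(1) k(1)] I(2) by auto
      have "?x (\<pi> i0) i0 = 0" if "\<pi> permutes {..<p}" for \<pi>
      proof -
        have "\<pi> i0 < card J" using permutes_in_image[OF that, of i0] i0 J by auto
        then show ?thesis using sorted_list_nth_less(1)[OF J(1)] i0 k by (auto simp: unit_vec_def)
      qed
      then have "(\<Prod>i<p. ?x (\<pi> i) i) = 0" if "\<pi> permutes {..<p}" for \<pi>
        using that i0(1) by (intro prod_zero) auto
      then have "cdet p ?x = 0" unfolding cdet_def by (intro sum.neutral) (simp del: prod_zero_iff)
      then show ?thesis using False by simp
    qed
  qed
  also have "\<dots> = c J" using J by (simp add: sum.delta)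
  finally show ?thesis .
qed

text \<open>An injective index sequence is a rearrangement of the increasing enumeration of its range.\<close>

lemma alternating_seq_nat_eqI:
  assumes \<phi>: "alternating_seq p \<phi>" and \<psi>: "alternating_seq p \<psi>"
    and eq: "\<And>J. J \<subseteq> {..<r::nat} \<Longrightarrow> card J = p \<Longrightarrow> \<phi> (\<lambda>i. sorted_list_of_set J ! i) = \<psi> (\<lambda>i. sorted_list_of_set J ! i)"
    and k: "\<And>j. j < p \<Longrightarrow> k j < r"
  shows "\<phi> k = \<psi> k"
proof (cases "inj_on k {..<p}")
  case True
  define J where "J = k ` {..<p}"
  have J: "J \<subseteq> {..<r}" "card J = p" using k True by (auto simp: J_def card_image)
  have "\<forall>j<p. \<exists>i<p. sorted_list_of_set J ! i = k j"
  proof (intro allI impI)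
    fix j assume "j < p"
    then have "k j \<in> J" by (simp add: J_def)
    then obtain i where "i < card J" "sorted_list_of_set J ! i = k j" by (rule sorted_list_nth_surj[OF J(1)])
    then show "\<exists>i<p. sorted_list_of_set J ! i = k j" using J(2) by blast
  qed
  then obtain \<sigma> where \<sigma>: "\<And>j. j < p \<Longrightarrow> \<sigma> j < p \<and> sorted_list_of_set J ! \<sigma> j = k j" by metis
  then have im: "\<sigma> ` {..<p} \<subseteq> {..<p}" by auto
  have "\<phi> k = \<phi> (\<lambda>i. sorted_list_of_set J ! i) * cdet p (\<lambda>j. unit_vec (\<sigma> j))"
    by (rule alternating_seq_selection[OF \<phi> _ im]) (simp add: \<sigma>)
  moreover have "\<psi> k = \<psi> (\<lambda>i. sorted_list_of_set J ! i) * cdet p (\<lambda>j. unit_vec (\<sigma> j))"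
    by (rule alternating_seq_selection[OF \<psi> _ im]) (simp add: \<sigma>)
  ultimately show ?thesis using eq[OF J] by simp
next
  case False
  then obtain a b where "a < p" "b < p" "a \<noteq> b" "k a = k b" by (auto simp: inj_on_def)
  then have "\<phi> k = 0" "\<psi> k = 0" by (auto intro: alternating_seq_repeat[OF \<phi>, of a b] alternating_seq_repeat[OF \<psi>, of a b])
  then show ?thesis by simp
qed

lemma coef_seq_minors:
  assumes "\<And>j. j < p \<Longrightarrow> k j < r"
  shows "coef_seq p r (minors p L) k = cdet p (\<lambda>j i. L i (k j))"
proof (rule alternating_seq_nat_eqI[where r = r and p = p and \<psi> = "\<lambda>k. cdet p (\<lambda>j i. L i (k j))"])
  show "alternating_seq p (\<lambda>k. cdet p (\<lambda>j i. L i (k j)))"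
    by (rule alternating_seq_compose[OF alternating_seq_cdet, where g = "\<lambda>l i. L i l"])
qed (use assms in \<open>auto simp: coef_seq_sorted minors_def alternating_coef_seq\<close>)

text \<open>The Cauchy-Binet formula: it suffices to compare two multilinear functions on unit vectors.\<close>

lemma lform_eq_cdet:
  assumes coef: "\<And>k. (\<And>j. j < p \<Longrightarrow> k j < r) \<Longrightarrow> coef_seq p r c k = cdet p (\<lambda>j i. L i (k j))"
  shows "lform p r c u = cdet p (\<lambda>j i. \<Sum>l<r. L i l * u j l)"
proof (rule vanish_by_slots[where p = p and A = UNIV and B = "unit_vec ` {..<r}"
      and P = "\<lambda>u. lform p r c u = cdet p (\<lambda>j i. \<Sum>l<r. L i l * u j l)"])
  fix u :: "nat \<Rightarrow> nat \<Rightarrow> complex" assume "\<And>j. j < p \<Longrightarrow> u j \<in> unit_vec ` {..<r}"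
  then have "\<forall>j<p. \<exists>k<r. u j = unit_vec k" by auto
  then obtain k where k: "\<And>j. j < p \<Longrightarrow> k j < r \<and> u j = unit_vec (k j)" by metis
  have "lform p r c u = coef_seq p r c k"
    unfolding coef_seq_def by (rule alternating_seq_cong[OF alternating_lform]) (simp add: k)
  also have "\<dots> = cdet p (\<lambda>j i. L i (k j))" using coef k by simp
  also have "\<dots> = cdet p (\<lambda>j i. \<Sum>l<r. L i l * u j l)"
  proof (rule cdet_cong_entries)
    fix i j assume "j < p"
    then have kj: "k j < r" "u j = unit_vec (k j)" using k by auto
    have "(\<Sum>l<r. L i l * u j l) = (\<Sum>l<r. if l = k j then L i l else 0)"
      by (rule sum.cong) (auto simp: kj unit_vec_def)
    then show "L i (k j) = (\<Sum>l<r. L i l * u j l)" using kj by (simp add: sum.delta)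
  qed
  finally show "lform p r c u = cdet p (\<lambda>j i. \<Sum>l<r. L i l * u j l)" .
next
  fix u :: "nat \<Rightarrow> nat \<Rightarrow> complex" and j
  assume j: "j < p" and hyp: "\<And>b. b \<in> unit_vec ` {..<r} \<Longrightarrow>
      lform p r c (u(j := b)) = cdet p (\<lambda>k i. \<Sum>l<r. L i l * (u(j := b)) k l)"
  let ?T = "\<lambda>y i. \<Sum>l<r. L i l * y l"
  have upd: "(\<lambda>k. ?T ((u(j := b)) k)) = (\<lambda>k. ?T (u k))(j := ?T b)" for b by auto
  have "lform p r c u = (\<Sum>m<r. u j m * lform p r c (u(j := unit_vec m)))"
    by (rule lform_expand_slot[OF j])
  also have "\<dots> = (\<Sum>m<r. u j m * cdet p ((\<lambda>k. ?T (u k))(j := ?T (unit_vec m))))"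
    by (rule sum.cong[OF refl]) (subst hyp, use upd in auto)
  also have "\<dots> = cdet p ((\<lambda>k. ?T (u k))(j := ?T (u j)))"
  proof (rule cdet_upd_sum[OF j, symmetric])
    fix i
    have "(\<Sum>m<r. u j m * ?T (unit_vec m) i) = (\<Sum>m<r. \<Sum>l<r. u j m * (L i l * unit_vec m l))"
      by (simp add: sum_distrib_left)
    also have "\<dots> = (\<Sum>l<r. L i l * (\<Sum>m<r. u j m * unit_vec m l))"
      by (subst sum.swap) (simp add: sum_distrib_left mult_ac)
    finally show "?T (u j) i = (\<Sum>m<r. u j m * ?T (unit_vec m) i)" by (simp add: sum_unit_vec)
  qed
  also have "(\<lambda>k. ?T (u k))(j := ?T (u j)) = (\<lambda>k. ?T (u k))" by auto
  finally show "lform p r c u = cdet p (\<lambda>k i. \<Sum>l<r. L i l * u k l)" .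
qed auto

lemma coef_seq_expand:
  assumes "j < p"
  shows "lform p r c ((\<lambda>k. unit_vec (s k))(j := b)) = (\<Sum>l<r. b l * coef_seq p r c (s(j := l)))"
proof -
  have "(\<lambda>k. unit_vec (s k))(j := unit_vec l) = (\<lambda>k. unit_vec ((s(j := l)) k))" for l by auto
  then show ?thesis
    using lform_expand_slot[OF assms, of r c "(\<lambda>k. unit_vec (s k))(j := b)"] by (simp add: coef_seq_def)
qed

lemma exchange_coef_seq_minors:
  assumes "\<And>i. i < p \<Longrightarrow> v i < r" "\<And>i. i < p \<Longrightarrow> u i < r" "j < p"
    and coef: "\<And>k. (\<And>j. j < p \<Longrightarrow> k j < r) \<Longrightarrow> coef_seq p r c k = cdet p (\<lambda>j i. L i (k j))"
  shows "exchange_at p (coef_seq p r c) v u j"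
  using exchange_cdet_compose[OF assms(3), of "\<lambda>l i. L i l" v u] assms unfolding exchange_at_def
  by (simp add: coef)

section \<open>Calculus of polynomial functions\<close>

lemma scaleR_eq_scaleC_vec: "c *\<^sub>R x = complex_of_real c *s (x :: complex^'m)"
  by (simp add: vec_eq_iff scaleR_conv_of_real[where 'a = complex])

lemma bounded_linear_complex_linear:
  fixes \<phi> :: "complex^'m::finite \<Rightarrow> complex"
  assumes "Vector_Spaces.linear (*s) (*) \<phi>"
  shows "bounded_linear \<phi>"
proof -
  interpret Vector_Spaces.linear "(*s)" "(*)" \<phi> by fact
  have "linear \<phi>"
    by (rule linearI) (simp_all add: add scaleR_eq_scaleC_vec scale scaleR_conv_of_real[where 'a = complex])
  then show ?thesis by (rule linear_conv_bounded_linear[THEN iffD1])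
qed

lemma complex_linearI:
  fixes \<phi> :: "complex^'m::finite \<Rightarrow> complex"
  assumes "\<And>x y. \<phi> (x + y) = \<phi> x + \<phi> y" "\<And>c x. \<phi> (c *s x) = c * \<phi> x"
  shows "Vector_Spaces.linear (*s) (*) \<phi>"
  by unfold_locales (simp_all add: assms algebra_simps)

lemma complex_linearD:
  fixes \<phi> :: "complex^'m::finite \<Rightarrow> complex"
  assumes "Vector_Spaces.linear (*s) (*) \<phi>"
  shows "\<phi> (x + y) = \<phi> x + \<phi> y" "\<phi> (c *s x) = c * \<phi> x" "\<phi> (\<Sum>i\<in>I. g i) = (\<Sum>i\<in>I. \<phi> (g i))" "\<phi> 0 = 0"
    "\<phi> (x - y) = \<phi> x - \<phi> y"
proof -
  interpret Vector_Spaces.linear "(*s)" "(*)" \<phi> by fact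
  show "\<phi> (x + y) = \<phi> x + \<phi> y" "\<phi> (c *s x) = c * \<phi> x" "\<phi> (\<Sum>i\<in>I. g i) = (\<Sum>i\<in>I. \<phi> (g i))" "\<phi> 0 = 0"
    "\<phi> (x - y) = \<phi> x - \<phi> y"
    by (simp_all add: add scale sum zero diff)
qed

text \<open>Complex linear first derivatives with polynomial coefficients and a symmetric second derivative,
bundled so that one induction on polynomials gives all of them.\<close>

definition first_two_derivatives ::
    "(complex^'m::finite \<Rightarrow> complex) \<Rightarrow> (complex^'m \<Rightarrow> complex^'m \<Rightarrow> complex) \<Rightarrow>
      (complex^'m \<Rightarrow> complex^'m \<Rightarrow> complex^'m \<Rightarrow> complex) \<Rightarrow> bool" where
  "first_two_derivatives P P' P'' \<longleftrightarrow>
     (\<forall>z. (P has_derivative P' z) (at z) \<and> Vector_Spaces.linear (*s) (*) (P' z)) \<and>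
     (\<forall>v. polynomial_fun (*s) (\<lambda>z. P' z v)) \<and>
     (\<forall>v z. ((\<lambda>z. P' z v) has_derivative P'' z v) (at z)) \<and>
     (\<forall>v w z. P'' z v w = P'' z w v)"

lemma first_two_derivativesD:
  assumes "first_two_derivatives P P' P''"
  shows "(P has_derivative P' z) (at z)" "Vector_Spaces.linear (*s) (*) (P' z)"
    "polynomial_fun (*s) (\<lambda>z. P' z v)" "((\<lambda>z. P' z v) has_derivative P'' z v) (at z)"
    "P'' z v w = P'' z w v"
  using assms by (simp_all add: first_two_derivatives_def)

lemma polynomial_first_two_derivatives:
  fixes P :: "complex^'m::finite \<Rightarrow> complex"
  assumes "polynomial_fun (*s) P"
  shows "\<exists>P' P''. first_two_derivatives P P' P''"
  using assms
proof induction
  case (linear \<phi>)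
  have "(\<phi> has_derivative \<phi>) (at z)" for z
    using bounded_linear_complex_linear[OF linear] by (rule bounded_linear_imp_has_derivative)
  then have "first_two_derivatives \<phi> (\<lambda>z. \<phi>) (\<lambda>z v w. 0)"
    using linear by (auto simp: first_two_derivatives_def intro: polynomial_fun.const)
  then show ?case by blast
next
  case (const c)
  have "first_two_derivatives (\<lambda>_. c) (\<lambda>z v. 0) (\<lambda>z v w. 0)"
    by (simp add: first_two_derivatives_def polynomial_fun.const complex_linearI)
  then show ?case by blast
next
  case (add P Q)
  from add.IH obtain P' P'' Q' Q'' where
    "first_two_derivatives P P' P''" "first_two_derivatives Q Q' Q''" by blast
  note P = first_two_derivativesD[OF this(1)] and Q = first_two_derivativesD[OF this(2)]
  show ?case
    unfolding first_two_derivatives_def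
  proof (intro exI conjI allI)
    fix z v w
    show "((\<lambda>x. P x + Q x) has_derivative (\<lambda>v. P' z v + Q' z v)) (at z)"
      by (intro has_derivative_add P Q)
    show "Vector_Spaces.linear (*s) (*) (\<lambda>v. P' z v + Q' z v)"
      by (rule complex_linearI) (simp_all add: complex_linearD(1,2)[OF P(2)] complex_linearD(1,2)[OF Q(2)] algebra_simps)
    show "polynomial_fun (*s) (\<lambda>z. P' z v + Q' z v)" by (intro polynomial_fun.add P Q)
    show "((\<lambda>z. P' z v + Q' z v) has_derivative (\<lambda>w. P'' z v w + Q'' z v w)) (at z)"
      by (intro has_derivative_add P Q)
    show "P'' z v w + Q'' z v w = P'' z w v + Q'' z w v" by (simp only: P(5)[of z v w] Q(5)[of z v w])
  qed
next
  case (mult P Q)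
  from mult.IH obtain P' P'' Q' Q'' where
    "first_two_derivatives P P' P''" "first_two_derivatives Q Q' Q''" by blast
  note P = first_two_derivativesD[OF this(1)] and Q = first_two_derivativesD[OF this(2)]
  show ?case
    unfolding first_two_derivatives_def
  proof (intro exI conjI allI)
    fix z v w
    show "((\<lambda>x. P x * Q x) has_derivative (\<lambda>v. P z * Q' z v + P' z v * Q z)) (at z)"
      by (intro has_derivative_mult P Q)
    show "Vector_Spaces.linear (*s) (*) (\<lambda>v. P z * Q' z v + P' z v * Q z)"
      by (rule complex_linearI) (simp_all add: complex_linearD(1,2)[OF P(2)] complex_linearD(1,2)[OF Q(2)] algebra_simps)
    show "polynomial_fun (*s) (\<lambda>z. P z * Q' z v + P' z v * Q z)"
      by (intro polynomial_fun.add polynomial_fun.mult P Q mult)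
    show "((\<lambda>z. P z * Q' z v + P' z v * Q z) has_derivative
       (\<lambda>w. (P z * Q'' z v w + P' z w * Q' z v) + (P' z v * Q' z w + P'' z v w * Q z))) (at z)"
      by (intro has_derivative_add has_derivative_mult P Q)
    show "(P z * Q'' z v w + P' z w * Q' z v) + (P' z v * Q' z w + P'' z v w * Q z)
        = (P z * Q'' z w v + P' z v * Q' z w) + (P' z w * Q' z v + P'' z w v * Q z)"
      using P(5)[of z v w] Q(5)[of z v w] by simp
  qed
qed

lemma
  fixes P :: "complex^'m::finite \<Rightarrow> complex"
  assumes "polynomial_fun (*s) P"
  shows polynomial_has_derivative: "(P has_derivative frechet_derivative P (at z)) (at z)"
    and polynomial_derivative_linear: "Vector_Spaces.linear (*s) (*) (frechet_derivative P (at z))"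
    and polynomial_derivative_polynomial: "polynomial_fun (*s) (\<lambda>z. frechet_derivative P (at z) v)"
    and polynomial_derivative_symmetric:
      "frechet_derivative (\<lambda>z. frechet_derivative P (at z) v) (at z) w
       = frechet_derivative (\<lambda>z. frechet_derivative P (at z) w) (at z) v"
proof -
  obtain P' P'' where "first_two_derivatives P P' P''"
    using polynomial_first_two_derivatives[OF assms] by blast
  note P = first_two_derivativesD[OF this]
  have eq: "frechet_derivative P (at z) = P' z" for z using frechet_derivative_at[OF P(1)] by simp
  show "(P has_derivative frechet_derivative P (at z)) (at z)" using P eq by simp
  show "Vector_Spaces.linear (*s) (*) (frechet_derivative P (at z))" using P eq by simp
  show "polynomial_fun (*s) (\<lambda>z. frechet_derivative P (at z) v)" using P eq by simp
  have "frechet_derivative (\<lambda>z. P' z v) (at z) = P'' z v" for v z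
    using frechet_derivative_at[OF P(4)] by simp
  then show "frechet_derivative (\<lambda>z. frechet_derivative P (at z) v) (at z) w
       = frechet_derivative (\<lambda>z. frechet_derivative P (at z) w) (at z) v"
    using P(5)[of z v w] eq by simp
qed

lemma polynomial_continuous:
  fixes P :: "complex^'m::finite \<Rightarrow> complex"
  assumes "polynomial_fun (*s) P"
  shows "continuous_on S P"
  using polynomial_has_derivative[OF assms] has_derivative_continuous
  by (metis continuous_at_imp_continuous_on)

lemma polynomial_tendsto:
  fixes P :: "complex^'m::finite \<Rightarrow> complex"
  assumes "polynomial_fun (*s) P" "(g \<longlongrightarrow> z) F"
  shows "((\<lambda>t. P (g t)) \<longlongrightarrow> P z) F"
  using isCont_tendsto_compose[OF has_derivative_continuous[OF polynomial_has_derivative[OF assms(1)]] assms(2)] .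

lemma polynomial_along_curve:
  assumes P: "polynomial_fun scl P"
    and lin: "\<And>\<phi>. Vector_Spaces.linear scl (*) \<phi> \<Longrightarrow> \<exists>q. \<forall>t. \<phi> (\<gamma> t) = poly q t"
  shows "\<exists>q. \<forall>t. P (\<gamma> t) = poly q t"
  using P
proof induction
  case (const c)
  show ?case by (intro exI[of _ "[:c:]"]) simp
next
  case (add P Q)
  then obtain q1 q2 where "\<forall>t. P (\<gamma> t) = poly q1 t" "\<forall>t. Q (\<gamma> t) = poly q2 t" by blast
  then show ?case by (intro exI[of _ "q1 + q2"]) simp
next
  case (mult P Q)
  then obtain q1 q2 where "\<forall>t. P (\<gamma> t) = poly q1 t" "\<forall>t. Q (\<gamma> t) = poly q2 t" by blast
  then show ?case by (intro exI[of _ "q1 * q2"]) simp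
qed (rule lin)

lemma polynomial_on_line:
  assumes P: "polynomial_fun scl P"
  shows "\<exists>q. \<forall>t. P (a + scl t b) = poly q t"
proof (rule polynomial_along_curve[OF P])
  fix \<phi> assume "Vector_Spaces.linear scl (*) \<phi>"
  then interpret Vector_Spaces.linear scl "(*)" \<phi> .
  show "\<exists>q. \<forall>t. \<phi> (a + scl t b) = poly q t"
    by (intro exI[of _ "[:\<phi> a, \<phi> b:]"]) (simp add: add scale)
qed

lemma polynomial_fun_sum:
  "finite S \<Longrightarrow> (\<And>i. i \<in> S \<Longrightarrow> polynomial_fun scl (P i)) \<Longrightarrow> polynomial_fun scl (\<lambda>x. \<Sum>i\<in>S. P i x)"
  by (induction S rule: finite_induct) (auto intro: polynomial_fun.const polynomial_fun.add)

lemma polynomial_fun_prod: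
  "finite S \<Longrightarrow> (\<And>i. i \<in> S \<Longrightarrow> polynomial_fun scl (P i)) \<Longrightarrow> polynomial_fun scl (\<lambda>x. \<Prod>i\<in>S. P i x)"
  by (induction S rule: finite_induct) (auto intro: polynomial_fun.const polynomial_fun.mult)

lemma bounded_linear_scale_vec: "bounded_linear (\<lambda>t. t *s (v :: complex^'m::finite))"
proof -
  have "linear (\<lambda>t. t *s v)"
    by (rule linearI) (simp_all add: vec_eq_iff algebra_simps scaleR_conv_of_real[where 'a = complex])
  then show ?thesis by (rule linear_conv_bounded_linear[THEN iffD1])
qed

lemma has_derivative_scale_vec: "((\<lambda>t. a + t *s (v :: complex^'m::finite)) has_derivative (\<lambda>h. h *s v)) (at t)"
  using has_derivative_add[OF has_derivative_const bounded_linear_imp_has_derivative[OF bounded_linear_scale_vec]]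
  by fastforce

text \<open>Differentiation of \<open>P (t z) = t\<^sup>d P z\<close> at \<open>t = 1\<close>.\<close>

lemma euler_identity:
  fixes P :: "complex^'m::finite \<Rightarrow> complex"
  assumes "homogeneous_poly (*s) d P"
  shows "frechet_derivative P (at z) z = of_nat d * P z"
proof -
  have P: "polynomial_fun (*s) P" "\<And>c x. P (c *s x) = c ^ d * P x"
    using assms by (auto simp: homogeneous_poly_def)
  have "((\<lambda>t. P (0 + t *s z)) has_derivative (\<lambda>h. frechet_derivative P (at (0 + 1 *s z)) (h *s z))) (at 1)"
    by (rule has_derivative_compose[OF has_derivative_scale_vec polynomial_has_derivative[OF P(1)]])
  then have 1: "((\<lambda>t. t ^ d * P z) has_derivative (\<lambda>h. frechet_derivative P (at z) (h *s z))) (at 1)"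
    by (simp add: P(2))
  have "((\<lambda>t. t ^ d * P z) has_field_derivative of_nat d * P z) (at 1)"
    by (auto intro!: derivative_eq_intros)
  then have "((\<lambda>t. t ^ d * P z) has_derivative (\<lambda>h. of_nat d * P z * h)) (at 1)"
    by (simp add: has_field_derivative_def)
  from has_derivative_unique[OF 1 this] have "frechet_derivative P (at z) (1 *s z) = of_nat d * P z * 1"
    by meson
  then show ?thesis by simp
qed

text \<open>On the line through \<open>y\<close> and a point where \<open>F\<close> does not vanish, \<open>F\<close> has only finitely many zeros.\<close>

lemma polynomial_nonzero_dense:
  fixes F :: "complex^'m::finite \<Rightarrow> complex"
  assumes F: "polynomial_fun (*s) F" and w: "F w \<noteq> 0" and W: "open W" "y \<in> W"
  shows "\<exists>x\<in>W. F x \<noteq> 0"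
proof -
  obtain q where q: "\<And>t. F (y + t *s (w - y)) = poly q t"
    using polynomial_on_line[OF F, of y "w - y"] by blast
  have "poly q 1 \<noteq> 0" using w q[of 1, symmetric] by simp
  then have "q \<noteq> 0" by auto
  then have "finite {t. poly q t = 0}" by (rule poly_roots_finite)
  moreover have "((\<lambda>t. y + t *s (w - y)) \<longlongrightarrow> y + 0 *s (w - y)) (at 0)"
    using has_derivative_continuous[OF has_derivative_scale_vec[of y "w - y" 0]] unfolding isCont_def .
  then have "\<forall>\<^sub>F t in at 0. y + t *s (w - y) \<in> W"
    using W by (intro topological_tendstoD) simp_all
  then obtain e where e: "e > 0" "\<And>t. t \<noteq> 0 \<Longrightarrow> dist t 0 < e \<Longrightarrow> y + t *s (w - y) \<in> W"
    unfolding eventually_at by blast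
  moreover have "infinite (ball (0::complex) e - {0})"
    using uncountable_ball[OF \<open>e > 0\<close>, of "0::complex"] countable_finite by auto
  ultimately obtain t where "t \<in> ball 0 e - {0}" "t \<notin> {t. poly q t = 0}"
    by (meson finite_subset subsetI)
  then show ?thesis using e q by (intro bexI[of _ "y + t *s (w - y)"]) (auto simp: dist_commute)
qed

lemma continuous_eq_off_zero_set:
  fixes F :: "complex^'m::finite \<Rightarrow> complex" and g h :: "complex^'m \<Rightarrow> complex"
  assumes F: "polynomial_fun (*s) F" "F w \<noteq> 0" and W: "open W"
    and g: "continuous_on W g" and h: "continuous_on W h" and eq: "\<And>y. y \<in> W \<Longrightarrow> F y \<noteq> 0 \<Longrightarrow> g y = h y"
    and y: "y \<in> W"
  shows "g y = h y"
proof (rule ccontr)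
  assume neq: "g y \<noteq> h y"
  have "open {x \<in> W. g x - h x \<noteq> 0}"
    using continuous_open_preimage[OF continuous_on_diff[OF g h] W, of "- {0}"]
    by (simp add: Int_def vimage_def open_Compl)
  then obtain x where "x \<in> W" "g x \<noteq> h x" "F x \<noteq> 0"
    using polynomial_nonzero_dense[OF F, of "{x \<in> W. g x - h x \<noteq> 0}" y] neq y by auto
  then show False using eq by blast
qed

section \<open>Strictly ordinary divisors\<close>

locale ordinary_divisor =
  fixes f :: "nat \<Rightarrow> complex^'m::finite \<Rightarrow> complex" and r :: nat
  assumes homogeneous: "\<forall>i<r. \<exists>d. homogeneous_poly (*s) d (f i)"
    and ordinary: "strictly_ordinary f r"
begin

definition deg :: "nat \<Rightarrow> nat" where
  "deg i = (SOME d. homogeneous_poly (*s) d (f i))"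

lemma homogeneous_deg: "i < r \<Longrightarrow> homogeneous_poly (*s) (deg i) (f i)"
  unfolding deg_def using homogeneous by (metis someI)

lemma polynomial_f: "i < r \<Longrightarrow> polynomial_fun (*s) (f i)"
  using homogeneous_deg by (auto simp: homogeneous_poly_def)

lemma f_scale: "i < r \<Longrightarrow> f i (c *s z) = c ^ deg i * f i z"
  using homogeneous_deg by (auto simp: homogeneous_poly_def)

lemma f_0: "i < r \<Longrightarrow> f i 0 = 0"
  using ordinary by (auto simp: strictly_ordinary_def)

lemma polynomial_product: "polynomial_fun (*s) (\<lambda>z. \<Prod>i<r. f i z)"
  by (rule polynomial_fun_prod) (auto intro: polynomial_f)

lemma not_polar_iff: "z \<notin> polar_divisor f r \<longleftrightarrow> (\<Prod>i<r. f i z) \<noteq> 0"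
  by (auto simp: polar_divisor_def)

text \<open>The zero polynomial is divisible by the square of a coordinate, hence not reduced.\<close>

lemma product_nonzero: "\<exists>w. (\<Prod>i<r. f i w) \<noteq> 0"
proof (rule ccontr)
  assume "\<not> ?thesis"
  then have zero: "(\<Prod>i<r. f i z) = 0" for z by blast
  fix i0 :: 'm
  define g where "g = (\<lambda>z :: complex^'m. z $ i0)"
  have g: "polynomial_fun (*s) g"
    by (rule polynomial_fun.linear) (auto simp: g_def intro: complex_linearI)
  have red: "reduced_poly (\<lambda>z. \<Prod>i<r. f i z)" using ordinary by (simp add: strictly_ordinary_def)
  have "g constant_on UNIV"
    by (rule red[unfolded reduced_poly_def, rule_format, of g "\<lambda>_. 0"])
       (simp add: zero g polynomial_fun.const)
  then obtain y where "\<And>x. g x = y" unfolding constant_on_def by blast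
  then have "g 0 = g (axis i0 1)" by (simp only:)
  then show False by (simp add: g_def axis_def)
qed

lemma deg_pos:
  assumes "i < r" shows "deg i > 0"
proof (rule ccontr)
  assume "\<not> deg i > 0"
  then have "f i z = 0" for z using f_scale[OF assms, of 0 z] f_0[OF assms] by simp
  then have "(\<Prod>i<r. f i z) = 0" for z using assms by (intro prod_zero) auto
  then show False using product_nonzero by blast
qed

text \<open>The logarithmic differentials of all \<open>f k\<close> at once, as a linear map from the tangent space at \<open>z\<close>
to \<open>\<complex>\<^sup>r\<close>.\<close>

definition dlog :: "complex^'m \<Rightarrow> complex^'m \<Rightarrow> nat \<Rightarrow> complex" where
  "dlog z x k = frechet_derivative (f k) (at z) x / f k z"

lemma log_form_eq_lform:
  "z \<notin> polar_divisor f r \<Longrightarrow> log_form f r p c z v = lform p r c (\<lambda>j. dlog z (v j))"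
  by (simp add: log_form_def lform_def wedge1_eq_cdet differential_def dlog_def)

lemma dlog_radial: "z \<notin> polar_divisor f r \<Longrightarrow> k < r \<Longrightarrow> dlog z z k = of_nat (deg k)"
  using euler_identity[OF homogeneous_deg, of k z] by (auto simp: dlog_def polar_divisor_def)

text \<open>The normal crossing condition in the form in which it is used: the differentials of the
functions vanishing at \<open>z\<close> are part of a basis of the dual space.\<close>

lemma dual_vectors:
  assumes I: "I \<subseteq> {..<r}" "card I < CARD('m)" and z: "z \<noteq> 0" "\<And>i. i \<in> I \<Longrightarrow> f i z = 0"
  shows "\<exists>w. \<forall>i\<in>I. \<forall>j\<in>I. frechet_derivative (f i) (at z) (w j) = (if i = j then 1 else 0)"
proof (cases "I = {}")
  case False
  let ?L = "sorted_list_of_set I"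
  have "wedge1 (card I) (\<lambda>j. differential (f (?L ! j)) z) \<noteq> 0"
    using ordinary I z False by (auto simp: strictly_ordinary_def)
  then obtain v where "wedge1 (card I) (\<lambda>j. differential (f (?L ! j)) z) v \<noteq> 0"
    by (auto simp: fun_eq_iff)
  then have "cdet (card I) (\<lambda>j i. frechet_derivative (f (?L ! i)) (at z) (v j)) \<noteq> 0"
    by (simp add: wedge1_eq_cdet differential_def)
  then have "\<exists>w. \<forall>i<card I. \<forall>j<card I. frechet_derivative (f (?L ! i)) (at z) (w j) = (if i = j then 1 else 0)"
    by (rule cdet_nonzero_imp_dual[rotated])
       (auto intro!: polynomial_derivative_linear polynomial_f sorted_list_nth_less(2)[OF I(1)])
  then obtain w where w: "\<And>i j. i < card I \<Longrightarrow> j < card I \<Longrightarrow>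
      frechet_derivative (f (?L ! i)) (at z) (w j) = (if i = j then 1 else 0)" by blast
  have "\<forall>k\<in>I. \<exists>i<card I. ?L ! i = k" using sorted_list_nth_surj[OF I(1)] by blast
  then obtain \<sigma> where \<sigma>: "\<And>k. k \<in> I \<Longrightarrow> \<sigma> k < card I \<and> ?L ! \<sigma> k = k" by metis
  have "frechet_derivative (f i) (at z) (w (\<sigma> j)) = (if i = j then 1 else 0)" if "i \<in> I" "j \<in> I" for i j
  proof -
    have "\<sigma> i = \<sigma> j \<longleftrightarrow> i = j" using \<sigma>[OF that(1)] \<sigma>[OF that(2)] by metis
    then show ?thesis using w[of "\<sigma> i" "\<sigma> j"] \<sigma>[OF that(1)] \<sigma>[OF that(2)] by simp
  qed
  then show ?thesis by (intro exI[of _ "\<lambda>j. w (\<sigma> j)"]) blast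
qed simp

end

section \<open>Common zeros\<close>

context ordinary_divisor begin

lemma kernel_vector:
  fixes \<beta> :: "nat \<Rightarrow> complex^'m \<Rightarrow> complex"
  assumes Q: "finite Q" "card Q < CARD('m)"
    and lin: "\<And>a. a \<in> Q \<Longrightarrow> Vector_Spaces.linear (*s) (*) (\<beta> a)"
    and dual: "\<And>a b. a \<in> Q \<Longrightarrow> b \<in> Q \<Longrightarrow> \<beta> a (w b) = (if a = b then 1 else 0)"
  shows "\<exists>v. v \<noteq> 0 \<and> (\<forall>a\<in>Q. \<beta> a v = 0)"
proof (rule ccontr)
  assume no: "\<not> ?thesis"
  have "x \<in> vec.span (w ` Q)" for x :: "complex^'m"
  proof -
    let ?v = "x - (\<Sum>b\<in>Q. \<beta> b x *s w b)"
    have "\<beta> a ?v = 0" if a: "a \<in> Q" for a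
    proof -
      have "\<beta> a ?v = \<beta> a x - (\<Sum>b\<in>Q. \<beta> b x * \<beta> a (w b))"
        by (simp add: complex_linearD[OF lin[OF a]])
      also have "(\<Sum>b\<in>Q. \<beta> b x * \<beta> a (w b)) = (\<Sum>b\<in>Q. if b = a then \<beta> b x else 0)"
        by (rule sum.cong) (auto simp: dual a)
      finally show ?thesis using Q a by simp
    qed
    then have "?v = 0" using no by blast
    then have "x = (\<Sum>b\<in>Q. \<beta> b x *s w b)" by simp
    also have "\<dots> \<in> vec.span (w ` Q)"
      by (intro vec.span_sum vec.span_scale vec.span_base) auto
    finally show ?thesis .
  qed
  then have "vec.dim (UNIV :: (complex^'m) set) \<le> card (w ` Q)"
    using Q by (intro vec.dim_le_card) auto
  also have "\<dots> \<le> card Q" by (rule card_image_le[OF Q(1)])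
  finally show False using Q(2) by (simp add: card_cart_basis)
qed

text \<open>The implicit function theorem for independent differentials, in the weak form of one nonconstant
holomorphic curve in the common level set through \<open>z0\<close>.\<close>

lemma curve_in_level_set:
  assumes Q: "Q \<subseteq> {..<r}" "card Q < CARD('m)"
    and dual: "\<And>a b. a \<in> Q \<Longrightarrow> b \<in> Q \<Longrightarrow> frechet_derivative (f a) (at z0) (w b) = (if a = b then 1 else 0)"
  obtains \<epsilon> \<phi> t0 where "\<epsilon> > 0" "\<phi> 0 = z0" "t0 \<in> ball 0 \<epsilon>" "\<phi> t0 \<noteq> z0"
    "\<forall>t\<in>ball (0::complex) \<epsilon>. \<forall>a\<in>Q. f a (\<phi> t) = f a z0"
    "\<forall>i. (\<lambda>t. (\<phi> t :: complex^'m) $ i) holomorphic_on ball 0 \<epsilon>"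
proof -
  have fin: "finite Q" using finite_subset[OF Q(1)] by simp
  define \<beta> where "\<beta> a = frechet_derivative (f a) (at z0)" for a
  have pf: "polynomial_fun (*s) (f a)" if "a \<in> Q" for a using that Q polynomial_f by auto
  have lin: "Vector_Spaces.linear (*s) (*) (frechet_derivative (f a) (at z))" if "a \<in> Q" for a z
    by (rule polynomial_derivative_linear[OF pf[OF that]])
  \<comment> \<open>The derivative of \<open>G\<close> at \<open>z0\<close> is the identity, and \<open>\<beta> a \<circ> G = f a\<close> for \<open>a \<in> Q\<close>: the map \<open>G\<close> straightens
    the level sets into affine subspaces without a completion of the differentials to a basis.\<close>
  define G where "G z = z + (\<Sum>a\<in>Q. (f a z - \<beta> a z) *s w a)" for z
  define DG where "DG z x = x + (\<Sum>a\<in>Q. (frechet_derivative (f a) (at z) x - \<beta> a x) *s w a)" for z x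
  have DG: "(G has_derivative DG z) (at z)" for z
    unfolding G_def[abs_def] DG_def[abs_def]
    by (intro has_derivative_add has_derivative_ident has_derivative_sum
        bounded_linear.has_derivative[OF bounded_linear_scale_vec] has_derivative_diff
        polynomial_has_derivative pf bounded_linear_imp_has_derivative bounded_linear_complex_linear)
       (auto simp: \<beta>_def lin)
  have DG_lin: "DG z (c *s x) = c *s DG z x" for z c x
    unfolding DG_def \<beta>_def
    by (simp add: complex_linearD(2)[OF lin] vec.scale_right_distrib vec.scale_sum_right
        vec.scale_right_diff_distrib vec.scale_left_diff_distrib)
  have bl: "bounded_linear (DG z)" for z using DG has_derivative_bounded_linear by blast
  define G' where "G' z = Blinfun (DG z)" for z
  have G': "blinfun_apply (G' z) = DG z" for z
    unfolding G'_def by (rule bounded_linear_Blinfun_apply[OF bl])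
  have cont: "continuous_on UNIV G'"
  proof (rule continuous_on_blinfun_componentwise)
    fix x :: "complex^'m"
    show "continuous_on UNIV (\<lambda>z. blinfun_apply (G' z) x)"
      unfolding G' DG_def
      by (intro continuous_on_add continuous_on_const continuous_on_sum
          bounded_linear.continuous_on[OF bounded_linear_scale_vec] continuous_on_diff
          polynomial_continuous polynomial_derivative_polynomial pf)
  qed
  have "id_blinfun o\<^sub>L G' z0 = id_blinfun"
    by (rule blinfun_eqI) (simp add: G' DG_def \<beta>_def)
  then obtain U' V g g' where U: "z0 \<in> U'" and V: "open V" "G z0 \<in> V" and hom: "homeomorphism U' V G g"
    and g: "\<And>y. y \<in> V \<Longrightarrow> (g has_derivative (g' y)) (at y)"
      "\<And>y. y \<in> V \<Longrightarrow> g' y = inv (blinfun_apply (G' (g y)))"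
      "\<And>y. y \<in> V \<Longrightarrow> bij (blinfun_apply (G' (g y)))"
    using inverse_function_theorem[OF open_UNIV, of G G' z0 id_blinfun] DG cont
    by (metis G' UNIV_I)
  obtain v where v: "v \<noteq> 0" "\<And>a. a \<in> Q \<Longrightarrow> \<beta> a v = 0"
    using kernel_vector[OF fin Q(2), of \<beta> w] lin dual by (auto simp: \<beta>_def)
  have \<beta>G: "\<beta> a (G z) = f a z" if a: "a \<in> Q" for a z
  proof -
    have "\<beta> a (G z) = \<beta> a z + (\<Sum>b\<in>Q. (f b z - \<beta> b z) * \<beta> a (w b))"
      unfolding G_def by (simp add: complex_linearD[OF lin[OF a, of z0, folded \<beta>_def]] algebra_simps)
    also have "(\<Sum>b\<in>Q. (f b z - \<beta> b z) * \<beta> a (w b)) = (\<Sum>b\<in>Q. if b = a then f b z - \<beta> b z else 0)"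
      by (rule sum.cong) (auto simp: dual a \<beta>_def)
    finally show ?thesis using fin a by simp
  qed
  define l where "l t = G z0 + t *s v" for t
  have "(l \<longlongrightarrow> l 0) (at 0)"
    using has_derivative_continuous[OF has_derivative_scale_vec[of "G z0" v 0]]
    unfolding isCont_def l_def[abs_def] .
  moreover have l0: "l 0 = G z0" by (simp add: l_def)
  ultimately have "\<forall>\<^sub>F t in at 0. l t \<in> V" using V by (intro topological_tendstoD) auto
  then obtain \<epsilon> where e: "\<epsilon> > 0" "\<And>t. t \<noteq> 0 \<Longrightarrow> dist t 0 < \<epsilon> \<Longrightarrow> l t \<in> V"
    unfolding eventually_at by blast
  have lV: "l t \<in> V" if "t \<in> ball 0 \<epsilon>" for t
    using e(2)[of t] that V(2) l0 by (cases "t = 0") (auto simp: dist_commute)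
  define \<phi> where "\<phi> t = g (l t)" for t
  have G\<phi>: "G (\<phi> t) = l t" if "t \<in> ball 0 \<epsilon>" for t
    using hom lV[OF that] by (simp add: \<phi>_def homeomorphism_def)
  show ?thesis
  proof
    show "\<epsilon> > 0" by fact
    show "\<phi> 0 = z0" using hom U by (simp add: \<phi>_def l0 homeomorphism_def)
    have in_ball: "of_real (\<epsilon> / 2) \<in> ball (0::complex) \<epsilon>" using e(1) by simp
    show "of_real (\<epsilon> / 2) \<in> ball (0::complex) \<epsilon>" by (rule in_ball)
    show "\<phi> (of_real (\<epsilon> / 2)) \<noteq> z0"
      using G\<phi>[OF in_ball] v(1) e(1) by (auto simp: l_def)
    have "f a (\<phi> t) = f a z0" if "t \<in> ball 0 \<epsilon>" "a \<in> Q" for t a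
      using \<beta>G[OF that(2), of "\<phi> t"] \<beta>G[OF that(2), of z0] G\<phi>[OF that(1)] v(2)[OF that(2)]
        complex_linearD(1,2)[OF lin[OF that(2), of z0, folded \<beta>_def]]
      by (simp add: l_def)
    then show "\<forall>t\<in>ball (0::complex) \<epsilon>. \<forall>a\<in>Q. f a (\<phi> t) = f a z0" by blast
    have "(\<lambda>t. \<phi> t $ i) holomorphic_on ball 0 \<epsilon>" for i
    proof (rule holomorphic_onI)
      fix t :: complex assume t: "t \<in> ball 0 \<epsilon>"
      have scale: "g' (l t) (h *s v) = h *s g' (l t) v" for h
      proof -
        have b: "bij (DG (g (l t)))" and inv: "g' (l t) = inv (DG (g (l t)))"
          using g(2,3)[OF lV[OF t]] by (simp_all add: G')
        have "DG (g (l t)) (h *s g' (l t) v) = h *s v"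
          unfolding DG_lin inv using b by (simp add: bij_is_surj surj_f_inv_f)
        then show ?thesis unfolding inv by (metis b bij_inv_eq_iff)
      qed
      have "(\<phi> has_derivative (\<lambda>h. g' (l t) (h *s v))) (at t)"
        using has_derivative_compose[OF has_derivative_scale_vec[of "G z0" v t], of g "g' (l t)"] g(1)[OF lV[OF t]]
        unfolding \<phi>_def[abs_def] l_def[abs_def] by simp
      then have "((\<lambda>t. \<phi> t $ i) has_derivative (\<lambda>h. g' (l t) (h *s v) $ i)) (at t)"
        by (rule bounded_linear.has_derivative[OF bounded_linear_vec_nth])
      then have "((\<lambda>t. \<phi> t $ i) has_field_derivative g' (l t) v $ i) (at t)"
        unfolding has_field_derivative_def scale by (simp add: mult_commute_abs)
      then show "(\<lambda>t. \<phi> t $ i) field_differentiable at t within ball 0 \<epsilon>"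
        using field_differentiable_at_within field_differentiable_def by blast
    qed
    then show "\<forall>i. (\<lambda>t. \<phi> t $ i) holomorphic_on ball 0 \<epsilon>" by blast
  qed
qed

text \<open>A nonconstant holomorphic curve cannot reach its maximal distance from the origin in its interior:
the function \<open>h\<close>, the hermitian product with the initial point, would attain its maximal real part
there, and equality in the Cauchy-Schwarz inequality makes the curve constant.\<close>

lemma norm_maximal_curve_constant:
  fixes \<phi> :: "complex \<Rightarrow> complex^'m"
  assumes hol: "\<And>i. (\<lambda>t. \<phi> t $ i) holomorphic_on ball 0 \<epsilon>" and e: "\<epsilon> > 0"
    and le: "\<And>t. t \<in> ball 0 \<epsilon> \<Longrightarrow> norm (\<phi> t) \<le> norm (\<phi> 0)" and t: "t \<in> ball 0 \<epsilon>"
  shows "\<phi> t = \<phi> 0"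
proof -
  define h where "h t = (\<Sum>i\<in>UNIV. \<phi> t $ i * cnj (\<phi> 0 $ i))" for t
  have Re_h: "Re (h t) = inner (\<phi> t) (\<phi> 0)" for t
    by (simp add: h_def inner_vec_def inner_complex_def)
  \<comment> \<open>The modulus of \<open>exp (h t)\<close> depends on the real part of \<open>h t\<close> only, which is the real inner product.\<close>
  have "(\<lambda>t. exp (h t)) holomorphic_on ball 0 \<epsilon>"
    unfolding h_def by (intro holomorphic_intros hol)
  moreover have "norm (exp (h t)) \<le> norm (exp (h 0))" if "t \<in> ball 0 \<epsilon>" for t
  proof -
    have "inner (\<phi> t) (\<phi> 0) \<le> norm (\<phi> t) * norm (\<phi> 0)" by (rule norm_cauchy_schwarz)
    also have "\<dots> \<le> norm (\<phi> 0) * norm (\<phi> 0)" using le[OF that] by (intro mult_right_mono) auto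
    finally show ?thesis by (simp add: Re_h power2_norm_eq_inner[symmetric] power2_eq_square)
  qed
  ultimately have "(\<lambda>t. exp (h t)) constant_on ball 0 \<epsilon>"
    using e by (intro maximum_modulus_principle[where U = "ball 0 \<epsilon>" and \<xi> = 0]) auto
  then have "exp (h t) = exp (h 0)" using t e unfolding constant_on_def by (metis centre_in_ball)
  then have "norm (exp (h t)) = norm (exp (h 0))" by simp
  then have eq: "inner (\<phi> t) (\<phi> 0) = inner (\<phi> 0) (\<phi> 0)" by (simp add: Re_h)
  have "(norm (\<phi> t - \<phi> 0))\<^sup>2 = (norm (\<phi> t))\<^sup>2 - (norm (\<phi> 0))\<^sup>2"
    using eq by (simp add: power2_norm_eq_inner inner_diff_left inner_diff_right inner_commute)
  also have "\<dots> \<le> 0" using le[OF t] by (simp add: power_mono)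
  finally show ?thesis by simp
qed

text \<open>Induction on \<open>I\<close>. If \<open>f k\<close> had no zero on the cone \<open>X = {f i = 0 for i \<in> I}\<close> away from the origin, then
by homogeneity \<open>K = X \<inter> {f k = 1}\<close> would be compact. At a point of \<open>K\<close> of maximal norm the differentials
of all these functions are independent, by Euler's identity, and there are fewer of them than
coordinates, so \<open>K\<close> contains a nonconstant holomorphic curve through that point.\<close>

lemma common_zero:
  assumes "I \<subseteq> {..<r}" "card I < CARD('m)"
  shows "\<exists>z. z \<noteq> 0 \<and> (\<forall>i\<in>I. f i z = 0)"
proof -
  have "finite I" using finite_subset[OF assms(1)] by simp
  then show ?thesis using assms
  proof (induction I rule: finite_induct)
    case empty
    have "axis (undefined::'m) (1::complex) \<noteq> 0" by simp
    then show ?case by blast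
  next
    case (insert k I)
    then obtain z1 where z1: "z1 \<noteq> 0" "\<And>i. i \<in> I \<Longrightarrow> f i z1 = 0" by auto
    have k: "k < r" and I: "I \<subseteq> {..<r}" "card I < CARD('m)" using insert by auto
    show ?case
    proof (rule ccontr)
      assume "\<not> ?case"
      then have nz: "f k z \<noteq> 0" if "z \<noteq> 0" "\<And>i. i \<in> I \<Longrightarrow> f i z = 0" for z using that by auto
      define X where "X = {z. \<forall>i\<in>I. f i z = 0}"
      have X_scale: "c *s z \<in> X" if "z \<in> X" for c z
        using that I f_scale by (auto simp: X_def)
      have "closed (\<Inter>i\<in>I. {z. f i z = 0})"
      proof (intro closed_INT ballI closed_Collect_eq)
        fix i assume "i \<in> I"
        then show "continuous_on UNIV (f i)" using I by (auto intro: polynomial_continuous polynomial_f)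
      qed auto
      also have "(\<Inter>i\<in>I. {z. f i z = 0}) = X" by (auto simp: X_def)
      finally have "closed X" .
      have cont_k: "continuous_on S (f k)" for S by (rule polynomial_continuous[OF polynomial_f[OF k]])
      define K where "K = {z \<in> X. f k z = 1}"
      have "closed {z. f k z = 1}" by (intro closed_Collect_eq cont_k continuous_on_const)
      then have "closed K" using closed_Int[OF \<open>closed X\<close>] by (simp add: K_def Collect_conj_eq)
      have unit: "inverse (of_real (norm z)) *s z \<in> X \<inter> sphere 0 1" if "z \<in> X" "z \<noteq> 0" for z
      proof -
        have "inverse (of_real (norm z)) *s z = inverse (norm z) *\<^sub>R z"
          by (simp add: scaleR_eq_scaleC_vec)
        then have "norm (inverse (of_real (norm z)) *s z) = 1" using that(2) by simp
        then show ?thesis using X_scale[OF that(1)] by simp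
      qed
      have "compact (X \<inter> sphere 0 1)" using \<open>closed X\<close> by (intro closed_Int_compact) auto
      moreover have "X \<inter> sphere 0 1 \<noteq> {}" using unit[of z1] z1 by (auto simp: X_def)
      ultimately obtain u where u: "u \<in> X \<inter> sphere 0 1"
        and u_min: "\<And>z. z \<in> X \<inter> sphere 0 1 \<Longrightarrow> norm (f k u) \<le> norm (f k z)"
        using continuous_attains_inf[of "X \<inter> sphere 0 1" "\<lambda>z. norm (f k z)"] cont_k
        by (metis continuous_on_norm)
      define \<delta> where "\<delta> = norm (f k u)"
      have \<delta>: "\<delta> > 0" using nz[of u] u by (force simp: \<delta>_def X_def)
      have "norm z \<le> max 1 (1 / \<delta>)" if "z \<in> K" for z
      proof (cases "norm z \<le> 1")
        case False
        have z: "z \<in> X" "f k z = 1" "z \<noteq> 0" using that f_0[OF k] by (auto simp: K_def)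
        have "\<delta> \<le> norm (f k (inverse (of_real (norm z)) *s z))"
          unfolding \<delta>_def by (rule u_min[OF unit[OF z(1,3)]])
        also have "\<dots> = inverse (norm z) ^ deg k"
          by (simp add: f_scale[OF k] z(2) norm_power norm_inverse)
        finally have "\<delta> \<le> 1 / norm z ^ deg k" by (simp add: power_inverse divide_inverse)
        moreover have "norm z ^ deg k > 0" using z(3) by simp
        ultimately have "\<delta> * norm z ^ deg k \<le> 1" by (simp add: pos_le_divide_eq)
        moreover have "norm z ^ 1 \<le> norm z ^ deg k"
          using False deg_pos[OF k] by (intro power_increasing) auto
        then have "\<delta> * norm z \<le> \<delta> * norm z ^ deg k" using \<delta> by simp
        ultimately have "\<delta> * norm z \<le> 1" by linarith
        then have "norm z \<le> 1 / \<delta>" using \<delta> by (simp add: pos_le_divide_eq mult.commute)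
        then show ?thesis by simp
      qed auto
      then have "bounded K" by (auto simp: bounded_iff)
      then have "compact K" using \<open>closed K\<close> by (simp add: compact_eq_bounded_closed)
      moreover have "K \<noteq> {}"
      proof -
        have fz1: "f k z1 \<noteq> 0" using nz z1 by blast
        define c where "c = exp (Ln (inverse (f k z1)) / of_nat (deg k))"
        have "c ^ deg k = exp (Ln (inverse (f k z1)))"
          unfolding c_def using deg_pos[OF k] by (simp add: exp_of_nat_mult[symmetric])
        then have "f k (c *s z1) = 1" using fz1 by (simp add: f_scale[OF k])
        then show ?thesis using X_scale[of z1 c] z1 by (auto simp: K_def X_def)
      qed
      ultimately obtain z0 where z0: "z0 \<in> K" and max: "\<And>z. z \<in> K \<Longrightarrow> norm z \<le> norm z0"
        using continuous_attains_sup[of K norm] by (metis continuous_on_norm_id)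
      have z0': "z0 \<noteq> 0" "\<And>i. i \<in> I \<Longrightarrow> f i z0 = 0" "f k z0 = 1"
        using z0 f_0[OF k] by (auto simp: K_def X_def)
      obtain w where w: "\<And>i j. i \<in> I \<Longrightarrow> j \<in> I \<Longrightarrow>
          frechet_derivative (f i) (at z0) (w j) = (if i = j then 1 else 0)"
        using dual_vectors[OF I z0'(1,2)] by blast
      let ?D = "\<lambda>i. frechet_derivative (f i) (at z0)"
      have lin: "Vector_Spaces.linear (*s) (*) (?D i)" if "i < r" for i
        by (rule polynomial_derivative_linear[OF polynomial_f[OF that]])
      have radial: "?D i z0 = of_nat (deg i) * f i z0" if "i < r" for i
        by (rule euler_identity[OF homogeneous_deg[OF that]])
      \<comment> \<open>By Euler's identity the radial direction is dual to \<open>f k\<close> and tangent to the cone.\<close>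
      define wk where "wk = inverse (of_nat (deg k)) *s z0"
      have wk: "?D k wk = 1" "\<And>i. i \<in> I \<Longrightarrow> ?D i wk = 0"
        using I z0' deg_pos[OF k] k
        by (auto simp: wk_def complex_linearD(2)[OF lin] radial)
      define w' where "w' j = (if j = k then wk else w j - ?D k (w j) *s wk)" for j
      have dual: "?D a (w' b) = (if a = b then 1 else 0)" if "a \<in> insert k I" "b \<in> insert k I" for a b
        using that insert.hyps(2) I k w wk
        by (auto simp: w'_def complex_linearD[OF lin])
      obtain \<epsilon> \<phi> t0 where \<phi>: "\<epsilon> > 0" "\<phi> 0 = z0" "t0 \<in> ball 0 \<epsilon>" "\<phi> t0 \<noteq> z0"
        "\<forall>t\<in>ball (0::complex) \<epsilon>. \<forall>a\<in>insert k I. f a (\<phi> t) = f a z0"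
        "\<forall>i. (\<lambda>t. (\<phi> t :: complex^'m) $ i) holomorphic_on ball 0 \<epsilon>"
        by (rule curve_in_level_set[OF insert.prems dual])
      have "norm (\<phi> t) \<le> norm (\<phi> 0)" if "t \<in> ball 0 \<epsilon>" for t
      proof -
        have "\<forall>a\<in>insert k I. f a (\<phi> t) = f a z0" using \<phi>(5) that by blast
        then have "\<phi> t \<in> K" using z0' by (simp add: K_def X_def)
        then show ?thesis using max \<phi>(2) by simp
      qed
      then have "\<phi> t0 = \<phi> 0"
        using norm_maximal_curve_constant[OF \<phi>(6)[rule_format] \<phi>(1) _ \<phi>(3)] by blast
      then show False using \<phi>(2,4) by simp
    qed
  qed
qed

end

section \<open>Logarithmic frames\<close>

lemma cdet_tendsto:
  assumes "\<And>i j. i < p \<Longrightarrow> j < p \<Longrightarrow> ((\<lambda>t. x t j i) \<longlongrightarrow> y j i) F"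
  shows "((\<lambda>t. cdet p (x t)) \<longlongrightarrow> cdet p y) F"
  unfolding cdet_def
proof (intro tendsto_sum tendsto_mult tendsto_const tendsto_prod)
  fix \<pi> i assume "\<pi> \<in> {\<pi>. \<pi> permutes {..<p}}" "i \<in> {..<p}"
  then show "((\<lambda>t. x t (\<pi> i) i) \<longlongrightarrow> y (\<pi> i) i) F"
    using permutes_in_image[of \<pi> "{..<p}" i] by (intro assms) auto
qed

lemma lform_tendsto:
  assumes "\<And>j k. j < p \<Longrightarrow> k < r \<Longrightarrow> ((\<lambda>t. u t j k) \<longlongrightarrow> u0 j k) F"
  shows "((\<lambda>t. lform p r c (u t)) \<longlongrightarrow> lform p r c u0) F"
  unfolding lform_def
  by (intro tendsto_sum tendsto_mult tendsto_const cdet_tendsto assms)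
     (auto intro: sorted_list_nth_less(2))

text \<open>Decomposability is a closed condition. The values of \<open>V t\<close> play the role of vectors converging to
basis vectors that are labelled by \<open>A\<close>.\<close>

lemma exchange_at_tendsto:
  assumes lim: "\<And>w. (\<And>i. i < p \<Longrightarrow> w i \<in> A) \<Longrightarrow> ((\<lambda>t. \<phi> t (\<lambda>i. V t (w i))) \<longlongrightarrow> \<psi> w) F"
    and ev: "\<forall>\<^sub>F t in F. exchange_at p (\<phi> t) (\<lambda>i. V t (v i)) (\<lambda>i. V t (u i)) j"
    and F: "F \<noteq> bot" and v: "\<And>i. i < p \<Longrightarrow> v i \<in> A" and u: "\<And>i. i < p \<Longrightarrow> u i \<in> A" and j: "j < p"
  shows "exchange_at p \<psi> v u j"
proof -
  have upd: "(\<lambda>k. V t (w k))(i := V t a) = (\<lambda>k. V t ((w(i := a)) k))" for t w i a by auto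
  have "((\<lambda>t. \<phi> t (\<lambda>i. V t (v i)) * \<phi> t (\<lambda>i. V t (u i))) \<longlongrightarrow> \<psi> v * \<psi> u) F"
    by (intro tendsto_mult lim v u)
  note lim_left = this
  have lim_right: "((\<lambda>t. \<Sum>i<p. \<phi> t (\<lambda>k. V t ((v(i := u j)) k)) * \<phi> t (\<lambda>k. V t ((u(j := v i)) k)))
      \<longlongrightarrow> (\<Sum>i<p. \<psi> (v(i := u j)) * \<psi> (u(j := v i)))) F"
    by (intro tendsto_sum tendsto_mult lim) (use v u j in auto)
  have "\<forall>\<^sub>F t in F. \<phi> t (\<lambda>i. V t (v i)) * \<phi> t (\<lambda>i. V t (u i))
      = (\<Sum>i<p. \<phi> t (\<lambda>k. V t ((v(i := u j)) k)) * \<phi> t (\<lambda>k. V t ((u(j := v i)) k)))"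
    using ev by (simp only: exchange_at_def upd)
  from Lim_transform_eventually[OF lim_left this] show ?thesis
    unfolding exchange_at_def by (rule tendsto_unique[OF F _ lim_right])
qed

context ordinary_divisor begin

lemma common_zeros_few:
  assumes "z \<noteq> 0" shows "card {i. i < r \<and> f i z = 0} < CARD('m)"
proof (rule ccontr)
  assume ge: "\<not> ?thesis"
  let ?K = "{i. i < r \<and> f i z = 0}"
  have "?K \<noteq> {}"
  proof
    assume "?K = {}"
    then have "card ?K = 0" by (simp only: card.empty)
    with ge zero_less_card_finite[where 'a = 'm] show False by simp
  qed
  moreover have "?K \<subseteq> {..<r}" by auto
  ultimately have "{z. \<forall>i\<in>?K. f i z = 0} = {0}"
    using ordinary ge unfolding strictly_ordinary_def by (meson not_less)
  then show False using assms by blast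
qed

text \<open>Points \<open>Z t\<close> off the divisor with tangent vectors \<open>V t i\<close> that become dual to the logarithmic
differentials as \<open>t\<close> tends to \<open>0\<close>.\<close>

definition log_frame :: "nat set \<Rightarrow> (complex \<Rightarrow> complex^'m) \<Rightarrow> (complex \<Rightarrow> nat \<Rightarrow> complex^'m) \<Rightarrow> bool" where
  "log_frame I Z V \<longleftrightarrow>
     (\<forall>\<^sub>F t in at 0. Z t \<notin> polar_divisor f r) \<and>
     (\<forall>i\<in>I. \<forall>k<r. ((\<lambda>t. dlog (Z t) (V t i) k) \<longlongrightarrow> unit_vec i k) (at 0))"

lemma log_frameD:
  assumes "log_frame I Z V"
  shows "\<forall>\<^sub>F t in at 0. Z t \<notin> polar_divisor f r"
    and "i \<in> I \<Longrightarrow> k < r \<Longrightarrow> ((\<lambda>t. dlog (Z t) (V t i) k) \<longlongrightarrow> unit_vec i k) (at 0)"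
  using assms by (auto simp: log_frame_def)

text \<open>In coordinates that include the functions vanishing at \<open>z0\<close>, the vectors \<open>V t i\<close> approximate the
logarithmic vector fields \<open>f\<^sub>i \<partial>/\<partial>f\<^sub>i\<close>.\<close>

lemma log_frame_exists:
  assumes I: "I \<subseteq> {..<r}" "card I < CARD('m)"
  obtains Z V where "log_frame I Z V"
proof -
  obtain z0 where z0: "z0 \<noteq> 0" "\<And>i. i \<in> I \<Longrightarrow> f i z0 = 0" using common_zero[OF I] by blast
  define K where "K = {i. i < r \<and> f i z0 = 0}"
  have K: "K \<subseteq> {..<r}" "card K < CARD('m)" "I \<subseteq> K" "finite K"
    using common_zeros_few[OF z0(1)] z0 I by (auto simp: K_def)
  obtain w where w: "\<And>i j. i \<in> K \<Longrightarrow> j \<in> K \<Longrightarrow>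
      frechet_derivative (f i) (at z0) (w j) = (if i = j then 1 else 0)"
    using dual_vectors[OF K(1,2) z0(1)] by (auto simp: K_def)
  \<comment> \<open>All indices of functions vanishing at \<open>z0\<close> have to be treated, not only those in \<open>I\<close>. In direction \<open>W\<close>
    each of these functions equals \<open>t\<close> to first order, so that quotients of two of them tend to \<open>1\<close>.\<close>
  define W where "W = (\<Sum>j\<in>K. w j)"
  define Z where "Z t = z0 + t *s W" for t
  have lim_Z: "(Z \<longlongrightarrow> z0) (at 0)"
    using has_derivative_continuous[OF has_derivative_scale_vec[of z0 W 0]]
    by (simp add: isCont_def Z_def[abs_def])
  have lin: "Vector_Spaces.linear (*s) (*) (frechet_derivative (f k) (at z))" if "k < r" for k z
    by (rule polynomial_derivative_linear[OF polynomial_f[OF that]])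
  have quot: "((\<lambda>t. f k (Z t) / t) \<longlongrightarrow> 1) (at 0)" if k: "k \<in> K" for k
  proof -
    have kr: "k < r" using k K by auto
    have "frechet_derivative (f k) (at z0) W = (\<Sum>j\<in>K. if k = j then 1 else 0)"
      unfolding W_def complex_linearD(3)[OF lin[OF kr]] by (rule sum.cong) (auto simp: w k)
    then have one: "frechet_derivative (f k) (at z0) W = 1" using k K(4) by simp
    have "((\<lambda>t. f k (Z t)) has_derivative (\<lambda>h. frechet_derivative (f k) (at (Z 0)) (h *s W))) (at 0)"
      unfolding Z_def by (rule has_derivative_compose[OF has_derivative_scale_vec polynomial_has_derivative[OF polynomial_f[OF kr]]])
    moreover have "(\<lambda>h. frechet_derivative (f k) (at (Z 0)) (h *s W)) = (*) 1"
      by (simp add: fun_eq_iff complex_linearD(2)[OF lin[OF kr]] Z_def one)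
    ultimately have "((\<lambda>t. f k (Z t)) has_field_derivative 1) (at 0)"
      by (simp only: has_field_derivative_def)
    then show ?thesis using k by (simp add: has_field_derivative_iff Z_def K_def)
  qed
  have away: "((\<lambda>t. f k (Z t)) \<longlongrightarrow> f k z0) (at 0)" if "k < r" for k
    by (rule polynomial_tendsto[OF polynomial_f[OF that] lim_Z])
  have deriv: "((\<lambda>t. frechet_derivative (f k) (at (Z t)) x) \<longlongrightarrow> frechet_derivative (f k) (at z0) x) (at 0)" if "k < r" for k x
    by (rule polynomial_tendsto[OF polynomial_derivative_polynomial[OF polynomial_f[OF that]] lim_Z])
  define V where "V t i = t *s w i" for t i
  have "log_frame I Z V"
    unfolding log_frame_def
  proof (intro conjI ballI allI impI)
    have "\<forall>\<^sub>F t in at 0. f k (Z t) \<noteq> 0" if k: "k < r" for k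
    proof (cases "k \<in> K")
      case True
      have "\<forall>\<^sub>F t in at 0. f k (Z t) / t \<noteq> 0"
        by (rule tendsto_imp_eventually_ne[OF quot[OF True]]) simp
      then show ?thesis by eventually_elim auto
    next
      case False
      then show ?thesis using tendsto_imp_eventually_ne[OF away[OF k]] k by (auto simp: K_def)
    qed
    then have "\<forall>\<^sub>F t in at 0. \<forall>k\<in>{..<r}. f k (Z t) \<noteq> 0" by (intro eventually_ball_finite) auto
    then show "\<forall>\<^sub>F t in at 0. Z t \<notin> polar_divisor f r"
      by eventually_elim (auto simp: polar_divisor_def)
  next
    fix i k assume i: "i \<in> I" and k: "k < r"
    have iK: "i \<in> K" using i K by auto
    have V: "dlog (Z t) (V t i) k = t * frechet_derivative (f k) (at (Z t)) (w i) / f k (Z t)" for t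
      by (simp add: dlog_def V_def complex_linearD(2)[OF lin[OF k]])
    show "((\<lambda>t. dlog (Z t) (V t i) k) \<longlongrightarrow> unit_vec i k) (at 0)"
    proof (cases "k \<in> K")
      case True
      have "((\<lambda>t. frechet_derivative (f k) (at (Z t)) (w i) / (f k (Z t) / t)) \<longlongrightarrow> (if k = i then 1 else 0) / 1) (at 0)"
        using deriv[OF k, of "w i"] w[OF True iK] by (intro tendsto_divide quot[OF True]) auto
      then show ?thesis unfolding V unit_vec_def
        by (simp add: mult.commute)
    next
      case False
      then have "((\<lambda>t. t * frechet_derivative (f k) (at (Z t)) (w i) / f k (Z t)) \<longlongrightarrow>
          0 * frechet_derivative (f k) (at z0) (w i) / f k z0) (at 0)"
        using k by (intro tendsto_divide tendsto_mult deriv away tendsto_ident_at) (auto simp: K_def)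
      moreover have "unit_vec i k = 0" using False iK by (auto simp: unit_vec_def)
      ultimately show ?thesis unfolding V by simp
    qed
  qed
  then show ?thesis by (rule that)
qed

lemma log_form_limit:
  assumes frame: "log_frame I Z V"
    and k: "\<And>j. j < p \<Longrightarrow> k j \<in> I"
  shows "((\<lambda>t. log_form f r p c (Z t) (\<lambda>j. V t (k j))) \<longlongrightarrow> coef_seq p r c k) (at 0)"
proof (rule Lim_transform_eventually)
  show "((\<lambda>t. lform p r c (\<lambda>j. dlog (Z t) (V t (k j)))) \<longlongrightarrow> coef_seq p r c k) (at 0)"
    unfolding coef_seq_def by (intro lform_tendsto log_frameD(2)[OF frame] k)
  show "\<forall>\<^sub>F t in at 0. lform p r c (\<lambda>j. dlog (Z t) (V t (k j))) = log_form f r p c (Z t) (\<lambda>j. V t (k j))"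
    using log_frameD(1)[OF frame] by eventually_elim (simp add: log_form_eq_lform)
qed

text \<open>The coefficient \<open>c J\<close> is the limit of the values of the form on a logarithmic frame for \<open>J\<close>.\<close>

lemma log_form_inj:
  assumes p: "p < CARD('m)" and eq: "log_form f r p c = log_form f r p c'" and J: "J \<subseteq> {..<r}" "card J = p"
  shows "c J = c' J"
proof -
  obtain Z V where frame: "log_frame J Z V"
    by (rule log_frame_exists[of J]) (use J p in auto)
  have "((\<lambda>t. log_form f r p c (Z t) (\<lambda>j. V t (sorted_list_of_set J ! j))) \<longlongrightarrow> c J) (at 0)" for c
    using log_form_limit[OF frame, where p = p and k = "\<lambda>j. sorted_list_of_set J ! j" and c = c] J sorted_list_nth_less(1)[OF J(1)]
    by (simp add: coef_seq_sorted)
  from this[of c] this[of c'] show ?thesis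
    unfolding eq by (intro tendsto_unique[of "at (0::complex)"]) auto
qed

text \<open>Only the indices that occur in \<open>v\<close> and \<open>u\<close> need a frame, and a frame exists for fewer than
\<open>CARD('m)\<close> indices.\<close>

lemma exchange_coef_seq_limit:
  assumes ex: "\<And>z v u. z \<notin> polar_divisor f r \<Longrightarrow> exchange_at p (log_form f r p c z) v u j"
    and I: "card (v ` {..<p} \<union> u ` {..<p}) < CARD('m)" and j: "j < p"
    and v: "\<And>i. i < p \<Longrightarrow> v i < r" and u: "\<And>i. i < p \<Longrightarrow> u i < r"
  shows "exchange_at p (coef_seq p r c) v u j"
proof -
  define I where "I = v ` {..<p} \<union> u ` {..<p}"
  have "I \<subseteq> {..<r}" "card I < CARD('m)" using assms by (auto simp: I_def)
  then obtain Z V where frame: "log_frame I Z V"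
    by (rule log_frame_exists)
  show ?thesis
  proof (rule exchange_at_tendsto[where A = I and V = V and \<phi> = "\<lambda>t. log_form f r p c (Z t)" and F = "at 0"])
    show "((\<lambda>t. log_form f r p c (Z t) (\<lambda>i. V t (w i))) \<longlongrightarrow> coef_seq p r c w) (at 0)"
      if "\<And>i. i < p \<Longrightarrow> w i \<in> I" for w
      by (rule log_form_limit[OF frame that])
    show "\<forall>\<^sub>F t in at 0. exchange_at p (log_form f r p c (Z t)) (\<lambda>i. V t (v i)) (\<lambda>i. V t (u i)) j"
      using log_frameD(1)[OF frame] by eventually_elim (rule ex)
  qed (use j in \<open>auto simp: I_def\<close>)
qed

lemma log_form_slot_radial:
  assumes R: "interior_product radial_field (log_form f r p c) = 0" and z: "z \<notin> polar_divisor f r" and j: "j < p"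
  shows "log_form f r p c z (v(j := z)) = 0"
proof -
  let ?t = "Transposition.transpose 0 j"
  have alt: "alternating_seq p (log_form f r p c z)"
    using alternating_seq_compose[OF alternating_lform, of p r c "dlog z"]
    by (simp add: log_form_eq_lform[OF z, abs_def])
  have "?t permutes {..<p}" using j by (simp add: permutes_swap_id)
  then have perm: "log_form f r p c z ((v(j := z)) \<circ> ?t) = of_int (sign ?t) * log_form f r p c z (v(j := z))"
    by (rule alternating_seq_permute[OF alt])
  have "(v(j := z)) \<circ> ?t = case_nat (radial_field z) (\<lambda>i. ((v(j := z)) \<circ> ?t) (Suc i))"
    by (auto simp: fun_eq_iff radial_field_def split: nat.split)
  moreover have "interior_product radial_field (log_form f r p c) z w = 0" for w
    by (simp add: R)
  ultimately have "log_form f r p c z ((v(j := z)) \<circ> ?t) = 0"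
    unfolding interior_product_def by metis
  then show ?thesis using perm by simp
qed

text \<open>The radial vector has the constant image \<open>(deg l)\<^sub>l\<close> under the logarithmic differentials, so inserting
it into one slot and a frame into the others yields the contraction in the limit.\<close>

lemma coef_seq_contraction:
  assumes p: "p < CARD('m)" and R: "interior_product radial_field (log_form f r p c) = 0"
    and s: "\<And>i. i < p \<Longrightarrow> s i < r" and j: "j < p"
  shows "(\<Sum>l<r. of_nat (deg l) * coef_seq p r c (s(j := l))) = 0"
proof -
  have "card (s ` {..<p}) \<le> p" using card_image_le[of "{..<p}" s] by simp
  then have "s ` {..<p} \<subseteq> {..<r}" "card (s ` {..<p}) < CARD('m)" using s p by auto
  then obtain Z V where frame: "log_frame (s ` {..<p}) Z V"
    by (rule log_frame_exists)
  let ?u = "\<lambda>t. (\<lambda>k. dlog (Z t) (V t (s k)))(j := \<lambda>k. of_nat (deg k))"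
  have lim: "((\<lambda>t. lform p r c (?u t)) \<longlongrightarrow> lform p r c ((\<lambda>k. unit_vec (s k))(j := \<lambda>k. of_nat (deg k)))) (at 0)"
    by (rule lform_tendsto) (auto intro!: log_frameD(2)[OF frame])
  have ev: "\<forall>\<^sub>F t in at 0. lform p r c (?u t) = 0"
    using log_frameD(1)[OF frame]
  proof eventually_elim
    case (elim t)
    have "lform p r c (\<lambda>k. dlog (Z t) (((\<lambda>k. V t (s k))(j := Z t)) k)) = 0"
      using log_form_slot_radial[OF R elim j] log_form_eq_lform[OF elim] by metis
    moreover have "(\<lambda>k. dlog (Z t) (((\<lambda>k. V t (s k))(j := Z t)) k))
        = (\<lambda>k. dlog (Z t) (V t (s k)))(j := dlog (Z t) (Z t))" by auto
    moreover have "lform p r c ((\<lambda>k. dlog (Z t) (V t (s k)))(j := dlog (Z t) (Z t))) = lform p r c (?u t)"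
    proof -
      have "lform p r c ((\<lambda>k. dlog (Z t) (V t (s k)))(j := dlog (Z t) (Z t)))
          = (\<Sum>l\<in>{()}. 1 * lform p r c (?u t))"
        by (rule lform_upd_sum[OF j]) (simp add: dlog_radial[OF elim])
      then show ?thesis by simp
    qed
    ultimately show ?case by simp
  qed
  have "lform p r c ((\<lambda>k. unit_vec (s k))(j := \<lambda>k. of_nat (deg k))) = 0"
    using Lim_transform_eventually[OF lim ev] by (simp add: tendsto_const_iff)
  then show ?thesis by (simp add: coef_seq_expand[OF j])
qed

end

section \<open>Holomorphic functions and exterior products\<close>

text \<open>The pointwise version of \<open>holomorphic_fun_on\<close>.\<close>

definition complex_differentiable_at :: "(complex^'m::finite \<Rightarrow> complex) \<Rightarrow> complex^'m \<Rightarrow> bool" where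
  "complex_differentiable_at g z \<longleftrightarrow> (\<exists>g'. (g has_derivative g') (at z) \<and> (\<forall>c v. g' (c *s v) = c * g' v))"

lemma holomorphic_fun_on_iff: "holomorphic_fun_on U g \<longleftrightarrow> (\<forall>z\<in>U. complex_differentiable_at g z)"
  by (simp add: holomorphic_fun_on_def complex_differentiable_at_def)

lemma complex_differentiable_const: "complex_differentiable_at (\<lambda>_. c) z"
  unfolding complex_differentiable_at_def by (rule exI[of _ "\<lambda>_. 0"]) simp

lemma complex_differentiable_mult:
  assumes "complex_differentiable_at g z" "complex_differentiable_at h z"
  shows "complex_differentiable_at (\<lambda>z. g z * h z) z"
proof -
  obtain g' h' where g': "(g has_derivative g') (at z)" "\<And>c v. g' (c *s v) = c * g' v"
    and h': "(h has_derivative h') (at z)" "\<And>c v. h' (c *s v) = c * h' v"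
    using assms by (auto simp: complex_differentiable_at_def)
  show ?thesis unfolding complex_differentiable_at_def
    by (rule exI, rule conjI[OF has_derivative_mult[OF g'(1) h'(1)]]) (simp add: g' h' algebra_simps)
qed

lemma complex_differentiable_add:
  assumes "complex_differentiable_at g z" "complex_differentiable_at h z"
  shows "complex_differentiable_at (\<lambda>z. g z + h z) z"
proof -
  obtain g' h' where g': "(g has_derivative g') (at z)" "\<And>c v. g' (c *s v) = c * g' v"
    and h': "(h has_derivative h') (at z)" "\<And>c v. h' (c *s v) = c * h' v"
    using assms by (auto simp: complex_differentiable_at_def)
  show ?thesis unfolding complex_differentiable_at_def
    by (rule exI, rule conjI[OF has_derivative_add[OF g'(1) h'(1)]]) (simp add: g' h' algebra_simps)
qed

lemma complex_differentiable_sum: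
  "finite S \<Longrightarrow> (\<And>i. i \<in> S \<Longrightarrow> complex_differentiable_at (g i) z) \<Longrightarrow>
    complex_differentiable_at (\<lambda>z. \<Sum>i\<in>S. g i z) z"
  by (induction S rule: finite_induct)
     (auto intro: complex_differentiable_const complex_differentiable_add)

lemma complex_differentiable_prod:
  "finite S \<Longrightarrow> (\<And>i. i \<in> S \<Longrightarrow> complex_differentiable_at (g i) z) \<Longrightarrow>
    complex_differentiable_at (\<lambda>z. \<Prod>i\<in>S. g i z) z"
  by (induction S rule: finite_induct)
     (auto intro: complex_differentiable_const complex_differentiable_mult)

lemma complex_differentiable_divide:
  assumes "complex_differentiable_at g z" "complex_differentiable_at h z" "h z \<noteq> 0"
  shows "complex_differentiable_at (\<lambda>z. g z / h z) z"
proof -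
  obtain g' h' where g': "(g has_derivative g') (at z)" "\<And>c v. g' (c *s v) = c * g' v"
    and h': "(h has_derivative h') (at z)" "\<And>c v. h' (c *s v) = c * h' v"
    using assms by (auto simp: complex_differentiable_at_def)
  show ?thesis unfolding complex_differentiable_at_def
    by (rule exI, rule conjI[OF has_derivative_divide'[OF g'(1) h'(1) assms(3)]]) (simp add: g' h' algebra_simps)
qed

lemma complex_differentiable_cdet:
  assumes "\<And>i j. i < p \<Longrightarrow> j < p \<Longrightarrow> complex_differentiable_at (\<lambda>z. x z j i) z"
  shows "complex_differentiable_at (\<lambda>z. cdet p (x z)) z"
  unfolding cdet_def
proof (intro complex_differentiable_sum complex_differentiable_mult complex_differentiable_const
    complex_differentiable_prod finite_permutations finite_lessThan)
  fix \<pi> i assume "\<pi> \<in> {\<pi>. \<pi> permutes {..<p}}" "i \<in> {..<p}"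
  then show "complex_differentiable_at (\<lambda>z. x z (\<pi> i) i) z"
    using permutes_in_image[of \<pi> "{..<p}" i] by (intro assms) auto
qed

lemma complex_differentiable_polynomial:
  "polynomial_fun (*s) P \<Longrightarrow> complex_differentiable_at P z"
  unfolding complex_differentiable_at_def
  using polynomial_has_derivative complex_linearD(2)[OF polynomial_derivative_linear] by blast

lemma complex_differentiable_cong:
  assumes "complex_differentiable_at g z" "open W" "z \<in> W" "\<And>y. y \<in> W \<Longrightarrow> g y = h y"
  shows "complex_differentiable_at h z"
proof -
  obtain g' where g': "(g has_derivative g') (at z)" "\<And>c v. g' (c *s v) = c * g' v"
    using assms(1) by (auto simp: complex_differentiable_at_def)
  have "(h has_derivative g') (at z)"
    by (rule has_derivative_transform_within_open[OF g'(1) assms(2-4)])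
  then show ?thesis using g'(2) by (auto simp: complex_differentiable_at_def)
qed

lemma complex_differentiableD:
  assumes "complex_differentiable_at g z"
  shows "(g has_derivative frechet_derivative g (at z)) (at z)"
    and "frechet_derivative g (at z) (c *s v) = c * frechet_derivative g (at z) v"
proof -
  obtain g' where g': "(g has_derivative g') (at z)" "\<And>c v. g' (c *s v) = c * g' v"
    using assms by (auto simp: complex_differentiable_at_def)
  then have "frechet_derivative g (at z) = g'" using frechet_derivative_at by metis
  then show "(g has_derivative frechet_derivative g (at z)) (at z)"
    "frechet_derivative g (at z) (c *s v) = c * frechet_derivative g (at z) v"
    using g' by simp_all
qed

lemma frechet_derivative_eqI: "(g has_derivative g') (at z) \<Longrightarrow> frechet_derivative g (at z) = g'"
  using frechet_derivative_at by metis

lemma holomorphic_fun_on_continuous: "holomorphic_fun_on U g \<Longrightarrow> continuous_on U g"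
  unfolding holomorphic_fun_on_iff
  by (meson complex_differentiableD(1) continuous_at_imp_continuous_on has_derivative_continuous)

lemma has_field_derivative_along_line:
  assumes "complex_differentiable_at g (y + t *s w)"
  shows "((\<lambda>t. g (y + t *s w)) has_field_derivative frechet_derivative g (at (y + t *s w)) w) (at t)"
proof -
  have "((\<lambda>t. g (y + t *s w)) has_derivative (\<lambda>h. frechet_derivative g (at (y + t *s w)) (h *s w))) (at t)"
    by (rule has_derivative_compose[OF has_derivative_scale_vec complex_differentiableD(1)[OF assms]])
  moreover have "(\<lambda>h. frechet_derivative g (at (y + t *s w)) (h *s w)) = (*) (frechet_derivative g (at (y + t *s w)) w)"
    by (simp add: fun_eq_iff complex_differentiableD(2)[OF assms] mult.commute)
  ultimately show ?thesis by (simp only: has_field_derivative_def)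
qed

lemma norm_scale_vec: "norm (t *s (w :: complex^'m::finite)) = norm t * norm w"
  by (simp add: norm_vec_def L2_set_def norm_mult power_mult_distrib sum_distrib_left[symmetric] real_sqrt_mult)

text \<open>Holomorphy only asks for a complex derivative at each point. Its continuity follows from Cauchy's
inequality on the line through the point in direction \<open>w\<close>, since the restrictions of \<open>g\<close> to nearby
parallel lines are uniformly close.\<close>

lemma holomorphic_fun_derivative_continuous:
  fixes g :: "complex^'m::finite \<Rightarrow> complex"
  assumes W: "open W" and g: "holomorphic_fun_on W g"
  shows "continuous_on W (\<lambda>y. frechet_derivative g (at y) w)"
proof (intro continuous_at_imp_continuous_on ballI)
  fix y0 assume y0: "y0 \<in> W"
  obtain R where R: "R > 0" "cball y0 R \<subseteq> W" using W y0 open_contains_cball by blast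
  \<comment> \<open>Small enough for the discs of radius \<open>\<rho>\<close> through points at distance at most \<open>R / 2\<close> to stay in \<open>cball y0 R\<close>.\<close>
  define \<rho> where "\<rho> = R / (2 * (norm w + 1))"
  have \<rho>: "\<rho> > 0" using R by (simp add: \<rho>_def add_nonneg_pos)
  have "\<rho> * norm w = R / 2 * (norm w / (norm w + 1))" by (simp add: \<rho>_def)
  also have "\<dots> \<le> R / 2 * 1"
  proof (rule mult_left_mono)
    show "norm w / (norm w + 1) \<le> 1" using add_nonneg_pos[OF norm_ge_zero[of w] zero_less_one] by (simp add: divide_le_eq_1)
  qed (use R in simp)
  finally have \<rho>w: "\<rho> * norm w \<le> R / 2" by simp
  have near: "y + t *s w \<in> cball y0 R" if "dist y y0 \<le> R / 2" "norm t \<le> \<rho>" for y t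
  proof -
    have "norm (t *s w) \<le> \<rho> * norm w" unfolding norm_scale_vec by (rule mult_right_mono[OF that(2)]) simp
    then have "norm (y + t *s w - y0) \<le> R / 2 + R / 2"
      using norm_triangle_ineq[of "y - y0" "t *s w"] that(1) \<rho>w by (simp add: dist_norm algebra_simps)
    then show ?thesis by (simp add: dist_norm norm_minus_commute)
  qed
  have cd: "complex_differentiable_at g x" if "x \<in> cball y0 R" for x
    using g that R by (auto simp: holomorphic_fun_on_iff)
  have "uniformly_continuous_on (cball y0 R) g"
    using holomorphic_fun_on_continuous[OF g] R
    by (intro compact_uniformly_continuous) (auto intro: continuous_on_subset)
  then have unif: "\<exists>d>0. \<forall>x\<in>cball y0 R. \<forall>x'\<in>cball y0 R. dist x' x < d \<longrightarrow> dist (g x') (g x) < e" if "e > 0" for e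
    using that unfolding uniformly_continuous_on_def by blast
  show "isCont (\<lambda>y. frechet_derivative g (at y) w) y0"
    unfolding continuous_at_eps_delta
  proof (intro allI impI)
    fix e :: real assume e: "e > 0"
    then have "e * \<rho> / 2 > 0" using \<rho> by simp
    from unif[OF this] obtain d where d: "d > 0"
      "\<forall>x\<in>cball y0 R. \<forall>x'\<in>cball y0 R. dist x' x < d \<longrightarrow> dist (g x') (g x) < e * \<rho> / 2" by blast
    show "\<exists>d>0. \<forall>y. dist y y0 < d \<longrightarrow> dist (frechet_derivative g (at y) w) (frechet_derivative g (at y0) w) < e"
    proof (intro exI[of _ "min d (R / 2)"] conjI allI impI)
      show "min d (R / 2) > 0" using d R by simp
      fix y assume y: "dist y y0 < min d (R / 2)"
      define h where "h t = g (y + t *s w) - g (y0 + t *s w)" for t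
      have h': "(h has_field_derivative
          (frechet_derivative g (at (y + t *s w)) w - frechet_derivative g (at (y0 + t *s w)) w)) (at t)"
        if "norm t \<le> \<rho>" for t
        unfolding h_def
        by (intro DERIV_diff has_field_derivative_along_line cd near) (use y R that in auto)
      have "h holomorphic_on ball 0 \<rho>"
      proof (rule holomorphic_onI)
        fix t :: complex assume "t \<in> ball 0 \<rho>"
        then have "norm t \<le> \<rho>" by simp
        from h'[OF this] show "h field_differentiable at t within ball 0 \<rho>"
          using field_differentiable_at_within field_differentiable_def by blast
      qed
      moreover have "continuous_on (cball 0 \<rho>) h"
        using h' by (intro continuous_at_imp_continuous_on ballI) (auto intro: DERIV_isCont)
      moreover have "norm (h t) \<le> e * \<rho> / 2" if "norm (0 - t) = \<rho>" for t
      proof -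
        have "dist (g (y + t *s w)) (g (y0 + t *s w)) < e * \<rho> / 2"
        proof (rule d(2)[rule_format])
          show "y0 + t *s w \<in> cball y0 R" "y + t *s w \<in> cball y0 R"
            by (rule near; use y R that in simp)+
          show "dist (y + t *s w) (y0 + t *s w) < d" using y by simp
        qed
        then show ?thesis by (simp add: h_def dist_norm)
      qed
      ultimately have "norm ((deriv ^^ 1) h 0) \<le> fact 1 * (e * \<rho> / 2) / \<rho> ^ 1"
        by (rule Cauchy_inequality[OF _ _ \<rho>])
      then have "norm (deriv h 0) \<le> e / 2" using \<rho> by simp
      moreover have "deriv h 0 = frechet_derivative g (at y) w - frechet_derivative g (at y0) w"
        using DERIV_imp_deriv[OF h'[of 0]] \<rho> by simp
      ultimately show "dist (frechet_derivative g (at y) w) (frechet_derivative g (at y0) w) < e"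
        using e by (simp add: dist_norm)
    qed
  qed
qed

text \<open>Composition with a transposition changes the sign but not the summand.\<close>

lemma sum_permutations_symmetric_zero:
  fixes h :: "(nat \<Rightarrow> nat) \<Rightarrow> complex"
  assumes ab: "a < n" "b < n" "a \<noteq> b"
    and sym: "\<And>\<pi>. h (\<pi> \<circ> Transposition.transpose a b) = h \<pi>"
  shows "(\<Sum>\<pi> | \<pi> permutes {..<n}. of_int (sign \<pi>) * h \<pi>) = 0"
proof -
  let ?t = "Transposition.transpose a b"
  have t: "?t permutes {..<n}" using ab by (simp add: permutes_swap_id)
  have perm: "permutation \<sigma>" if "\<sigma> permutes {..<n}" for \<sigma>
    using that permutes_imp_permutation by blast
  have "(\<Sum>\<pi> | \<pi> permutes {..<n}. of_int (sign \<pi>) * h \<pi>)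
      = (\<Sum>\<pi> | \<pi> permutes {..<n}. of_int (sign (\<pi> \<circ> ?t)) * h (\<pi> \<circ> ?t))"
    by (rule sum_permutations_compose_right[OF t])
  also have "\<dots> = (\<Sum>\<pi> | \<pi> permutes {..<n}. - (of_int (sign \<pi>) * h \<pi>))"
    using ab by (intro sum.cong) (auto simp: sign_compose perm t sym sign_swap_id)
  also have "\<dots> = - (\<Sum>\<pi> | \<pi> permutes {..<n}. of_int (sign \<pi>) * h \<pi>)" by (simp add: sum_negf)
  finally show ?thesis by simp
qed

text \<open>The two-form is \<open>\<Sum>\<^sub>k g\<^sub>k \<and> T\<^sub>k\<close>, and \<open>T\<^sub>k\<close> occurs again as a factor of the determinant.\<close>

lemma wedge_two_form_cdet_zero:
  fixes g T :: "nat \<Rightarrow> complex^'m \<Rightarrow> complex"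
  shows "wedge 2 p (\<lambda>s. \<Sum>k<p. g k (s 0) * T k (s 1) - g k (s 1) * T k (s 0)) (\<lambda>s. cdet p (\<lambda>j i. T i (s j))) s = 0"
proof -
  have vanish: "(\<Sum>\<pi> | \<pi> permutes {..<2 + p}. of_int (sign \<pi>) *
      (g k (s (\<pi> a)) * T k (s (\<pi> b)) * (\<Prod>i<p. T i (s (\<pi> (2 + \<sigma> i)))))) = 0"
    if k: "k < p" and \<sigma>: "\<sigma> permutes {..<p}" and ab: "a < 2" "b < 2" "a \<noteq> b" for k \<sigma> a b
  proof (rule sum_permutations_symmetric_zero[of b _ "2 + \<sigma> k"])
    show "2 + \<sigma> k < 2 + p" using permutes_in_image[OF \<sigma>, of k] k by simp
    fix \<pi> :: "nat \<Rightarrow> nat"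
    let ?\<pi> = "\<pi> \<circ> Transposition.transpose b (2 + \<sigma> k)"
    have other: "?\<pi> (2 + \<sigma> i) = \<pi> (2 + \<sigma> i)" if "i \<noteq> k" for i
      using that ab inj_eq[OF permutes_inj[OF \<sigma>]] by (auto simp: Transposition.transpose_def)
    have split: "(\<Prod>i<p. T i (s (\<pi> (2 + \<sigma> i)))) = T k (s (\<pi> (2 + \<sigma> k))) * (\<Prod>i\<in>{..<p} - {k}. T i (s (\<pi> (2 + \<sigma> i))))"
      for \<pi> using k by (intro prod.remove) auto
    have "(\<Prod>i\<in>{..<p} - {k}. T i (s (?\<pi> (2 + \<sigma> i)))) = (\<Prod>i\<in>{..<p} - {k}. T i (s (\<pi> (2 + \<sigma> i))))"
      by (rule prod.cong) (use other in auto)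
    then show "g k (s (?\<pi> a)) * T k (s (?\<pi> b)) * (\<Prod>i<p. T i (s (?\<pi> (2 + \<sigma> i))))
        = g k (s (\<pi> a)) * T k (s (\<pi> b)) * (\<Prod>i<p. T i (s (\<pi> (2 + \<sigma> i))))"
      using ab unfolding split by (simp add: Transposition.transpose_def)
  qed (use that in auto)
  let ?h = "\<lambda>k a b \<sigma> \<pi>. g k (s (\<pi> a)) * T k (s (\<pi> b)) * (\<Prod>i<p. T i (s (\<pi> (2 + \<sigma> i))))"
  have expand: "c * (\<Sum>k<p. A k - B k) * (\<Sum>\<sigma>\<in>S. d \<sigma> * X \<sigma>) =
      (\<Sum>k<p. \<Sum>\<sigma>\<in>S. d \<sigma> * (c * (A k * X \<sigma>) - c * (B k * X \<sigma>)))"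
    for c :: complex and A B and S :: "(nat \<Rightarrow> nat) set" and d X
  proof -
    have "c * (\<Sum>k<p. A k - B k) * (\<Sum>\<sigma>\<in>S. d \<sigma> * X \<sigma>) = (\<Sum>k<p. \<Sum>\<sigma>\<in>S. c * (A k - B k) * (d \<sigma> * X \<sigma>))"
      by (simp only: sum_product sum_distrib_left[of c])
    also have "\<dots> = (\<Sum>k<p. \<Sum>\<sigma>\<in>S. d \<sigma> * (c * (A k * X \<sigma>) - c * (B k * X \<sigma>)))"
      by (intro sum.cong refl) (simp add: algebra_simps)
    finally show ?thesis .
  qed
  have "(\<Sum>\<pi> | \<pi> permutes {..<2 + p}. of_int (sign \<pi>) *
        (\<Sum>k<p. g k (s (\<pi> 0)) * T k (s (\<pi> 1)) - g k (s (\<pi> 1)) * T k (s (\<pi> 0))) *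
        cdet p (\<lambda>j i. T i (s (\<pi> (2 + j)))))
      = (\<Sum>\<pi> | \<pi> permutes {..<2 + p}. \<Sum>k<p. \<Sum>\<sigma> | \<sigma> permutes {..<p}. of_int (sign \<sigma>) *
          (of_int (sign \<pi>) * ?h k 0 1 \<sigma> \<pi> - of_int (sign \<pi>) * ?h k 1 0 \<sigma> \<pi>))"
    unfolding cdet_def by (rule sum.cong[OF refl expand])
  also have "\<dots> = (\<Sum>k<p. \<Sum>\<sigma> | \<sigma> permutes {..<p}. of_int (sign \<sigma>) *
      ((\<Sum>\<pi> | \<pi> permutes {..<2 + p}. of_int (sign \<pi>) * ?h k 0 1 \<sigma> \<pi>)
     - (\<Sum>\<pi> | \<pi> permutes {..<2 + p}. of_int (sign \<pi>) * ?h k 1 0 \<sigma> \<pi>)))"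
    unfolding sum_subtractf[symmetric] sum_distrib_left
    by (subst sum.swap, rule sum.cong[OF refl], subst sum.swap) simp
  also have "\<dots> = 0"
  proof (intro sum.neutral ballI)
    fix k \<sigma> assume "k \<in> {..<p}" "\<sigma> \<in> {\<sigma>. \<sigma> permutes {..<p}}"
    then have "k < p" "\<sigma> permutes {..<p}" by auto
    from vanish[OF this, of 0 1] vanish[OF this, of 1 0]
    show "of_int (sign \<sigma>) *
      ((\<Sum>\<pi> | \<pi> permutes {..<2 + p}. of_int (sign \<pi>) * ?h k 0 1 \<sigma> \<pi>)
     - (\<Sum>\<pi> | \<pi> permutes {..<2 + p}. of_int (sign \<pi>) * ?h k 1 0 \<sigma> \<pi>)) = 0" by simp
  qed
  finally show ?thesis by (simp add: wedge_def)
qed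

section \<open>Integrability and pointwise decomposability\<close>

lemma alternatingD:
  assumes "alternating p \<phi>"
  shows "(\<And>i. i < p \<Longrightarrow> v i = w i) \<Longrightarrow> \<phi> v = \<phi> w"
    and "i < p \<Longrightarrow> Vector_Spaces.linear (*s) (*) (\<lambda>x. \<phi> (v(i := x)))"
    and "i < p \<Longrightarrow> j < p \<Longrightarrow> i \<noteq> j \<Longrightarrow> v i = v j \<Longrightarrow> \<phi> v = 0"
proof -
  have *: "\<forall>v w. (\<forall>i<p. v i = w i) \<longrightarrow> \<phi> v = \<phi> w"
    "\<forall>v. \<forall>i<p. Vector_Spaces.linear (*s) (*) (\<lambda>x. \<phi> (v(i := x)))"
    "\<forall>v. \<forall>i<p. \<forall>j<p. i \<noteq> j \<and> v i = v j \<longrightarrow> \<phi> v = 0"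
    by (rule assms[unfolded alternating_def, THEN conjunct1]
        assms[unfolded alternating_def, THEN conjunct2, THEN conjunct1]
        assms[unfolded alternating_def, THEN conjunct2, THEN conjunct2])+
  show "(\<And>i. i < p \<Longrightarrow> v i = w i) \<Longrightarrow> \<phi> v = \<phi> w" by (rule *(1)[rule_format])
  show "i < p \<Longrightarrow> Vector_Spaces.linear (*s) (*) (\<lambda>x. \<phi> (v(i := x)))" by (rule *(2)[rule_format])
  show "i < p \<Longrightarrow> j < p \<Longrightarrow> i \<noteq> j \<Longrightarrow> v i = v j \<Longrightarrow> \<phi> v = 0"
    using *(3) by blast
qed

text \<open>Used to put a scalar into one linear factor of a decomposable form.\<close>

lemma cdet_scale_first_row:
  assumes "p \<ge> 1"
  shows "cdet p (\<lambda>j i. (if i = 0 then a else 1) * x j i) = a * cdet p x"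
proof -
  have split: "{..<p} = insert 0 {1..<p}" using assms by auto
  have "(\<Prod>i<p. (if i = 0 then a else 1) * x (\<pi> i) i) = a * (\<Prod>i<p. x (\<pi> i) i)" for \<pi>
    by (simp add: prod.distrib split)
  then show ?thesis by (simp add: cdet_def sum_distrib_left mult_ac)
qed

lemma lform_1: "lform 1 r c u = (\<Sum>l<r. c {l} * u 0 l)"
proof -
  have "lform 1 r c (u(0 := unit_vec l)) = c {l}" if l: "l < r" for l
  proof -
    have "lform 1 r c (u(0 := unit_vec l)) = coef_seq 1 r c (\<lambda>i. sorted_list_of_set {l} ! i)"
      unfolding coef_seq_def by (rule alternating_seq_cong[OF alternating_lform]) simp
    also have "\<dots> = c {l}" by (rule coef_seq_sorted) (use l in auto)
    finally show ?thesis .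
  qed
  then show ?thesis using lform_expand_slot[of 0 1 r c u] by (simp add: mult.commute)
qed

lemma ext_deriv_1:
  "ext_deriv 1 \<omega> z s = frechet_derivative (\<lambda>y. \<omega> y (\<lambda>j. s (Suc j))) (at z) (s 0)
     - frechet_derivative (\<lambda>y. \<omega> y (\<lambda>j. if j < 1 then s j else s (Suc j))) (at z) (s 1)"
  by (simp add: ext_deriv_def)

context ordinary_divisor begin

lemma closed_polar_divisor: "closed (polar_divisor f r)"
proof -
  have eq: "polar_divisor f r = {z. (\<Prod>i<r. f i z) = 0}" using not_polar_iff by blast
  show ?thesis unfolding eq
    by (intro closed_Collect_eq polynomial_continuous polynomial_product continuous_on_const)
qed

lemma continuous_eq_off_polar:
  fixes g h :: "complex^'m \<Rightarrow> complex"
  assumes "open W" "continuous_on W g" "continuous_on W h"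
    and eq: "\<And>y. y \<in> W - polar_divisor f r \<Longrightarrow> g y = h y" and "y \<in> W"
  shows "g y = h y"
proof -
  obtain w where w: "(\<Prod>i<r. f i w) \<noteq> 0" using product_nonzero by blast
  show ?thesis
  proof (rule continuous_eq_off_zero_set[where F = "\<lambda>z. \<Prod>i<r. f i z" and w = w and W = W])
    show "g y = h y" if "y \<in> W" "(\<Prod>i<r. f i y) \<noteq> 0" for y
      using eq[of y] that not_polar_iff[of y] by blast
  qed (use assms w polynomial_product in blast)+
qed

lemma complex_differentiable_dlog:
  "y \<notin> polar_divisor f r \<Longrightarrow> l < r \<Longrightarrow> complex_differentiable_at (\<lambda>y. dlog y x l) y"
  unfolding dlog_def
  by (intro complex_differentiable_divide complex_differentiable_polynomial
      polynomial_derivative_polynomial polynomial_f) (auto simp: polar_divisor_def)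

lemma dlog_linear: "l < r \<Longrightarrow> Vector_Spaces.linear (*s) (*) (\<lambda>x. dlog y x l)"
  using complex_linearD(1,2)[OF polynomial_derivative_linear[OF polynomial_f]]
  by (intro complex_linearI) (simp_all add: dlog_def add_divide_distrib)

text \<open>The form \<open>df/f\<close> is closed because second derivatives commute.\<close>

lemma dlog_closed:
  assumes "y \<notin> polar_divisor f r" "l < r"
  shows "frechet_derivative (\<lambda>y. dlog y x l) (at y) w = frechet_derivative (\<lambda>y. dlog y w l) (at y) x"
proof -
  let ?D = "\<lambda>y x. frechet_derivative (f l) (at y) x"
  have nz: "f l y \<noteq> 0" using assms by (auto simp: polar_divisor_def)
  have "frechet_derivative (\<lambda>y. dlog y x l) (at y) w =
      (frechet_derivative (\<lambda>y. ?D y x) (at y) w * f l y - ?D y x * ?D y w) / (f l y * f l y)" for x w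
    unfolding dlog_def
    by (subst frechet_derivative_eqI[OF has_derivative_divide'[OF
            polynomial_has_derivative[OF polynomial_derivative_polynomial[OF polynomial_f]]
            polynomial_has_derivative[OF polynomial_f]]]) (use assms nz in auto)
  then show ?thesis
    using polynomial_derivative_symmetric[OF polynomial_f[OF assms(2)], of x y w] by (simp add: mult.commute)
qed

lemma holomorphic_log_form: "holomorphic_form_on (- polar_divisor f r) p (log_form f r p c)"
  unfolding holomorphic_form_on_def
proof (intro conjI ballI allI)
  fix z assume z: "z \<in> - polar_divisor f r"
  then have eq: "log_form f r p c z v = lform p r c (\<lambda>j. dlog z (v j))" for v
    by (simp add: log_form_eq_lform)
  have alt: "alternating_seq p (\<lambda>v. lform p r c (\<lambda>j. dlog z (v j)))"
    by (rule alternating_seq_compose[OF alternating_lform])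
  show "alternating p (log_form f r p c z)"
    unfolding alternating_def eq
  proof (intro conjI allI impI)
    show "lform p r c (\<lambda>j. dlog z (v j)) = lform p r c (\<lambda>j. dlog z (w j))" if "\<forall>i<p. v i = w i" for v w
      using alternating_seq_cong[OF alt, of v w] that by blast
    show "lform p r c (\<lambda>j. dlog z (v j)) = 0" if "i < p" "j < p" "i \<noteq> j \<and> v i = v j" for v i j
      using alternating_seq_repeat[OF alt, of i j v] that by blast
    fix v i assume i: "i < p"
    have upd: "(\<lambda>j. dlog z ((v(i := x)) j)) = (\<lambda>j. dlog z (v j))(i := dlog z x)" for x by auto
    show "Vector_Spaces.linear (*s) (*) (\<lambda>x. lform p r c (\<lambda>j. dlog z ((v(i := x)) j)))"
    proof (rule complex_linearI)
      fix x y :: "complex^'m" and a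
      have "lform p r c ((\<lambda>j. dlog z (v j))(i := dlog z (x + y))) =
          (\<Sum>b\<in>{False, True}. 1 * lform p r c ((\<lambda>j. dlog z (v j))(i := if b then dlog z x else dlog z y)))"
        by (rule lform_upd_sum[OF i]) (simp add: complex_linearD(1)[OF dlog_linear])
      then show "lform p r c (\<lambda>j. dlog z ((v(i := x + y)) j))
          = lform p r c (\<lambda>j. dlog z ((v(i := x)) j)) + lform p r c (\<lambda>j. dlog z ((v(i := y)) j))"
        by (simp only: upd) simp
      have "lform p r c ((\<lambda>j. dlog z (v j))(i := dlog z (a *s x))) =
          (\<Sum>b\<in>{()}. a * lform p r c ((\<lambda>j. dlog z (v j))(i := dlog z x)))"
        by (rule lform_upd_sum[OF i]) (simp add: complex_linearD(2)[OF dlog_linear])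
      then show "lform p r c (\<lambda>j. dlog z ((v(i := a *s x)) j)) = a * lform p r c (\<lambda>j. dlog z ((v(i := x)) j))"
        by (simp only: upd) simp
    qed
  qed
next
  fix v
  show "holomorphic_fun_on (- polar_divisor f r) (\<lambda>z. log_form f r p c z v)"
    unfolding holomorphic_fun_on_iff
  proof
    fix z assume z: "z \<in> - polar_divisor f r"
    have "complex_differentiable_at (\<lambda>z. lform p r c (\<lambda>j. dlog z (v j))) z"
      unfolding lform_def
      by (intro complex_differentiable_sum complex_differentiable_mult complex_differentiable_const
          complex_differentiable_cdet complex_differentiable_dlog)
         (use z sorted_list_nth_less(2) in auto)
    then show "complex_differentiable_at (\<lambda>z. log_form f r p c z v) z"
      by (rule complex_differentiable_cong[OF _ open_Compl[OF closed_polar_divisor] z])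
         (simp add: log_form_eq_lform)
  qed
qed

lemma exchange_wedge1: "j < p \<Longrightarrow> exchange_at p (wedge1 p \<alpha>) v u j"
  using exchange_cdet_compose[of j p "\<lambda>x i. \<alpha> i (\<lambda>_. x)" v u]
  by (simp add: wedge1_eq_cdet[abs_def])

text \<open>Off the divisor the form is its own holomorphic extension, so integrability makes it a product of
linear forms at each of these points.\<close>

lemma integrable_exchange:
  assumes int: "integrable_form (polar_divisor f r) p (log_form f r p c)"
    and z: "z \<notin> polar_divisor f r" and j: "j < p"
  shows "exchange_at p (log_form f r p c z) v u j"
proof (cases "log_form f r p c z = 0")
  case True
  then show ?thesis by (simp add: exchange_at_def)
next
  case False
  have "\<exists>W \<omega>. open W \<and> z \<in> W \<and> W \<subseteq> - polar_divisor f r \<and>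
              (\<forall>j<p. holomorphic_form_on W 1 (\<omega> j)) \<and>
              (\<forall>y\<in>W. log_form f r p c y = wedge1 p (\<lambda>j. \<omega> j y)) \<and>
              (\<forall>j<p. \<forall>y\<in>W. wedge 2 p (ext_deriv 1 (\<omega> j) y) (wedge1 p (\<lambda>i. \<omega> i y)) = 0)"
    by (rule int[unfolded integrable_form_def, rule_format])
       (use z False open_Compl[OF closed_polar_divisor] holomorphic_log_form in auto)
  then obtain W \<omega> where "z \<in> W" "\<forall>y\<in>W. log_form f r p c y = wedge1 p (\<lambda>j. \<omega> j y)" by blast
  then have "log_form f r p c z = wedge1 p (\<lambda>j. \<omega> j z)" by blast
  then show ?thesis using exchange_wedge1[OF j] by simp
qed

text \<open>Let \<open>\<alpha>\<close> be a holomorphic extension with \<open>\<alpha> z v \<noteq> 0\<close>. Decomposability of \<open>\<alpha> y\<close> is a closed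
condition, so it holds on the divisor as well, and the normal form with respect to \<open>v\<close> gives
holomorphic linear factors \<open>\<omega>\<^sub>j\<close>. Off the divisor these are combinations of the closed forms
\<open>\<theta>\<^sub>k\<close> that divide \<open>\<alpha>\<close>, so \<open>d\<omega>\<^sub>j \<and> \<alpha> = 0\<close> there, and by continuity everywhere.\<close>

lemma integrable_wedge_of_log_forms:
  assumes p: "p \<ge> 1" and \<theta>: "\<And>j. j < p \<Longrightarrow> \<theta> j \<in> log_forms f r 1"
    and \<eta>: "\<eta> = (\<lambda>z. wedge1 p (\<lambda>j. \<theta> j z))"
  shows "integrable_form (polar_divisor f r) p \<eta>"
  unfolding integrable_form_def
proof (intro allI impI, elim conjE)
  fix U and \<alpha> :: "'m form" and z
  let ?D = "polar_divisor f r"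
  assume U: "open U" "z \<in> U" and hol: "holomorphic_form_on U p \<alpha>"
    and agree: "\<forall>y\<in>U - ?D. \<alpha> y = \<eta> y" and nz: "\<alpha> z \<noteq> 0"
  have "\<forall>j. \<exists>c. j < p \<longrightarrow> \<theta> j = log_form f r 1 c" using \<theta> unfolding log_forms_def by blast
  then obtain L where L: "\<And>j. j < p \<Longrightarrow> \<theta> j = log_form f r 1 (L j)" by metis
  define T where "T j y x = (\<Sum>l<r. L j {l} * dlog y x l)" for j y x
  have \<theta>T: "\<theta> j y s = T j y (s 0)" if "j < p" "y \<notin> ?D" for j y s
    using that by (simp add: L log_form_eq_lform lform_1[unfolded One_nat_def] T_def)
  have cd_T: "complex_differentiable_at (\<lambda>y. T j y x) y" if "y \<notin> ?D" for j y x
    unfolding T_def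
    by (intro complex_differentiable_sum complex_differentiable_mult complex_differentiable_const
        complex_differentiable_dlog) (use that in auto)
  have T_closed: "frechet_derivative (\<lambda>y. T k y x) (at y) w = frechet_derivative (\<lambda>y. T k y w) (at y) x"
    if y: "y \<notin> ?D" for k y x w
  proof -
    have "((\<lambda>y. T k y x) has_derivative (\<lambda>w. \<Sum>l<r. L k {l} * frechet_derivative (\<lambda>y. dlog y x l) (at y) w)) (at y)" for x
      unfolding T_def
      by (intro has_derivative_sum has_derivative_mult_right
          complex_differentiableD(1)[OF complex_differentiable_dlog[OF y]]) auto
    from this[THEN frechet_derivative_eqI]
    have "frechet_derivative (\<lambda>y. T k y x) (at y) w = (\<Sum>l<r. L k {l} * frechet_derivative (\<lambda>y. dlog y x l) (at y) w)" for x w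
      by simp
    then show ?thesis using dlog_closed[OF y] by (simp cong: sum.cong_simp)
  qed
  have \<alpha>_off: "\<alpha> y s = cdet p (\<lambda>j i. T i y (s j))" if "y \<in> U - ?D" for y s
    using that agree by (simp add: \<eta> wedge1_eq_cdet \<theta>T cong: cdet_cong_entries)
  have alt: "alternating p (\<alpha> y)" if "y \<in> U" for y
    using hol that by (simp add: holomorphic_form_on_def)
  have hol_\<alpha>: "holomorphic_fun_on U (\<lambda>y. \<alpha> y s)" for s
    using hol by (simp add: holomorphic_form_on_def)
  then have cd_\<alpha>: "complex_differentiable_at (\<lambda>y. \<alpha> y s) y" if "y \<in> U" for y s
    using that by (simp add: holomorphic_fun_on_iff)
  have cont_\<alpha>: "continuous_on U (\<lambda>y. \<alpha> y s)" for s by (rule holomorphic_fun_on_continuous[OF hol_\<alpha>])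
  have alt_seq: "alternating_seq p (\<alpha> y)" if y: "y \<in> U" for y
    unfolding alternating_seq_def
  proof (intro conjI allI impI)
    show "\<alpha> y (v \<circ> \<pi>) = of_int (sign \<pi>) * \<alpha> y v" if "\<pi> permutes {..<p}" for v \<pi>
    proof (rule continuous_eq_off_polar[OF U(1) _ _ _ y])
      fix y assume "y \<in> U - ?D"
      then show "\<alpha> y (v \<circ> \<pi>) = of_int (sign \<pi>) * \<alpha> y v"
        using cdet_permute[OF that, of "\<lambda>j i. T i y (v j)"] by (simp add: \<alpha>_off comp_def)
    qed (intro continuous_intros cont_\<alpha>)+
  qed (use alternatingD[OF alt[OF y]] in blast)+
  have ex: "exchange_at p (\<alpha> y) v u j" if y: "y \<in> U" and j: "j < p" for y v u j
    unfolding exchange_at_def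
  proof (rule continuous_eq_off_polar[OF U(1) _ _ _ y])
    fix y assume "y \<in> U - ?D"
    then have "\<alpha> y = (\<lambda>s. cdet p (\<lambda>j. (\<lambda>x i. T i y x) (s j)))" by (simp add: fun_eq_iff \<alpha>_off)
    with exchange_cdet_compose[OF j, of "\<lambda>x i. T i y x" v u] show "\<alpha> y v * \<alpha> y u = (\<Sum>i<p. \<alpha> y (v(i := u j)) * \<alpha> y (u(j := v i)))"
      by (simp only: exchange_at_def)
  qed (intro continuous_intros cont_\<alpha>)+
  obtain v where v: "\<alpha> z v \<noteq> 0" using nz by (auto simp: fun_eq_iff)
  define W where "W = {y \<in> U. \<alpha> y v \<noteq> 0}"
  have "open (U \<inter> (\<lambda>y. \<alpha> y v) -` (- {0}))"
    by (rule continuous_open_preimage[OF cont_\<alpha> U(1)]) (simp add: open_Compl)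
  then have W: "open W" by (simp add: W_def Int_def vimage_def)
  have WU: "W \<subseteq> U" by (auto simp: W_def)
  \<comment> \<open>The product of the forms \<open>\<alpha> y (v(j := _)) / \<alpha> y v\<close> is \<open>\<alpha> y / \<alpha> y v\<close>; the missing factor goes into \<open>\<omega> 0\<close>.\<close>
  define \<omega> where "\<omega> j y s = (if j = 0 then \<alpha> y v else 1) * (\<alpha> y (v(j := s 0)) / \<alpha> y v)" for j y and s :: "nat \<Rightarrow> complex^'m"
  have \<alpha>_wedge: "\<alpha> y = wedge1 p (\<lambda>j. \<omega> j y)" if y: "y \<in> W" for y
  proof
    fix u
    have yU: "y \<in> U" "\<alpha> y v \<noteq> 0" using y by (auto simp: W_def)
    have "wedge1 p (\<lambda>j. \<omega> j y) u = \<alpha> y v * cdet p (\<lambda>j i. \<alpha> y (v(i := u j)) / \<alpha> y v)"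
      unfolding wedge1_eq_cdet \<omega>_def by (rule cdet_scale_first_row[OF p])
    also have "\<dots> = \<alpha> y u"
      by (rule exchange_normal_form[where A = UNIV, OF alt_seq[OF yU(1)] ex[OF yU(1)] yU(2), symmetric]) auto
    finally show "\<alpha> y u = wedge1 p (\<lambda>j. \<omega> j y) u" by simp
  qed
  have cd_first: "complex_differentiable_at (\<lambda>y. if j = 0 then \<alpha> y v else 1) y" if "y \<in> U" for j :: nat and y
    using that by (cases "j = 0") (simp_all add: cd_\<alpha> complex_differentiable_const)
  have cd_\<omega>: "complex_differentiable_at (\<lambda>y. \<omega> j y s) y" if "y \<in> W" for j y s
    unfolding \<omega>_def
    by (intro complex_differentiable_mult complex_differentiable_divide cd_\<alpha> cd_first)
       (use that in \<open>auto simp: W_def\<close>)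
  have hol_\<omega>: "holomorphic_form_on W 1 (\<omega> j)" if j: "j < p" for j
    unfolding holomorphic_form_on_def
  proof (intro conjI ballI allI)
    show "holomorphic_fun_on W (\<lambda>z. \<omega> j z s)" for s using cd_\<omega> by (simp add: holomorphic_fun_on_iff)
    fix y assume y: "y \<in> W"
    have lin: "Vector_Spaces.linear (*s) (*) (\<lambda>x. \<alpha> y (v(j := x)))"
      using alternatingD(2)[OF alt j] y WU by blast
    show "alternating 1 (\<omega> j y)"
      unfolding alternating_def \<omega>_def
      using complex_linearD(1,2)[OF lin]
      by (cases "j = 0") (auto intro!: complex_linearI simp: add_divide_distrib algebra_simps)
  qed
  have wedge_zero: "wedge 2 p (ext_deriv 1 (\<omega> j) y) (wedge1 p (\<lambda>i. \<omega> i y)) = 0" if j: "j < p" and y: "y \<in> W" for j y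
  proof
    fix s
    have "wedge 2 p (ext_deriv 1 (\<omega> j) y) (\<alpha> y) s = 0"
    proof (rule continuous_eq_off_polar[OF W _ _ _ y])
      have "continuous_on W (\<lambda>y. ext_deriv 1 (\<omega> j) y s)" for s
        unfolding ext_deriv_1
        by (intro continuous_on_diff holomorphic_fun_derivative_continuous[OF W])
           (simp_all add: holomorphic_fun_on_iff cd_\<omega>)
      then show "continuous_on W (\<lambda>y. wedge 2 p (ext_deriv 1 (\<omega> j) y) (\<alpha> y) s)"
        unfolding wedge_def by (intro continuous_intros continuous_on_subset[OF cont_\<alpha> WU]) auto
      show "continuous_on W (\<lambda>y. 0 :: complex)" by (rule continuous_on_const)
      fix y assume y: "y \<in> W - ?D"
      then have yD: "y \<in> U - ?D" "y \<notin> ?D" "\<alpha> y v \<noteq> 0" by (auto simp: W_def)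
      \<comment> \<open>Coefficients of \<open>\<omega> j\<close> with respect to the closed forms \<open>T k\<close>: cofactors of the matrix \<open>T i y (v m)\<close>.\<close>
      define G where "G k y = (if j = 0 then \<alpha> y v else 1) / \<alpha> y v * cdet p ((\<lambda>m i. T i y (v m))(j := unit_vec k))" for k y
      have cd_G: "complex_differentiable_at (G k) y" for k
      proof -
        have "complex_differentiable_at (\<lambda>y. cdet p ((\<lambda>m i. T i y (v m))(j := unit_vec k))) y"
        proof (rule complex_differentiable_cdet)
          fix i m
          show "complex_differentiable_at (\<lambda>y. ((\<lambda>m i. T i y (v m))(j := unit_vec k)) m i) y"
            using cd_T[OF yD(2)] by (cases "m = j") (auto intro: complex_differentiable_const)
        qed
        then show ?thesis unfolding G_def
          by (intro complex_differentiable_mult complex_differentiable_divide cd_\<alpha> cd_first)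
             (use yD in auto)
      qed
      have \<omega>_off: "\<omega> j y' s = (\<Sum>k<p. G k y' * T k y' (s 0))" if "y' \<in> W - ?D" for y' s
      proof -
        have y': "y' \<in> U - ?D" using that WU by auto
        have "\<alpha> y' (v(j := s 0)) = cdet p ((\<lambda>m i. T i y' (v m))(j := \<lambda>i. T i y' (s 0)))"
          unfolding \<alpha>_off[OF y'] by (rule arg_cong[where f = "cdet p"]) auto
        also have "\<dots> = (\<Sum>k<p. T k y' (s 0) * cdet p ((\<lambda>m i. T i y' (v m))(j := unit_vec k)))"
          by (rule cdet_expand_column[OF j])
        finally show ?thesis
          unfolding \<omega>_def G_def by (simp add: sum_distrib_left sum_divide_distrib mult_ac)
      qed
      have WD: "open (W - ?D)" by (rule open_Diff[OF W closed_polar_divisor])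
      have D\<omega>: "frechet_derivative (\<lambda>y. \<omega> j y s) (at y) w =
          (\<Sum>k<p. G k y * frechet_derivative (\<lambda>y. T k y (s 0)) (at y) w + frechet_derivative (G k) (at y) w * T k y (s 0))"
        for s w
      proof -
        have "((\<lambda>y. \<Sum>k<p. G k y * T k y (s 0)) has_derivative
            (\<lambda>w. \<Sum>k<p. G k y * frechet_derivative (\<lambda>y. T k y (s 0)) (at y) w + frechet_derivative (G k) (at y) w * T k y (s 0))) (at y)"
          by (intro has_derivative_sum has_derivative_mult complex_differentiableD(1) cd_G cd_T yD)
        then have "((\<lambda>y. \<omega> j y s) has_derivative
            (\<lambda>w. \<Sum>k<p. G k y * frechet_derivative (\<lambda>y. T k y (s 0)) (at y) w + frechet_derivative (G k) (at y) w * T k y (s 0))) (at y)"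
          by (rule has_derivative_transform_within_open[OF _ WD y]) (simp add: \<omega>_off)
        then show ?thesis by (simp add: frechet_derivative_eqI)
      qed
      have "ext_deriv 1 (\<omega> j) y = (\<lambda>s. \<Sum>k<p. frechet_derivative (G k) (at y) (s 0) * T k y (s 1)
          - frechet_derivative (G k) (at y) (s 1) * T k y (s 0))"
        unfolding ext_deriv_1 D\<omega> sum_subtractf[symmetric]
        by (intro ext sum.cong refl) (simp add: T_closed[OF yD(2)])
      moreover have "\<alpha> y = (\<lambda>s. cdet p (\<lambda>j i. T i y (s j)))" by (simp add: fun_eq_iff \<alpha>_off[OF yD(1)])
      ultimately show "wedge 2 p (ext_deriv 1 (\<omega> j) y) (\<alpha> y) s = 0"
        using wedge_two_form_cdet_zero[of p "\<lambda>k. frechet_derivative (G k) (at y)" "\<lambda>k. T k y" s] by simp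
    qed
    then show "wedge 2 p (ext_deriv 1 (\<omega> j) y) (wedge1 p (\<lambda>i. \<omega> i y)) s = 0 s"
      using \<alpha>_wedge[OF y] by simp
  qed
  show "\<exists>W \<omega>. open W \<and> z \<in> W \<and> W \<subseteq> U \<and>
              (\<forall>j<p. holomorphic_form_on W 1 (\<omega> j)) \<and>
              (\<forall>y\<in>W. \<alpha> y = wedge1 p (\<lambda>j. \<omega> j y)) \<and>
              (\<forall>j<p. \<forall>y\<in>W. wedge 2 p (ext_deriv 1 (\<omega> j) y) (wedge1 p (\<lambda>i. \<omega> i y)) = 0)"
  proof (intro exI conjI allI impI ballI)
    show "open W" "W \<subseteq> U" by fact+
    show "z \<in> W" using U v by (simp add: W_def)
  qed (use hol_\<omega> \<alpha>_wedge wedge_zero in auto)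
qed

end

section \<open>Decomposability from few indices\<close>

lemma two_distinct_elements:
  assumes "1 < card S"
  obtains a b where "a \<noteq> b" "a \<in> S" "b \<in> S"
proof -
  have fin: "finite S" using assms card.infinite by force
  have "\<exists>a\<in>S. \<exists>b\<in>S. a \<noteq> b"
    using card_le_Suc0_iff_eq[OF fin] assms by auto
  then show ?thesis using that by blast
qed

text \<open>Linear forms whose product is the decomposable form with the same values as \<open>C\<close> near \<open>v\<close>. The scalar
\<open>C v\<close> is absorbed into the first of them.\<close>

definition adapted_rows :: "((nat \<Rightarrow> nat) \<Rightarrow> complex) \<Rightarrow> (nat \<Rightarrow> nat) \<Rightarrow> nat \<Rightarrow> nat \<Rightarrow> complex" where
  "adapted_rows C v i l = (if i = 0 then C v else 1) * (C (v(i := l)) / C v)"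

lemma cdet_adapted_rows:
  "p \<ge> 1 \<Longrightarrow> cdet p (\<lambda>j i. adapted_rows C v i (k j)) = C v * cdet p (\<lambda>j i. C (v(i := k j)) / C v)"
  unfolding adapted_rows_def by (rule cdet_scale_first_row)

lemma adapted_rows_contraction:
  assumes "(\<Sum>l<r. d l * C (v(i := l))) = 0"
  shows "(\<Sum>l<r. adapted_rows C v i l * d l) = 0"
proof -
  have "(\<Sum>l<r. adapted_rows C v i l * d l) = (if i = 0 then C v else 1) / C v * (\<Sum>l<r. d l * C (v(i := l)))"
    unfolding adapted_rows_def sum_distrib_left by (rule sum.cong) auto
  then show ?thesis using assms by simp
qed

text \<open>A sequence with at most one entry outside \<open>v\<close> is a rearrangement of some \<open>v(i := a)\<close>, or has a
repeated entry; on \<open>v(i := a)\<close> the matrix is the identity with one column replaced.\<close>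

lemma adapted_rows_agree:
  assumes C: "alternating_seq p C" and p: "p \<ge> 1" and v: "C v \<noteq> 0"
    and near: "card (k ` {..<p} - v ` {..<p}) \<le> 1"
  shows "C k = cdet p (\<lambda>j i. adapted_rows C v i (k j))"
proof -
  let ?\<psi> = "\<lambda>k. cdet p (\<lambda>j i. adapted_rows C v i (k j))"
  have \<psi>: "alternating_seq p ?\<psi>" by (rule alternating_cdet_rows)
  have unit: "C (v(i := v j)) / C v = unit_vec j i" if "i < p" "j < p" for i j
    using alternating_seq_repeat[OF C that, of "v(i := v j)"] v by (cases "i = j") (auto simp: unit_vec_def)
  have at_v: "?\<psi> (v(i := a)) = C (v(i := a))" if i: "i < p" for i a
  proof -
    have "cdet p (\<lambda>j m. C (v(m := (v(i := a)) j)) / C v) = cdet p (unit_vec(i := (\<lambda>m. C (v(m := a)) / C v)))"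
      by (rule cdet_cong_entries) (use unit in auto)
    also have "\<dots> = C (v(i := a)) / C v"
      by (rule cdet_unit_column[OF i])
    finally show ?thesis using v cdet_adapted_rows[OF p, of C v "v(i := a)"] by simp
  qed
  show ?thesis
  proof (cases "inj_on k {..<p}")
    case False
    then show ?thesis using alternating_seq_not_inj[OF C] alternating_seq_not_inj[OF \<psi>] by simp
  next
    case inj: True
    have "\<exists>i a \<sigma>. i < p \<and> \<sigma> ` {..<p} \<subseteq> {..<p} \<and> (\<forall>m<p. k m = (v(i := a)) (\<sigma> m))"
    proof (cases "k ` {..<p} \<subseteq> v ` {..<p}")
      case True
      then have "\<forall>m<p. \<exists>s<p. k m = v s" by auto
      then obtain \<sigma> where "\<And>m. m < p \<Longrightarrow> \<sigma> m < p \<and> k m = v (\<sigma> m)" by metis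
      then have "0 < p \<and> \<sigma> ` {..<p} \<subseteq> {..<p} \<and> (\<forall>m<p. k m = (v(0 := v 0)) (\<sigma> m))"
        using p by (simp add: image_subset_iff)
      then show ?thesis by blast
    next
      case False
      then obtain j where j: "j < p" "k j \<notin> v ` {..<p}" by auto
      have in_v: "k m \<in> v ` {..<p}" if "m < p" "m \<noteq> j" for m
      proof (rule ccontr)
        assume "k m \<notin> v ` {..<p}"
        then have "{k m, k j} \<subseteq> k ` {..<p} - v ` {..<p}" using j that by auto
        then have "card {k m, k j} \<le> card (k ` {..<p} - v ` {..<p})" by (intro card_mono) auto
        moreover have "k m \<noteq> k j" using inj that j by (auto dest: inj_onD)
        ultimately show False using near by simp
      qed
      then have "\<forall>m. \<exists>s. m < p \<and> m \<noteq> j \<longrightarrow> s < p \<and> k m = v s" by blast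
      then obtain \<tau> where \<tau>: "\<And>m. m < p \<Longrightarrow> m \<noteq> j \<Longrightarrow> \<tau> m < p \<and> k m = v (\<tau> m)" by metis
      have "card (\<tau> ` ({..<p} - {j})) \<le> card ({..<p} - {j})" by (rule card_image_le) simp
      also have "\<dots> < card {..<p}" using j by (intro psubset_card_mono) auto
      finally have "\<not> {..<p} \<subseteq> \<tau> ` ({..<p} - {j})" by (meson card_mono finite_Diff finite_imageI finite_lessThan leD)
      then obtain i where i: "i < p" "i \<notin> \<tau> ` ({..<p} - {j})" by auto
      have "k m = (v(i := k j)) ((\<tau>(j := i)) m)" if "m < p" for m
      proof (cases "m = j")
        case False
        then have "\<tau> m \<noteq> i" using i(2) that by auto
        then show ?thesis using \<tau>[OF that False] False by simp
      qed simp
      moreover have "(\<tau>(j := i)) ` {..<p} \<subseteq> {..<p}" using \<tau> i(1) by (auto simp: image_subset_iff)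
      ultimately show ?thesis using i(1) by blast
    qed
    then obtain i a \<sigma> where i: "i < p" and im: "\<sigma> ` {..<p} \<subseteq> {..<p}" and k: "\<And>m. m < p \<Longrightarrow> k m = (v(i := a)) (\<sigma> m)" by blast
    show ?thesis
      using alternating_seq_selection[OF C, of k "v(i := a)" \<sigma>]
        alternating_seq_selection[OF \<psi>, of k "v(i := a)" \<sigma>] k im at_v[OF i, of a] by simp
  qed
qed

text \<open>With at most \<open>p + 2\<close> indices, a sequence \<open>k\<close> has at most two entries \<open>a\<close>, \<open>b\<close> outside \<open>v\<close>. Contracting the
slot of \<open>b\<close> with \<open>d\<close> involves, besides \<open>k\<close> itself, only sequences whose one entry outside \<open>v\<close> is
\<open>a\<close>, and sequences in which \<open>a\<close> is repeated.\<close>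

lemma agree_of_contraction:
  fixes d :: "nat \<Rightarrow> complex"
  assumes C: "alternating_seq p C" and \<psi>: "alternating_seq p \<psi>"
    and near: "\<And>k. card (k ` {..<p} - v ` {..<p}) \<le> 1 \<Longrightarrow> C k = \<psi> k"
    and dC: "\<And>s j. (\<And>i. i < p \<Longrightarrow> s i < r) \<Longrightarrow> j < p \<Longrightarrow> (\<Sum>l<r. d l * C (s(j := l))) = 0"
    and d\<psi>: "\<And>s j. (\<And>i. i < p \<Longrightarrow> s i < r) \<Longrightarrow> j < p \<Longrightarrow> (\<Sum>l<r. d l * \<psi> (s(j := l))) = 0"
    and d: "\<And>l. l < r \<Longrightarrow> d l \<noteq> 0" and r: "r \<le> p + 2"
    and v: "inj_on v {..<p}" "\<And>i. i < p \<Longrightarrow> v i < r" and k: "\<And>i. i < p \<Longrightarrow> k i < r"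
  shows "C k = \<psi> k"
proof (cases "inj_on k {..<p} \<and> card (k ` {..<p} - v ` {..<p}) > 1")
  case False
  show ?thesis
  proof (cases "inj_on k {..<p}")
    case True
    then show ?thesis using False near by simp
  next
    case False
    then show ?thesis using alternating_seq_not_inj[OF C] alternating_seq_not_inj[OF \<psi>] by simp
  qed
next
  case True
  then have inj: "inj_on k {..<p}" by simp
  obtain a b where ab: "a \<noteq> b" "a \<in> k ` {..<p} - v ` {..<p}" "b \<in> k ` {..<p} - v ` {..<p}"
    using two_distinct_elements[of "k ` {..<p} - v ` {..<p}"] True by blast
  obtain ja where ja: "ja < p" "k ja = a" using ab by auto
  obtain jb where jb: "jb < p" "k jb = b" using ab by auto
  have jab: "ja \<noteq> jb" using ja jb ab by auto
  have cover: "l \<in> v ` {..<p} \<or> l = a \<or> l = b" if l: "l < r" for l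
  proof (rule ccontr)
    assume "\<not> ?thesis"
    then have "card (v ` {..<p} \<union> {a, b, l}) = p + 3"
      using ab v(1) by (subst card_Un_disjoint) (auto simp: card_image)
    moreover have "card (v ` {..<p} \<union> {a, b, l}) \<le> card {..<r}"
      using v(2) l ja jb k by (intro card_mono) auto
    ultimately show False using r by simp
  qed
  have same: "C (k(jb := l)) = \<psi> (k(jb := l))" if l: "l < r" "l \<noteq> b" for l
  proof (cases "l = a")
    case True
    have rep: "(k(jb := l)) ja = (k(jb := l)) jb" using True ja jab by simp
    show ?thesis
      using alternating_seq_repeat[OF C ja(1) jb(1) jab, where v = "k(jb := l)", OF rep]
        alternating_seq_repeat[OF \<psi> ja(1) jb(1) jab, where v = "k(jb := l)", OF rep] by simp
  next
    case False
    then have lv: "l \<in> v ` {..<p}" using cover l by auto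
    have "(k(jb := l)) ` {..<p} - v ` {..<p} \<subseteq> {a}"
    proof
      fix x assume x: "x \<in> (k(jb := l)) ` {..<p} - v ` {..<p}"
      then obtain m where m: "m < p" "x = (k(jb := l)) m" by auto
      then have "m \<noteq> jb" using x lv by auto
      then have "x = k m" "k m \<noteq> k jb" using m jb inj by (auto dest: inj_onD)
      then show "x \<in> {a}" using cover[OF k[OF m(1)]] x jb by auto
    qed
    then have "card ((k(jb := l)) ` {..<p} - v ` {..<p}) \<le> card {a}" by (intro card_mono) auto
    then show ?thesis by (intro near) simp
  qed
  have b: "b < r" using jb k by auto
  have sum_split: "(\<Sum>l<r. d l * \<phi> (k(jb := l))) = d b * \<phi> k + (\<Sum>l\<in>{..<r} - {b}. d l * \<phi> (k(jb := l)))"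
    for \<phi> :: "(nat \<Rightarrow> nat) \<Rightarrow> complex"
  proof -
    have "k(jb := b) = k" using jb by auto
    then show ?thesis using sum.remove[of "{..<r}" b "\<lambda>l. d l * \<phi> (k(jb := l))"] b by simp
  qed
  have "(\<Sum>l\<in>{..<r} - {b}. d l * C (k(jb := l))) = (\<Sum>l\<in>{..<r} - {b}. d l * \<psi> (k(jb := l)))"
    by (rule sum.cong) (auto simp: same)
  moreover have "d b * C k + (\<Sum>l\<in>{..<r} - {b}. d l * C (k(jb := l))) = 0"
    using dC[of k jb] k jb(1) by (simp only: sum_split)
  moreover have "d b * \<psi> k + (\<Sum>l\<in>{..<r} - {b}. d l * \<psi> (k(jb := l))) = 0"
    using d\<psi>[of k jb] k jb(1) by (simp only: sum_split)
  ultimately have "d b * C k = d b * \<psi> k" by (metis add_right_cancel)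
  then show ?thesis using d[OF b] by simp
qed

lemma card_less_of_removed:
  assumes "finite T" "e \<in> T" "S \<subseteq> T - {e}" shows "card S < card T"
  using assms by (intro psubset_card_mono) auto

text \<open>Induction on the number of entries of \<open>k\<close> outside \<open>v\<close>. If \<open>a\<close>, \<open>b\<close> are two of them, and \<open>x\<close>, \<open>y\<close> are
entries of \<open>v\<close> missing in \<open>k\<close>, let \<open>w\<close> be \<open>k\<close> with \<open>a\<close>, \<open>b\<close> replaced by \<open>x\<close>, \<open>y\<close>. The exchange relation
between \<open>w\<close> and \<open>k\<close> is a three-term Pluecker relation that expresses \<open>C w * C k\<close> by values closer to \<open>v\<close>,
and the pivot \<open>C w\<close> is nonzero by assumption.\<close>

lemma agree_of_exchange:
  assumes C: "alternating_seq p C" and \<psi>: "alternating_seq p \<psi>"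
    and near: "\<And>k. card (k ` {..<p} - v ` {..<p}) \<le> 1 \<Longrightarrow> C k = \<psi> k"
    and exC: "\<And>w u j. (\<And>i. i < p \<Longrightarrow> w i < r) \<Longrightarrow> (\<And>i. i < p \<Longrightarrow> u i < r) \<Longrightarrow> j < p \<Longrightarrow>
      card (w ` {..<p} \<union> u ` {..<p}) \<le> p + 2 \<Longrightarrow> exchange_at p C w u j"
    and ex\<psi>: "\<And>w u j. j < p \<Longrightarrow> exchange_at p \<psi> w u j"
    and nz: "\<And>w. inj_on w {..<p} \<Longrightarrow> (\<And>i. i < p \<Longrightarrow> w i < r) \<Longrightarrow>
      card (w ` {..<p} - v ` {..<p}) + 2 \<le> p \<Longrightarrow> C w \<noteq> 0"
    and v: "inj_on v {..<p}" "\<And>i. i < p \<Longrightarrow> v i < r" and k: "\<And>i. i < p \<Longrightarrow> k i < r"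
  shows "C k = \<psi> k"
  using k
proof (induction "card (k ` {..<p} - v ` {..<p})" arbitrary: k rule: less_induct)
  case less
  note k = less.prems
  let ?dist = "\<lambda>k. card (k ` {..<p} - v ` {..<p})"
  show ?case
  proof (cases "inj_on k {..<p} \<and> ?dist k > 1")
    case False
    show ?thesis
    proof (cases "inj_on k {..<p}")
      case True
      then show ?thesis using False near by simp
    next
      case False
      then show ?thesis using alternating_seq_not_inj[OF C] alternating_seq_not_inj[OF \<psi>] by simp
    qed
  next
    case True
    then have inj: "inj_on k {..<p}" by simp
    obtain a b where ab: "a \<noteq> b" "a \<in> k ` {..<p} - v ` {..<p}" "b \<in> k ` {..<p} - v ` {..<p}"
      using two_distinct_elements[of "k ` {..<p} - v ` {..<p}"] True by blast
    have "card (v ` {..<p} - k ` {..<p}) = ?dist k"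
      using inj v(1) by (simp add: card_image card_Diff_subset_Int Int_commute)
    then obtain x y where xy: "x \<noteq> y" "x \<in> v ` {..<p} - k ` {..<p}" "y \<in> v ` {..<p} - k ` {..<p}"
      using two_distinct_elements[of "v ` {..<p} - k ` {..<p}"] True by metis
    obtain ja where ja: "ja < p" "k ja = a" using ab by auto
    obtain jb where jb: "jb < p" "k jb = b" using ab by auto
    have jab: "ja \<noteq> jb" using ja jb ab by auto
    have kinj: "m = m'" if "k m = k m'" "m < p" "m' < p" for m m' using inj that by (auto dest: inj_onD)
    have xr: "x < r" "y < r" using xy v(2) by auto
    have closer: "?dist w < ?dist k" if "w ` {..<p} - v ` {..<p} \<subseteq> k ` {..<p} - v ` {..<p} - {e}" "e \<in> {a, b}" for w e
    proof (rule card_less_of_removed[OF _ _ that(1)])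
      show "e \<in> k ` {..<p} - v ` {..<p}" using that(2) ab by auto
    qed simp
    define w where "w = k(ja := x, jb := y)"
    have w_set: "w ` {..<p} - v ` {..<p} \<subseteq> k ` {..<p} - v ` {..<p} - {a, b}"
    proof
      fix e assume e: "e \<in> w ` {..<p} - v ` {..<p}"
      then obtain m where m: "m < p" "e = w m" by auto
      have "w ja = x" "w jb = y" using jab by (simp_all add: w_def)
      then have "m \<noteq> ja" "m \<noteq> jb" using e m xy(2,3) by blast+
      then have "e = k m" "k m \<noteq> a" "k m \<noteq> b"
        using m ja jb kinj[of m ja] kinj[of m jb] by (auto simp: w_def)
      then show "e \<in> k ` {..<p} - v ` {..<p} - {a, b}" using e m(1) by simp
    qed
    have w_r: "w i < r" if "i < p" for i using that k xr by (auto simp: w_def)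
    have kxy: "k m \<noteq> x" "k m \<noteq> y" if "m < p" for m
      using xy(2,3) imageI[of m "{..<p}" k] that by force+
    have w_inj: "inj_on w {..<p}"
    proof (rule inj_onI)
      fix m m' assume m: "m \<in> {..<p}" "m' \<in> {..<p}" and eq: "w m = w m'"
      then show "m = m'"
        using xy(1) kxy[of m] kxy[of m'] kinj[of m m'] by (simp add: w_def split: if_splits)
    qed
    have "card (k ` {..<p} - v ` {..<p} - {a, b}) = ?dist k - 2"
      using ab by (subst card_Diff_subset) auto
    moreover have "?dist w \<le> card (k ` {..<p} - v ` {..<p} - {a, b})" by (rule card_mono[OF _ w_set]) auto
    moreover have "?dist k \<le> p" using card_mono[of "k ` {..<p}" "k ` {..<p} - v ` {..<p}"] inj by (simp add: card_image)
    ultimately have "?dist w + 2 \<le> p" using True by linarith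
    then have Cw: "C w \<noteq> 0" using nz[of w] w_inj w_r by blast
    have "w ` {..<p} \<union> k ` {..<p} \<subseteq> k ` {..<p} \<union> {x, y}" by (auto simp: w_def)
    then have "card (w ` {..<p} \<union> k ` {..<p}) \<le> card (k ` {..<p} \<union> {x, y})" by (intro card_mono) auto
    also have "\<dots> \<le> card (k ` {..<p}) + card {x, y}" by (rule card_Un_le)
    also have "\<dots> \<le> p + 2" using inj xy by (simp add: card_image)
    finally have ex: "exchange_at p C w k ja" by (intro exC w_r k ja)
    have terms: "\<phi> w * \<phi> k = \<phi> (k(jb := y)) * \<phi> (k(ja := x)) + \<phi> (k(ja := x, jb := a)) * \<phi> (k(ja := y))"
      if alt: "alternating_seq p \<phi>" and e: "exchange_at p \<phi> w k ja" for \<phi>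
    proof -
      have "\<phi> (k(ja := w i)) = 0" if "i < p" "i \<noteq> ja" "i \<noteq> jb" for i
        by (rule alternating_seq_repeat[OF alt that(1) ja(1) that(2)]) (use that in \<open>auto simp: w_def\<close>)
      then have "(\<Sum>i<p. \<phi> (w(i := k ja)) * \<phi> (k(ja := w i))) = (\<Sum>i\<in>{ja, jb}. \<phi> (w(i := k ja)) * \<phi> (k(ja := w i)))"
        using ja jb by (intro sum.mono_neutral_right) auto
      moreover have "w(ja := k ja) = k(jb := y)" "w(jb := k ja) = k(ja := x, jb := a)"
        using ja jab by (auto simp: w_def)
      moreover have "w ja = x" "w jb = y" using jab by (auto simp: w_def)
      ultimately show ?thesis using e jab by (simp add: exchange_at_def)
    qed
    have upd: "C (k(m := e)) = \<psi> (k(m := e))" if m: "m < p" "k m \<in> {a, b}" and e: "e \<in> v ` {..<p}" for m e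
    proof (rule less.hyps[OF closer[OF _ m(2)]])
      show "(k(m := e)) ` {..<p} - v ` {..<p} \<subseteq> k ` {..<p} - v ` {..<p} - {k m}"
      proof
        fix s assume s: "s \<in> (k(m := e)) ` {..<p} - v ` {..<p}"
        then obtain m' where m': "m' < p" "s = (k(m := e)) m'" by auto
        then have "m' \<noteq> m" using s e by auto
        then have "s = k m'" "k m' \<noteq> k m" using m m' kinj[of m' m] by auto
        then show "s \<in> k ` {..<p} - v ` {..<p} - {k m}" using s m'(1) by simp
      qed
      show "(k(m := e)) i < r" if "i < p" for i using that k e v(2) by auto
    qed
    have xv: "x \<in> v ` {..<p}" "y \<in> v ` {..<p}" using xy by auto
    have "C w = \<psi> w"
    proof (rule less.hyps[OF closer[of w a]])
      show "w ` {..<p} - v ` {..<p} \<subseteq> k ` {..<p} - v ` {..<p} - {a}" using w_set by auto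
    qed (use w_r in auto)
    moreover have "C (k(jb := y)) = \<psi> (k(jb := y))" "C (k(ja := x)) = \<psi> (k(ja := x))"
      "C (k(ja := y)) = \<psi> (k(ja := y))"
      using upd[OF ja(1) _ xv(1)] upd[OF ja(1) _ xv(2)] upd[OF jb(1) _ xv(2)] ja(2) jb(2) by auto
    moreover have "C (k(ja := x, jb := a)) = \<psi> (k(ja := x, jb := a))"
    proof (rule less.hyps[OF closer[of _ b]])
      show "(k(ja := x, jb := a)) ` {..<p} - v ` {..<p} \<subseteq> k ` {..<p} - v ` {..<p} - {b}"
      proof
        fix s assume s: "s \<in> (k(ja := x, jb := a)) ` {..<p} - v ` {..<p}"
        then obtain m where m: "m < p" "s = (k(ja := x, jb := a)) m" by auto
        then have mja: "m \<noteq> ja" using s xv jab by auto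
        show "s \<in> k ` {..<p} - v ` {..<p} - {b}"
        proof (cases "m = jb")
          case True
          then have "s = a" using m by simp
          then show ?thesis using ab by auto
        next
          case False
          then have "s = k m" "k m \<noteq> b" using mja m jb kinj[of m jb] by auto
          then show ?thesis using s m(1) by simp
        qed
      qed
      show "(k(ja := x, jb := a)) i < r" if "i < p" for i using that k xr ja by auto
    qed simp
    ultimately have "\<psi> w * C k = \<psi> w * \<psi> k"
      using terms[OF C ex] terms[OF \<psi> ex\<psi>[OF ja(1)]] by simp
    then show ?thesis using Cw \<open>C w = \<psi> w\<close> by simp
  qed
qed

lemma exchange_imp_rows:
  assumes p: "p \<ge> 1" and C: "alternating_seq p C" and v: "C v \<noteq> 0" "\<And>i. i < p \<Longrightarrow> v i < r"
    and ex: "\<And>u j. (\<And>i. i < p \<Longrightarrow> u i < r) \<Longrightarrow> j < p \<Longrightarrow> exchange_at p C v u j"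
    and k: "\<And>i. i < p \<Longrightarrow> k i < (r::nat)"
  shows "C k = cdet p (\<lambda>j i. adapted_rows C v i (k j))"
  unfolding cdet_adapted_rows[OF p]
  by (rule exchange_normal_form[where A = "{..<r}", OF C]) (use ex v k in auto)

lemma cdet_rows_contraction:
  fixes L :: "nat \<Rightarrow> nat \<Rightarrow> complex"
  assumes L: "\<And>i. i < p \<Longrightarrow> (\<Sum>l<r. L i l * d l) = 0" and j: "j < p"
  shows "(\<Sum>l<r. d l * cdet p (\<lambda>m i. L i ((s(j := l)) m))) = 0"
proof -
  have upd: "(\<lambda>m i. L i ((s(j := l)) m)) = (\<lambda>m i. L i (s m))(j := \<lambda>i. L i l)" for l by auto
  have "cdet p ((\<lambda>m i. L i (s m))(j := \<lambda>i. 0)) = (\<Sum>l<r. d l * cdet p ((\<lambda>m i. L i (s m))(j := \<lambda>i. L i l)))"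
    by (rule cdet_upd_sum[OF j]) (use L in \<open>simp add: mult.commute\<close>)
  moreover have "cdet p ((\<lambda>m i. L i (s m))(j := \<lambda>i. 0)) = 0"
    by (rule cdet_zero_column[OF j]) simp
  ultimately show ?thesis unfolding upd by simp
qed

section \<open>Totally decomposable forms\<close>

text \<open>The rows of \<open>L\<close> are linear forms on \<open>\<complex>\<^sup>r\<close> whose product has the coefficients \<open>c\<close>.\<close>

definition decomposed_by :: "nat \<Rightarrow> nat \<Rightarrow> (nat set \<Rightarrow> complex) \<Rightarrow> (nat \<Rightarrow> nat \<Rightarrow> complex) \<Rightarrow> bool" where
  "decomposed_by p r c L \<longleftrightarrow>
     (\<forall>k. (\<forall>j<p. k j < r) \<longrightarrow> coef_seq p r c k = cdet p (\<lambda>j i. L i (k j)))"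

lemma decomposed_by_minors: "decomposed_by p r (minors p L) L"
  by (simp add: decomposed_by_def coef_seq_minors)

context ordinary_divisor begin

lemma log_form_nonzero_coef:
  assumes "log_form f r p c \<noteq> 0"
  obtains J where "J \<subseteq> {..<r}" "card J = p" "c J \<noteq> 0"
proof -
  have "\<exists>J. J \<subseteq> {..<r} \<and> card J = p \<and> c J \<noteq> 0"
  proof (rule ccontr)
    assume "\<not> ?thesis"
    then have "log_form f r p c z v = 0" for z v by (auto simp: log_form_def intro!: sum.neutral)
    then show False using assms by (simp add: fun_eq_iff)
  qed
  then show ?thesis using that by blast
qed

lemma log_form_nonzero_seq:
  assumes "log_form f r p c \<noteq> 0"
  obtains v where "coef_seq p r c v \<noteq> 0" "\<forall>i<p. v i < r" "inj_on v {..<p}"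
proof -
  obtain J where J: "J \<subseteq> {..<r}" "card J = p" "c J \<noteq> 0" using log_form_nonzero_coef assms by blast
  show ?thesis
    by (rule that[of "\<lambda>i. sorted_list_of_set J ! i"])
       (use J sorted_list_nth_less(2) sorted_list_nth_inj[OF J(1)] in \<open>auto simp: coef_seq_sorted inj_on_def\<close>)
qed

lemma log_form_polar: "z \<in> polar_divisor f r \<Longrightarrow> log_form f r p c z v = 0"
  by (simp add: log_form_def)

lemma log_form_decomposed:
  assumes p: "p \<ge> 1" and L: "decomposed_by p r c L"
  shows "log_form f r p c = (\<lambda>z. wedge1 p (\<lambda>j. log_form f r 1 (\<lambda>J. L j (the_elem J)) z))"
proof (intro ext)
  fix z v
  show "log_form f r p c z v = wedge1 p (\<lambda>j. log_form f r 1 (\<lambda>J. L j (the_elem J)) z) v"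
  proof (cases "z \<in> polar_divisor f r")
    case True
    then show ?thesis
      using p by (simp add: log_form_polar wedge1_eq_cdet cdet_zero_column[of 0])
  next
    case False
    have "log_form f r p c z v = cdet p (\<lambda>j i. \<Sum>l<r. L i l * dlog z (v j) l)"
      unfolding log_form_eq_lform[OF False]
      by (rule lform_eq_cdet) (use L in \<open>simp add: decomposed_by_def\<close>)
    then show ?thesis
      by (simp add: wedge1_eq_cdet log_form_eq_lform[OF False] lform_1[unfolded One_nat_def])
  qed
qed

lemma wedge_log_forms_decomposed:
  assumes p: "p \<ge> 1" and \<theta>: "\<And>j. j < p \<Longrightarrow> \<theta> j \<in> log_forms f r 1"
  obtains L where "(\<lambda>z. wedge1 p (\<lambda>j. \<theta> j z)) = log_form f r p (minors p L)"
proof -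
  have "\<forall>j. \<exists>c. j < p \<longrightarrow> \<theta> j = log_form f r 1 c" using \<theta> unfolding log_forms_def by blast
  then obtain l where l: "\<And>j. j < p \<Longrightarrow> \<theta> j = log_form f r 1 (l j)" by metis
  define L where "L j i = l j {i}" for j i
  have row: "log_form f r 1 (\<lambda>J. L j (the_elem J)) z s = log_form f r 1 (l j) z s" for j z s
    by (cases "z \<in> polar_divisor f r")
       (simp_all add: log_form_polar log_form_eq_lform lform_1[unfolded One_nat_def] L_def)
  have "(\<lambda>z. wedge1 p (\<lambda>j. \<theta> j z)) = (\<lambda>z. wedge1 p (\<lambda>j. log_form f r 1 (\<lambda>J. L j (the_elem J)) z))"
    unfolding wedge1_eq_cdet[abs_def]
    by (intro ext cdet_cong_entries) (simp add: l row[unfolded One_nat_def])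
  also have "\<dots> = log_form f r p (minors p L)"
    by (rule log_form_decomposed[OF p decomposed_by_minors, symmetric])
  finally show ?thesis by (rule that)
qed

lemma mem_L_td:
  assumes p: "p \<ge> 1" and L: "decomposed_by p r c L"
    and \<eta>: "log_form f r p c \<in> log_forms_R f r p - {0}"
  shows "proj_pt scale_form (log_form f r p c) \<in> L_td f r p"
proof -
  let ?\<theta> = "\<lambda>j. log_form f r 1 (\<lambda>J. L j (the_elem J))"
  note eq = log_form_decomposed[OF p L]
  have "?\<theta> j \<noteq> 0" if j: "j < p" for j
  proof
    assume zero: "?\<theta> j = 0"
    have "(\<Prod>i<p. ?\<theta> i z (\<lambda>_. v (\<pi> i))) = 0" for z \<pi> and v :: "nat \<Rightarrow> complex^'m"
      by (rule prod_zero) (use j zero in \<open>auto intro!: bexI[of _ j]\<close>)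
    then have "wedge1 p (\<lambda>j. ?\<theta> j z) v = 0" for z v
      unfolding wedge1_def by (intro sum.neutral ballI) (simp only: mult_zero_right)
    then have "log_form f r p c = 0" unfolding eq by (intro ext) simp
    then show False using \<eta> by simp
  qed
  then have "\<forall>j<p. ?\<theta> j \<in> log_forms f r 1 - {0}" by (auto simp: log_forms_def)
  then show ?thesis
    unfolding L_td_def using \<eta> eq by (intro imageI CollectI conjI exI[of _ ?\<theta>]) auto
qed

lemma L_td_cases:
  assumes p: "p \<ge> 1" and X: "X \<in> L_td f r p"
  obtains L where "X = proj_pt scale_form (log_form f r p (minors p L))"
    "log_form f r p (minors p L) \<in> log_forms_R f r p - {0}"
proof -
  obtain \<eta> \<theta> where \<eta>: "X = proj_pt scale_form \<eta>" "\<eta> \<in> log_forms_R f r p - {0}"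
    and \<theta>: "\<forall>j<p. \<theta> j \<in> log_forms f r 1 - {0}" "\<eta> = (\<lambda>z. wedge1 p (\<lambda>j. \<theta> j z))"
    using X unfolding L_td_def by blast
  obtain L where "\<eta> = log_form f r p (minors p L)"
    using wedge_log_forms_decomposed[OF p, of \<theta>] \<theta> by auto
  then show ?thesis using \<eta> that by blast
qed

lemma L_td_subset_L_F:
  assumes p: "p \<ge> 1" shows "L_td f r p \<subseteq> L_F f r p"
  unfolding L_td_def L_F_def
  using integrable_wedge_of_log_forms[OF p] by (intro image_mono) blast

lemma L_F_cases:
  assumes X: "X \<in> L_F f r p"
  obtains c where "X = proj_pt scale_form (log_form f r p c)" "log_form f r p c \<in> log_forms_R f r p - {0}"
    "integrable_form (polar_divisor f r) p (log_form f r p c)"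
  using X unfolding L_F_def log_forms_R_def log_forms_def by blast

lemma log_forms_R_contraction:
  assumes "p < CARD('m)" "log_form f r p c \<in> log_forms_R f r p" "\<And>i. i < p \<Longrightarrow> s i < r" "j < p"
  shows "(\<Sum>l<r. of_nat (deg l) * coef_seq p r c (s(j := l))) = 0"
  by (rule coef_seq_contraction[OF assms(1) _ assms(3,4)]) (use assms(2) in \<open>simp add: log_forms_R_def\<close>)

text \<open>For \<open>z \<noteq> 0\<close> the tangent space has a basis consisting of \<open>z\<close> and all but one of the coordinate
vectors. Among \<open>CARD('m)\<close> or more of these, \<open>z\<close> occurs or a vector is repeated.\<close>

lemma log_forms_R_high_degree:
  assumes p: "p \<ge> CARD('m)" and r: "r > 0" and \<eta>: "log_form f r p c \<in> log_forms_R f r p"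
  shows "log_form f r p c = 0"
proof (intro ext)
  fix z v
  have R: "interior_product radial_field (log_form f r p c) = 0" using \<eta> by (simp add: log_forms_R_def)
  show "log_form f r p c z v = 0 z v"
  proof (cases "z \<in> polar_divisor f r")
    case True
    then show ?thesis by (simp add: log_form_polar)
  next
    case False
    have "z \<noteq> 0" using False r f_0 by (auto simp: polar_divisor_def)
    then obtain i0 where i0: "z $ i0 \<noteq> 0" by (auto simp: vec_eq_iff)
    have alt: "alternating p (log_form f r p c z)"
      using holomorphic_log_form False by (simp add: holomorphic_form_on_def)
    let ?B = "insert z ((\<lambda>i. axis i 1) ` (UNIV - {i0}))"
    have "log_form f r p c z v = 0"
    proof (rule vanish_by_slots[where p = p and A = UNIV and B = ?B and P = "\<lambda>v. log_form f r p c z v = 0"])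
      fix v assume v: "\<And>j. j < p \<Longrightarrow> v j \<in> ?B"
      show "log_form f r p c z v = 0"
      proof (cases "\<exists>j<p. v j = z")
        case True
        then obtain j where j: "j < p" "v j = z" by blast
        then show ?thesis using log_form_slot_radial[OF R False j(1), of v] by (metis fun_upd_triv)
      next
        case noz: False
        have "\<not> inj_on v {..<p}"
        proof
          assume "inj_on v {..<p}"
          moreover have "v ` {..<p} \<subseteq> (\<lambda>i. axis i 1) ` (UNIV - {i0})" using v noz by auto
          ultimately have "card {..<p} \<le> card ((\<lambda>i. axis i (1::complex)) ` (UNIV - {i0}))"
            by (intro card_inj_on_le) auto
          also have "\<dots> \<le> card (UNIV - {i0})" by (rule card_image_le) simp
          also have "\<dots> < CARD('m)" by (intro psubset_card_mono) auto
          finally show False using p by simp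
        qed
        then obtain a b where "a < p" "b < p" "a \<noteq> b" "v a = v b" by (auto simp: inj_on_def)
        then show ?thesis by (rule alternatingD(3)[OF alt])
      qed
    next
      fix v j assume j: "j < p" and hyp: "\<And>b. b \<in> ?B \<Longrightarrow> log_form f r p c z (v(j := b)) = 0"
      let ?\<phi> = "\<lambda>x. log_form f r p c z (v(j := x))"
      have lin: "Vector_Spaces.linear (*s) (*) ?\<phi>" by (rule alternatingD(2)[OF alt j])
      define a where "a = v j $ i0 / z $ i0"
      have "v j - a *s z = (\<Sum>i\<in>UNIV - {i0}. (v j - a *s z) $ i *s axis i 1)"
      proof -
        have "(v j - a *s z) = (\<Sum>i\<in>UNIV. (v j - a *s z) $ i *s axis i 1)"
          by (simp add: vec_eq_iff axis_def if_distrib sum.delta cong: if_cong)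
        also have "\<dots> = (v j - a *s z) $ i0 *s axis i0 1 + (\<Sum>i\<in>UNIV - {i0}. (v j - a *s z) $ i *s axis i 1)"
          by (rule sum.remove) auto
        also have "(v j - a *s z) $ i0 = 0" using i0 by (simp add: a_def)
        finally show ?thesis by (simp only: vec.scale_zero_left add_0_left)
      qed
      then have "?\<phi> (v j - a *s z) = ?\<phi> (\<Sum>i\<in>UNIV - {i0}. (v j - a *s z) $ i *s axis i 1)" by (rule arg_cong)
      also have "\<dots> = (\<Sum>i\<in>UNIV - {i0}. (v j - a *s z) $ i * ?\<phi> (axis i 1))"
        by (simp only: complex_linearD(2,3)[OF lin])
      also have "\<dots> = 0" by (intro sum.neutral ballI) (use hyp in auto)
      finally have "?\<phi> (v j) = a * ?\<phi> z" by (simp only: complex_linearD(2,5)[OF lin] right_minus_eq)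
      then show "log_form f r p c z v = 0" using hyp[of z] by simp
    qed auto
    then show ?thesis by simp
  qed
qed

lemma few_functions_decomposed:
  assumes p: "p \<ge> 1" "p < CARD('m)" and r: "r \<le> p + 2" and \<eta>: "log_form f r p c \<in> log_forms_R f r p - {0}"
  shows "\<exists>L. decomposed_by p r c L"
proof -
  let ?C = "coef_seq p r c"
  obtain v where "?C v \<noteq> 0" "\<forall>i<p. v i < r" "inj_on v {..<p}" using log_form_nonzero_seq \<eta> by blast
  then have v: "?C v \<noteq> 0" "\<And>i. i < p \<Longrightarrow> v i < r" "inj_on v {..<p}" by blast+
  let ?L = "adapted_rows ?C v"
  have contr: "(\<Sum>l<r. of_nat (deg l) * ?C (s(j := l))) = 0" if "\<And>i. i < p \<Longrightarrow> s i < r" "j < p" for s j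
    by (rule log_forms_R_contraction) (use p \<eta> that in auto)
  have "?C k = cdet p (\<lambda>j i. ?L i (k j))" if k: "\<And>j. j < p \<Longrightarrow> k j < r" for k
  proof (rule agree_of_contraction[where \<psi> = "\<lambda>k. cdet p (\<lambda>j i. ?L i (k j))" and v = v and r = r and d = "\<lambda>l. of_nat (deg l)" and p = p])
    show "?C k = cdet p (\<lambda>j i. ?L i (k j))" if "card (k ` {..<p} - v ` {..<p}) \<le> 1" for k
      by (rule adapted_rows_agree[OF alternating_coef_seq p(1) v(1) that])
    show "(\<Sum>l<r. of_nat (deg l) * cdet p (\<lambda>m i. ?L i ((s(j := l)) m))) = 0" if j: "j < p" for s j
      by (rule cdet_rows_contraction[OF adapted_rows_contraction j]) (use contr v in auto)
    show "of_nat (deg l) \<noteq> (0::complex)" if "l < r" for l using deg_pos[OF that] by simp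
    show "alternating_seq p ?C" by (rule alternating_coef_seq)
    show "alternating_seq p (\<lambda>k. cdet p (\<lambda>j i. ?L i (k j)))" by (rule alternating_cdet_rows)
    show "(\<Sum>l<r. of_nat (deg l) * ?C (s(j := l))) = 0" if "\<And>i. i < p \<Longrightarrow> s i < r" "j < p" for s j
      by (rule contr[OF that])
  qed (use r v k in auto)
  then show ?thesis unfolding decomposed_by_def by blast
qed

text \<open>For \<open>p = 2\<close> every pivot in \<open>agree_of_exchange\<close> is a rearrangement of \<open>v\<close>, hence nonzero; for larger \<open>p\<close> the
pivots are arbitrary coefficients.\<close>

lemma integrable_decomposed:
  assumes p: "p \<ge> 1" "p + 2 < CARD('m)" and nz: "log_form f r p c \<noteq> 0"
    and int: "integrable_form (polar_divisor f r) p (log_form f r p c)"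
    and gen: "p = 2 \<or> (\<forall>J. J \<subseteq> {..<r} \<and> card J = p \<longrightarrow> c J \<noteq> 0)"
  shows "\<exists>L. decomposed_by p r c L"
proof -
  let ?C = "coef_seq p r c"
  obtain v where "?C v \<noteq> 0" "\<forall>i<p. v i < r" "inj_on v {..<p}" using log_form_nonzero_seq nz by blast
  then have v: "?C v \<noteq> 0" "\<And>i. i < p \<Longrightarrow> v i < r" "inj_on v {..<p}" by blast+
  let ?L = "adapted_rows ?C v"
  have same_set: "?C w = of_int (sign \<pi>) * ?C u" if "\<pi> permutes {..<p}" "\<And>i. i < p \<Longrightarrow> w i = u (\<pi> i)" for w u \<pi>
    using alternating_seq_cong[OF alternating_coef_seq, of p w "u \<circ> \<pi>"]
      alternating_seq_permute[OF alternating_coef_seq that(1)] that(2) by simp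
  have image_nz: "?C w \<noteq> 0" if w: "inj_on w {..<p}" and u: "?C u \<noteq> 0" and sub: "w ` {..<p} \<subseteq> u ` {..<p}" for w u
  proof -
    have "\<forall>m<p. \<exists>s<p. w m = u s" using sub by auto
    then obtain \<sigma> where \<sigma>: "\<And>m. m < p \<Longrightarrow> \<sigma> m < p \<and> w m = u (\<sigma> m)" by metis
    have "inj_on \<sigma> {..<p}" using w \<sigma> by (metis (no_types, lifting) inj_on_def lessThan_iff)
    moreover have "\<sigma> ` {..<p} \<subseteq> {..<p}" using \<sigma> by auto
    ultimately obtain \<pi> where \<pi>: "\<pi> permutes {..<p}" "\<And>i. i < p \<Longrightarrow> \<pi> i = \<sigma> i"
      using permutes_of_inj[of \<sigma> p] by blast
    have "?C w = of_int (sign \<pi>) * ?C u" by (rule same_set[OF \<pi>(1)]) (use \<sigma> \<pi> in auto)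
    then show ?thesis using u by simp
  qed
  have "?C k = cdet p (\<lambda>j i. ?L i (k j))" if k: "\<And>j. j < p \<Longrightarrow> k j < r" for k
  proof (rule agree_of_exchange[where \<psi> = "\<lambda>k. cdet p (\<lambda>j i. ?L i (k j))" and v = v and r = r and p = p])
    show "?C k = cdet p (\<lambda>j i. ?L i (k j))" if "card (k ` {..<p} - v ` {..<p}) \<le> 1" for k
      by (rule adapted_rows_agree[OF alternating_coef_seq p(1) v(1) that])
    show "exchange_at p ?C w u j"
      if "\<And>i. i < p \<Longrightarrow> w i < r" "\<And>i. i < p \<Longrightarrow> u i < r" "j < p" "card (w ` {..<p} \<union> u ` {..<p}) \<le> p + 2" for w u j
      by (rule exchange_coef_seq_limit[OF integrable_exchange[OF int]]) (use that p in auto)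
    show "exchange_at p (\<lambda>k. cdet p (\<lambda>j i. ?L i (k j))) w u j" if "j < p" for w u j
      using exchange_cdet_compose[OF that, of "\<lambda>l i. ?L i l" w u] by simp
    show "?C w \<noteq> 0" if w: "inj_on w {..<p}" "\<And>i. i < p \<Longrightarrow> w i < r" "card (w ` {..<p} - v ` {..<p}) + 2 \<le> p" for w
      using gen
    proof
      assume "p = 2"
      then have "w ` {..<p} \<subseteq> v ` {..<p}" using w(3) by simp
      then show ?thesis by (rule image_nz[OF w(1) v(1)])
    next
      assume all: "\<forall>J. J \<subseteq> {..<r} \<and> card J = p \<longrightarrow> c J \<noteq> 0"
      let ?I = "w ` {..<p}"
      have I: "?I \<subseteq> {..<r}" "card ?I = p" using w by (auto simp: card_image)
      then have "?C (\<lambda>i. sorted_list_of_set ?I ! i) \<noteq> 0" using all by (simp add: coef_seq_sorted)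
      moreover have "?I \<subseteq> (\<lambda>i. sorted_list_of_set ?I ! i) ` {..<p}"
        using sorted_list_nth_surj[OF I(1)] I(2) by (metis (no_types, lifting) imageI lessThan_iff subsetI)
      ultimately show ?thesis by (rule image_nz[OF w(1)])
    qed
    show "alternating_seq p ?C" by (rule alternating_coef_seq)
    show "alternating_seq p (\<lambda>k. cdet p (\<lambda>j i. ?L i (k j)))" by (rule alternating_cdet_rows)
  qed (use v k in auto)
  then show ?thesis unfolding decomposed_by_def by blast
qed

lemma L_td_eq_L_F:
  assumes p: "p \<ge> 1" and cases: "p = 2 \<and> p + 2 < CARD('m) \<or> r = p + 1 \<or> r = p + 2"
  shows "L_td f r p = L_F f r p"
proof
  show "L_td f r p \<subseteq> L_F f r p" by (rule L_td_subset_L_F[OF p])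
  show "L_F f r p \<subseteq> L_td f r p"
  proof
    fix X assume "X \<in> L_F f r p"
    then obtain c where c: "X = proj_pt scale_form (log_form f r p c)" "log_form f r p c \<in> log_forms_R f r p - {0}"
      "integrable_form (polar_divisor f r) p (log_form f r p c)" by (rule L_F_cases)
    have "p < CARD('m)"
    proof (rule ccontr)
      assume "\<not> p < CARD('m)"
      moreover from this have "r > 0" using cases by auto
      ultimately show False using log_forms_R_high_degree[of p c] c(2) by simp
    qed
    have "\<exists>L. decomposed_by p r c L"
    proof (cases "r = p + 1 \<or> r = p + 2")
      case True
      then show ?thesis using few_functions_decomposed[OF p \<open>p < CARD('m)\<close> _ c(2)] by auto
    next
      case False
      then show ?thesis using integrable_decomposed[OF p _ _ c(3)] cases c(2) by auto
    qed
    then show "X \<in> L_td f r p" using mem_L_td[OF p _ c(2)] c(1) by blast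
  qed
qed

end

section \<open>Irreducibility of the space of totally decomposable forms\<close>

lemma sum_form_apply: "(\<Sum>i\<in>S. g i) z v = (\<Sum>i\<in>S. (g i :: 'm form) z v)"
  by (induction S rule: infinite_finite_induct) auto

lemma poly_common_nonroot:
  assumes "finite S" "\<And>q. q \<in> S \<Longrightarrow> q \<noteq> 0"
  obtains t :: complex where "\<forall>q\<in>S. poly q t \<noteq> 0"
proof -
  have "\<Prod>S \<noteq> 0" using assms by auto
  then have "finite {t. poly (\<Prod>S) t = 0}" by (rule poly_roots_finite)
  then obtain t where "t \<notin> {t. poly (\<Prod>S) t = 0}"
    using ex_new_if_finite[OF infinite_UNIV_char_0] by blast
  then have "\<forall>q\<in>S. poly q t \<noteq> 0" using assms(1) by (simp add: poly_prod)
  then show ?thesis by (rule that)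
qed

text \<open>The line through two points of the parameter space. Irreducibility of \<open>L_td\<close> is checked on such lines, where it reduces to
the fact that a product of nonzero polynomials in one variable is nonzero.\<close>

definition row_line :: "(nat \<Rightarrow> nat \<Rightarrow> complex) \<Rightarrow> (nat \<Rightarrow> nat \<Rightarrow> complex) \<Rightarrow> complex \<Rightarrow> nat \<Rightarrow> nat \<Rightarrow> complex" where
  "row_line L1 L2 t i l = L1 i l + t * (L2 i l - L1 i l)"

lemma row_line_0: "row_line L1 L2 0 = L1" and row_line_1: "row_line L1 L2 1 = L2"
  by (simp_all add: row_line_def fun_eq_iff)

lemma minors_row_line: "\<exists>q. \<forall>t. minors p (row_line L1 L2 t) J = poly q t"
proof -
  let ?l = "\<lambda>i. sorted_list_of_set J ! i"
  have "minors p (row_line L1 L2 t) J = poly (\<Sum>\<pi> | \<pi> permutes {..<p}. smult (of_int (sign \<pi>))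
      (\<Prod>i<p. [:L1 i (?l (\<pi> i)), L2 i (?l (\<pi> i)) - L1 i (?l (\<pi> i)):])) t" for t
    by (simp add: minors_def cdet_def row_line_def poly_sum poly_prod)
  then show ?thesis by blast
qed

lemma row_line_contraction:
  assumes "(\<Sum>l<r. L1 i l * d l) = 0" "(\<Sum>l<r. L2 i l * d l) = (0::complex)"
  shows "(\<Sum>l<r. row_line L1 L2 t i l * d l) = 0"
proof -
  have "(\<Sum>l<r. row_line L1 L2 t i l * d l)
      = (1 - t) * (\<Sum>l<r. L1 i l * d l) + t * (\<Sum>l<r. L2 i l * d l)"
    by (simp add: row_line_def sum_distrib_left sum.distrib[symmetric] sum_subtractf[symmetric] algebra_simps)
  then show ?thesis using assms by simp
qed

lemma proj_pt_self: "x \<in> proj_pt scale_form x"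
proof -
  have "scale_form 1 x = x" by (simp add: scale_form_def)
  then show ?thesis unfolding proj_pt_def mem_Collect_eq by (intro exI[of _ 1]) simp
qed

lemma proj_pt_mem_zero_locus:
  assumes mem: "proj_pt scale_form x \<in> proj_pt scale_form ` {y \<in> V - {0}. \<forall>P\<in>S. P y = 0}"
    and S: "\<forall>P\<in>S. \<exists>d. homogeneous_poly scale_form d P" and P: "P \<in> S"
  shows "P x = 0"
proof -
  obtain y where y: "proj_pt scale_form x = proj_pt scale_form y" "P y = 0" using mem P by auto
  then obtain c where "x = scale_form c y" using proj_pt_self[of x] by (auto simp: proj_pt_def)
  then show ?thesis using S P y(2) by (auto simp: homogeneous_poly_def)
qed

context ordinary_divisor begin

lemma log_form_minors_in_R:
  assumes p: "p \<ge> 1" and L: "\<And>i. i < p \<Longrightarrow> (\<Sum>l<r. L i l * of_nat (deg l)) = 0"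
  shows "log_form f r p (minors p L) \<in> log_forms_R f r p"
proof -
  have "log_form f r p (minors p L) z (case_nat z v) = 0" for z v
  proof (cases "z \<in> polar_divisor f r")
    case True
    then show ?thesis by (simp add: log_form_polar)
  next
    case False
    have "lform p r (minors p L) u = cdet p (\<lambda>j i. \<Sum>l<r. L i l * u j l)" for u
      by (rule lform_eq_cdet) (simp add: coef_seq_minors)
    then have "log_form f r p (minors p L) z (case_nat z v) = cdet p (\<lambda>j i. \<Sum>l<r. L i l * dlog z (case_nat z v j) l)"
      by (simp add: log_form_eq_lform[OF False])
    also have "\<dots> = 0"
      by (rule cdet_zero_column[of 0]) (use p L dlog_radial[OF False] in auto)
    finally show ?thesis .
  qed
  then have "interior_product radial_field (log_form f r p (minors p L)) = 0"
    by (simp add: interior_product_def radial_field_def fun_eq_iff)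
  then show ?thesis by (simp add: log_forms_R_def log_forms_def)
qed

text \<open>The rows adapted to a nonzero coefficient automatically annihilate the degrees, since the
coefficients do.\<close>

lemma exchange_imp_L_td_rows:
  assumes p: "p \<ge> 1" "p < CARD('m)" and \<eta>: "log_form f r p c \<in> log_forms_R f r p - {0}"
    and ex: "\<And>v u j. (\<And>i. i < p \<Longrightarrow> v i < r) \<Longrightarrow> (\<And>i. i < p \<Longrightarrow> u i < r) \<Longrightarrow> j < p \<Longrightarrow>
      exchange_at p (coef_seq p r c) v u j"
  shows "\<exists>L. decomposed_by p r c L \<and> log_form f r p c = log_form f r p (minors p L) \<and>
    (\<forall>i<p. (\<Sum>l<r. L i l * of_nat (deg l)) = 0)"
proof -
  let ?C = "coef_seq p r c"
  obtain v where "?C v \<noteq> 0" "\<forall>i<p. v i < r" using log_form_nonzero_seq \<eta> by blast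
  then have v: "?C v \<noteq> 0" "\<And>i. i < p \<Longrightarrow> v i < r" by blast+
  define L where "L = adapted_rows ?C v"
  have L: "decomposed_by p r c L"
    unfolding decomposed_by_def L_def
  proof (intro allI impI)
    fix k :: "nat \<Rightarrow> nat" assume k: "\<forall>j<p. k j < r"
    show "?C k = cdet p (\<lambda>j i. adapted_rows ?C v i (k j))"
    proof (rule exchange_imp_rows[OF p(1) alternating_coef_seq v])
      show "exchange_at p ?C v u j" if "\<And>i. i < p \<Longrightarrow> u i < r" "j < p" for u j
        by (rule ex[OF v(2) that])
    qed (use k in auto)
  qed
  moreover have "log_form f r p c = log_form f r p (minors p L)"
    using log_form_decomposed[OF p(1) L] log_form_decomposed[OF p(1) decomposed_by_minors] by metis
  moreover have "(\<Sum>l<r. L i l * of_nat (deg l)) = 0" if i: "i < p" for i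
    unfolding L_def
    by (rule adapted_rows_contraction, rule log_forms_R_contraction) (use p \<eta> v i in auto)
  ultimately show ?thesis by blast
qed

lemma L_td_rows:
  assumes p: "p \<ge> 1" "p < CARD('m)" and X: "X \<in> L_td f r p"
  obtains L where "X = proj_pt scale_form (log_form f r p (minors p L))"
    "log_form f r p (minors p L) \<in> log_forms_R f r p - {0}"
    "\<forall>i<p. (\<Sum>l<r. L i l * of_nat (deg l)) = 0"
proof -
  obtain L0 where L0: "X = proj_pt scale_form (log_form f r p (minors p L0))"
    "log_form f r p (minors p L0) \<in> log_forms_R f r p - {0}" by (rule L_td_cases[OF p(1) X])
  have "exchange_at p (coef_seq p r (minors p L0)) v u j"
    if "\<And>i. i < p \<Longrightarrow> v i < r" "\<And>i. i < p \<Longrightarrow> u i < r" "j < p" for v u j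
    by (rule exchange_coef_seq_minors[OF that coef_seq_minors])
  from exchange_imp_L_td_rows[OF p L0(2) this] obtain L where
    "log_form f r p (minors p L0) = log_form f r p (minors p L)" "\<forall>i<p. (\<Sum>l<r. L i l * of_nat (deg l)) = 0"
    by blast
  then show ?thesis using that[of L] L0 by simp
qed

lemma L_td_of_rows:
  assumes p: "p \<ge> 1" "p < CARD('m)" and L: "\<forall>i<p. (\<Sum>l<r. L i l * of_nat (deg l)) = 0"
    and J: "J \<subseteq> {..<r}" "card J = p" "minors p L J \<noteq> 0"
  shows "log_form f r p (minors p L) \<in> log_forms_R f r p - {0}"
    and "proj_pt scale_form (log_form f r p (minors p L)) \<in> L_td f r p"
proof -
  have "log_form f r p (minors p L) \<noteq> log_form f r p (\<lambda>_. 0)"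
    using log_form_inj[OF p(2) _ J(1,2)] J(3) by blast
  moreover have "log_form f r p (\<lambda>_. 0) = 0" by (simp add: log_form_def fun_eq_iff)
  ultimately show "log_form f r p (minors p L) \<in> log_forms_R f r p - {0}"
    using log_form_minors_in_R[OF p(1)] L by auto
  then show "proj_pt scale_form (log_form f r p (minors p L)) \<in> L_td f r p"
    by (rule mem_L_td[OF p(1) decomposed_by_minors])
qed

text \<open>A single minor can be made nonzero, and a general point of the line between two matrices keeps the
nonvanishing of the minors of both.\<close>

lemma rows_with_nonzero_minors:
  assumes p: "p < r" and S: "finite S" "\<And>J. J \<in> S \<Longrightarrow> J \<subseteq> {..<r} \<and> card J = p"
  shows "\<exists>L. (\<forall>i<p. (\<Sum>l<r. L i l * of_nat (deg l)) = 0) \<and> (\<forall>J\<in>S. minors p L J \<noteq> 0)"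
  using S
proof (induction S rule: finite_induct)
  case empty
  show ?case by (rule exI[of _ "\<lambda>_ _. 0"]) simp
next
  case (insert J S)
  then obtain L1 where L1: "\<forall>i<p. (\<Sum>l<r. L1 i l * of_nat (deg l)) = 0" "\<forall>J\<in>S. minors p L1 J \<noteq> 0" by auto
  have J: "J \<subseteq> {..<r}" "card J = p" using insert.prems by auto
  have "\<not> {..<r} \<subseteq> J" using J p by (metis card_lessThan less_irrefl subset_antisym)
  then obtain x where x: "x < r" "x \<notin> J" by auto
  let ?l = "\<lambda>i. sorted_list_of_set J ! i"
  \<comment> \<open>The identity in the columns of \<open>J\<close>, corrected in the column \<open>x\<close> to annihilate the degrees.\<close>
  define L2 where "L2 i = (\<lambda>l. unit_vec (?l i) l - of_nat (deg (?l i)) / of_nat (deg x) * unit_vec x l :: complex)" for i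
  have unit_sum: "(\<Sum>l<r. unit_vec m l * d l) = d m" if "m < r" for m and d :: "nat \<Rightarrow> complex"
  proof -
    have "(\<Sum>l<r. unit_vec m l * d l) = (\<Sum>l<r. if l = m then d l else 0)"
      by (rule sum.cong) (auto simp: unit_vec_def)
    then show ?thesis using that by simp
  qed
  have L2: "(\<Sum>l<r. L2 i l * of_nat (deg l)) = 0" if i: "i < p" for i
  proof -
    have li: "?l i < r" using sorted_list_nth_less(2)[OF J(1)] J(2) i by simp
    have "(\<Sum>l<r. L2 i l * of_nat (deg l)) = (\<Sum>l<r. unit_vec (?l i) l * of_nat (deg l))
        - of_nat (deg (?l i)) / of_nat (deg x) * (\<Sum>l<r. unit_vec x l * of_nat (deg l))"
      unfolding L2_def sum_distrib_left sum_subtractf[symmetric]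
      by (rule sum.cong) (simp_all add: left_diff_distrib)
    then show ?thesis using unit_sum[OF li, of "\<lambda>l. of_nat (deg l)"] unit_sum[OF x(1), of "\<lambda>l. of_nat (deg l)"] deg_pos[OF x(1)] by simp
  qed
  have "minors p L2 J = cdet p unit_vec"
    unfolding minors_def
  proof (rule cdet_cong_entries)
    fix i j assume ij: "i < p" "j < p"
    have "?l j \<noteq> x" using sorted_list_nth_less(1)[OF J(1)] J(2) ij x by metis
    moreover have "?l j = ?l i \<longleftrightarrow> j = i" using sorted_list_nth_inj[OF J(1)] J(2) ij by metis
    ultimately show "L2 i (?l j) = unit_vec j i" by (auto simp: L2_def unit_vec_def)
  qed
  then have L2J: "minors p L2 J \<noteq> 0" by (simp add: cdet_unit)
  have "\<forall>I. \<exists>q. \<forall>t. minors p (row_line L1 L2 t) I = poly q t" using minors_row_line by blast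
  then obtain q where q: "\<And>I t. minors p (row_line L1 L2 t) I = poly (q I) t" by metis
  have q_nz: "q I \<noteq> 0" if I: "I \<in> insert J S" for I
  proof
    assume "q I = 0"
    then have "minors p (row_line L1 L2 t) I = 0" for t using q by simp
    from this[of 0] this[of 1] show False using I L1(2) L2J by (auto simp: row_line_0 row_line_1)
  qed
  obtain t where "\<forall>s\<in>q ` insert J S. poly s t \<noteq> 0"
    by (rule poly_common_nonroot[of "q ` insert J S"]) (use q_nz insert.hyps(1) in auto)
  then have "\<forall>I\<in>insert J S. minors p (row_line L1 L2 t) I \<noteq> 0" by (simp add: q)
  moreover have "\<forall>i<p. (\<Sum>l<r. row_line L1 L2 t i l * of_nat (deg l)) = 0"
    by (intro allI impI row_line_contraction) (use L1(1) L2 in auto)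
  ultimately show ?case by blast
qed

definition basic_form :: "nat \<Rightarrow> nat set \<Rightarrow> 'm form" where
  "basic_form p J = log_form f r p (\<lambda>I. if I = J then 1 else 0)"

lemma log_form_eq_sum:
  "log_form f r p c = (\<Sum>J | J \<subseteq> {..<r} \<and> card J = p. scale_form (c J) (basic_form p J))"
proof (intro ext)
  fix z v
  show "log_form f r p c z v = (\<Sum>J | J \<subseteq> {..<r} \<and> card J = p. scale_form (c J) (basic_form p J)) z v"
    unfolding sum_form_apply scale_form_def basic_form_def log_form_def
    by (auto simp: if_distrib[of "\<lambda>x. x * _"] sum.delta' intro!: sum.cong cong: if_cong)
qed

lemma polynomial_on_log_curve:
  assumes P: "polynomial_fun scale_form P" and c: "\<And>J. \<exists>q. \<forall>t. c t J = poly q t"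
  shows "\<exists>q. \<forall>t. P (log_form f r p (c t)) = poly q t"
proof (rule polynomial_along_curve[OF P])
  fix \<phi> :: "'m form \<Rightarrow> complex" assume "Vector_Spaces.linear scale_form (*) \<phi>"
  then interpret Vector_Spaces.linear scale_form "(*)" \<phi> .
  have "\<forall>J. \<exists>q. \<forall>t. c t J = poly q t" using c by blast
  then obtain q where q: "\<And>J t. c t J = poly (q J) t" by metis
  have "\<phi> (log_form f r p (c t)) =
      poly (\<Sum>J | J \<subseteq> {..<r} \<and> card J = p. smult (\<phi> (basic_form p J)) (q J)) t" for t
    unfolding log_form_eq_sum by (simp add: sum scale q poly_sum mult.commute)
  then show "\<exists>q. \<forall>t. \<phi> (log_form f r p (c t)) = poly q t" by blast
qed

text \<open>Polynomials on projective space of forms are built from linear functionals on the space of all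
forms, so the coefficients, which are determined by a logarithmic form, are extended to it.\<close>

lemma coefficient_functionals:
  assumes p: "p < CARD('m)"
  obtains \<kappa> where "\<forall>J. Vector_Spaces.linear scale_form (*) (\<kappa> J)"
    "\<forall>J c. J \<subseteq> {..<r} \<and> card J = p \<longrightarrow> \<kappa> J (log_form f r p c) = c J"
proof -
  interpret form: vector_space "scale_form :: complex \<Rightarrow> 'm form \<Rightarrow> 'm form" by (rule vector_space_scale_form)
  interpret pair: vector_space_pair "scale_form :: complex \<Rightarrow> 'm form \<Rightarrow> 'm form" "(*) :: complex \<Rightarrow> complex \<Rightarrow> complex"
    by unfold_locales (simp_all add: algebra_simps)
  let ?S = "{J. J \<subseteq> {..<r} \<and> card J = p}"
  have inj: "inj_on (basic_form p) ?S"
  proof (rule inj_onI)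
    fix I J assume I: "I \<in> ?S" and "J \<in> ?S" "basic_form p I = basic_form p J"
    then have "(if I = I then 1 else 0) = (if I = J then 1 else (0::complex))"
      unfolding basic_form_def by (intro log_form_inj[OF p, of "\<lambda>K. if K = I then 1 else 0" "\<lambda>K. if K = J then 1 else 0"]) auto
    then show "I = J" by (simp split: if_splits)
  qed
  have "form.independent (basic_form p ` ?S)"
    unfolding form.dependent_finite[OF finite_imageI[OF finite_subsets_card]]
  proof (intro notI, elim exE conjE bexE)
    fix u x assume sum: "(\<Sum>x\<in>basic_form p ` ?S. scale_form (u x) x) = 0" and x: "x \<in> basic_form p ` ?S" "u x \<noteq> 0"
    then obtain J where J: "J \<subseteq> {..<r}" "card J = p" "x = basic_form p J" by auto
    have "log_form f r p (\<lambda>J. u (basic_form p J)) = 0"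
      unfolding log_form_eq_sum using sum inj by (simp add: sum.reindex)
    also have "0 = log_form f r p (\<lambda>_. 0)" by (simp add: log_form_def fun_eq_iff)
    finally have "u (basic_form p J) = 0" by (rule log_form_inj[OF p _ J(1,2)])
    then show False using x J by simp
  qed
  then have extend: "\<exists>g. Vector_Spaces.linear scale_form (*) g \<and> (\<forall>x\<in>basic_form p ` ?S. g x = h x)" for h :: "'m form \<Rightarrow> complex"
    by (rule pair.linear_independent_extend)
  have "\<forall>J. \<exists>g. Vector_Spaces.linear scale_form (*) g \<and> (\<forall>x\<in>basic_form p ` ?S. g x = (if x = basic_form p J then 1 else 0))"
    by (intro allI extend)
  from choice[OF this] obtain \<kappa> where
    "\<forall>J. Vector_Spaces.linear scale_form (*) (\<kappa> J) \<and> (\<forall>x\<in>basic_form p ` ?S. \<kappa> J x = (if x = basic_form p J then 1 else 0))"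
    by (elim exE)
  then have \<kappa>: "\<And>J. Vector_Spaces.linear scale_form (*) (\<kappa> J)"
    "\<And>J x. x \<in> basic_form p ` ?S \<Longrightarrow> \<kappa> J x = (if x = basic_form p J then 1 else 0)" by blast+
  have "\<kappa> J (log_form f r p c) = c J" if J: "J \<subseteq> {..<r}" "card J = p" for J c
  proof -
    interpret Vector_Spaces.linear scale_form "(*)" "\<kappa> J" by (rule \<kappa>(1))
    have "\<kappa> J (log_form f r p c) = (\<Sum>I\<in>?S. c I * \<kappa> J (basic_form p I))"
      unfolding log_form_eq_sum by (simp add: sum scale)
    also have "\<dots> = (\<Sum>I\<in>?S. if I = J then c I else 0)"
    proof (rule sum.cong[OF refl])
      fix I assume I: "I \<in> ?S"
      have "basic_form p I = basic_form p J \<longleftrightarrow> I = J" using inj I J by (auto dest: inj_onD)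
      then show "c I * \<kappa> J (basic_form p I) = (if I = J then c I else 0)" using \<kappa>(2)[OF imageI[OF I]] by simp
    qed
    also have "\<dots> = c J" using J by (simp add: sum.delta')
    finally show ?thesis .
  qed
  then have "\<forall>J c. J \<subseteq> {..<r} \<and> card J = p \<longrightarrow> \<kappa> J (log_form f r p c) = c J" by blast
  moreover have "\<forall>J. Vector_Spaces.linear scale_form (*) (\<kappa> J)" using \<kappa>(1) by blast
  ultimately show ?thesis by (intro that)
qed

text \<open>If closed sets \<open>A\<close> and \<open>B\<close> cover \<open>L_td\<close> and neither contains it, then some equation \<open>PA\<close> of \<open>A\<close> and some
equation \<open>PB\<close> of \<open>B\<close> each fail to vanish at some point of \<open>L_td\<close>.
On the line joining the matrices of these points neither equation vanishes at a general parameter,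
whose point lies in \<open>L_td\<close> but neither in \<open>A\<close> nor in \<open>B\<close>.\<close>

lemma L_td_irreducible:
  assumes p: "p \<ge> 1" "p < CARD('m)" "p < r"
  shows "zariski_irreducible scale_form (log_forms_R f r p) (L_td f r p)"
  unfolding zariski_irreducible_def
proof (intro conjI allI impI)
  show "L_td f r p \<noteq> {}"
  proof -
    have J: "{..<p} \<subseteq> {..<r}" using p by auto
    then obtain L where L: "\<forall>i<p. (\<Sum>l<r. L i l * of_nat (deg l)) = 0" "minors p L {..<p} \<noteq> 0"
      using rows_with_nonzero_minors[OF p(3), of "{{..<p}}"] by auto
    show ?thesis using L_td_of_rows(2)[OF p(1,2) L(1) J _ L(2)] by auto
  qed
  show "L_td f r p \<subseteq> projectivization scale_form (log_forms_R f r p)"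
    by (auto simp: L_td_def projectivization_def)
  fix A B
  assume AB: "zariski_closed scale_form (log_forms_R f r p) A \<and> zariski_closed scale_form (log_forms_R f r p) B \<and> L_td f r p \<subseteq> A \<union> B"
  have witness: "\<exists>S L P. (\<forall>P\<in>S. \<exists>d. homogeneous_poly scale_form d P) \<and>
      Z = proj_pt scale_form ` {x \<in> log_forms_R f r p - {0}. \<forall>P\<in>S. P x = 0} \<and>
      (\<forall>i<p. (\<Sum>l<r. L i l * of_nat (deg l)) = 0) \<and> log_form f r p (minors p L) \<noteq> 0 \<and>
      P \<in> S \<and> P (log_form f r p (minors p L)) \<noteq> 0"
    if Z: "zariski_closed scale_form (log_forms_R f r p) Z" and X: "X \<in> L_td f r p" "X \<notin> Z" for Z X
  proof -
    obtain S where S: "\<forall>P\<in>S. \<exists>d. homogeneous_poly scale_form d P"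
      "Z = proj_pt scale_form ` {x \<in> log_forms_R f r p - {0}. \<forall>P\<in>S. P x = 0}"
      using Z by (auto simp: zariski_closed_def)
    obtain L where L: "X = proj_pt scale_form (log_form f r p (minors p L))"
      "log_form f r p (minors p L) \<in> log_forms_R f r p - {0}"
      "\<forall>i<p. (\<Sum>l<r. L i l * of_nat (deg l)) = 0"
      by (rule L_td_rows[OF p(1,2) X(1)])
    then obtain P where "P \<in> S" "P (log_form f r p (minors p L)) \<noteq> 0" using X(2) S(2) by blast
    then show ?thesis using S L by blast
  qed
  show "L_td f r p \<subseteq> A \<or> L_td f r p \<subseteq> B"
  proof (rule ccontr)
    assume "\<not> ?thesis"
    then obtain X Y where XY: "X \<in> L_td f r p" "X \<notin> A" "Y \<in> L_td f r p" "Y \<notin> B" by blast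
    obtain SA L1 PA where A: "\<forall>P\<in>SA. \<exists>d. homogeneous_poly scale_form d P"
      "A = proj_pt scale_form ` {x \<in> log_forms_R f r p - {0}. \<forall>P\<in>SA. P x = 0}"
      "\<forall>i<p. (\<Sum>l<r. L1 i l * of_nat (deg l)) = 0" "log_form f r p (minors p L1) \<noteq> 0"
      "PA \<in> SA" "PA (log_form f r p (minors p L1)) \<noteq> 0"
      using witness[of A X] AB XY by blast
    obtain SB L2 PB where B: "\<forall>P\<in>SB. \<exists>d. homogeneous_poly scale_form d P"
      "B = proj_pt scale_form ` {x \<in> log_forms_R f r p - {0}. \<forall>P\<in>SB. P x = 0}"
      "\<forall>i<p. (\<Sum>l<r. L2 i l * of_nat (deg l)) = 0"
      "PB \<in> SB" "PB (log_form f r p (minors p L2)) \<noteq> 0"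
      using witness[of B Y] AB XY by blast
    obtain J where J: "J \<subseteq> {..<r}" "card J = p" "minors p L1 J \<noteq> 0"
      using log_form_nonzero_coef[OF A(4)] by blast
    let ?\<gamma> = "\<lambda>t. log_form f r p (minors p (row_line L1 L2 t))"
    obtain qA where qA: "\<And>t. PA (?\<gamma> t) = poly qA t"
      using polynomial_on_log_curve[of PA "\<lambda>t. minors p (row_line L1 L2 t)" p] minors_row_line A(1,5)
      by (auto simp: homogeneous_poly_def)
    obtain qB where qB: "\<And>t. PB (?\<gamma> t) = poly qB t"
      using polynomial_on_log_curve[of PB "\<lambda>t. minors p (row_line L1 L2 t)" p] minors_row_line B(1,4)
      by (auto simp: homogeneous_poly_def)
    obtain qJ where qJ: "\<And>t. minors p (row_line L1 L2 t) J = poly qJ t" using minors_row_line by blast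
    have "qA \<noteq> 0" using qA[of 0] A(6) by (auto simp: row_line_0)
    moreover have "qB \<noteq> 0" using qB[of 1] B(5) by (auto simp: row_line_1)
    moreover have "qJ \<noteq> 0" using qJ[of 0] J(3) by (auto simp: row_line_0)
    ultimately have nz: "s \<noteq> 0" if "s \<in> {qA, qB, qJ}" for s using that by blast
    obtain t where "\<forall>s\<in>{qA, qB, qJ}. poly s t \<noteq> 0"
      by (rule poly_common_nonroot[of "{qA, qB, qJ}"]) (use nz in auto)
    then have t: "PA (?\<gamma> t) \<noteq> 0" "PB (?\<gamma> t) \<noteq> 0" "minors p (row_line L1 L2 t) J \<noteq> 0"
      by (simp_all add: qA qB qJ)
    have "\<forall>i<p. (\<Sum>l<r. row_line L1 L2 t i l * of_nat (deg l)) = 0"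
      by (intro allI impI row_line_contraction) (use A(3) B(3) in auto)
    then have "proj_pt scale_form (?\<gamma> t) \<in> L_td f r p" by (rule L_td_of_rows(2)[OF p(1,2) _ J(1,2) t(3)])
    then have "proj_pt scale_form (?\<gamma> t) \<in> A \<or> proj_pt scale_form (?\<gamma> t) \<in> B" using AB by blast
    then show False
      using proj_pt_mem_zero_locus[OF _ A(1,5)] proj_pt_mem_zero_locus[OF _ B(1,4)] t(1,2) A(2) B(2) by blast
  qed
qed

text \<open>Let \<open>X'\<close> be irreducible between \<open>L_td\<close> and \<open>L_F\<close>. It is covered by the closed sets \<open>A\<close>, where the product
of all coefficients vanishes, and \<open>B\<close>, where all exchange relations hold. Matrices with
nonzero minors show that \<open>X'\<close> is not contained in \<open>A\<close>, and \<open>B\<close> is contained in \<open>L_td\<close>.\<close>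

lemma L_td_component:
  assumes p: "p \<ge> 1" "p + 2 < CARD('m)" "p < r"
  shows "irreducible_component scale_form (log_forms_R f r p) (L_td f r p) (L_F f r p)"
  unfolding irreducible_component_def
proof (intro conjI allI impI)
  let ?R = "log_forms_R f r p" and ?S = "{J. J \<subseteq> {..<r} \<and> card J = p}"
  have pm: "p < CARD('m)" using p by simp
  show "L_td f r p \<subseteq> L_F f r p" by (rule L_td_subset_L_F[OF p(1)])
  show "zariski_irreducible scale_form ?R (L_td f r p)" by (rule L_td_irreducible[OF p(1) pm p(3)])
  fix X' assume "L_td f r p \<subseteq> X' \<and> X' \<subseteq> L_F f r p \<and> zariski_irreducible scale_form ?R X'"
  then have X': "L_td f r p \<subseteq> X'" "X' \<subseteq> L_F f r p"
    and irr: "\<And>A B. zariski_closed scale_form ?R A \<Longrightarrow> zariski_closed scale_form ?R B \<Longrightarrow> X' \<subseteq> A \<union> B \<Longrightarrow> X' \<subseteq> A \<or> X' \<subseteq> B"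
    by (auto simp: zariski_irreducible_def)
  obtain \<kappa> where "\<forall>J. Vector_Spaces.linear scale_form (*) (\<kappa> J)"
    "\<forall>J c. J \<subseteq> {..<r} \<and> card J = p \<longrightarrow> \<kappa> J (log_form f r p c) = c J"
    by (rule coefficient_functionals[OF pm])
  then have \<kappa>: "\<And>J. Vector_Spaces.linear scale_form (*) (\<kappa> J)"
    "\<And>J c. J \<subseteq> {..<r} \<Longrightarrow> card J = p \<Longrightarrow> \<kappa> J (log_form f r p c) = c J"
    by blast+
  have coef_scale: "\<kappa> J (scale_form a x) = a * \<kappa> J x" for J a x
  proof -
    interpret Vector_Spaces.linear scale_form "(*)" "\<kappa> J" by (rule \<kappa>(1))
    show ?thesis by (rule scale)
  qed
  \<comment> \<open>\<open>Q\<close> is the equation of \<open>A\<close>, and the \<open>E v u j\<close> are the equations of \<open>B\<close>.\<close>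
  define Q where "Q x = (\<Prod>J\<in>?S. \<kappa> J x)" for x
  define K where "K k x = coef_seq p r (\<lambda>J. \<kappa> J x) k" for k x
  define E where "E v u j x = K v x * K u x - (\<Sum>i<p. K (v(i := u j)) x * K (u(j := v i)) x)" for v u j x
  define SE where "SE = {E v u j | v u j. (\<forall>i<p. v i < r) \<and> (\<forall>i<p. u i < r) \<and> j < p}"
  define A where "A = proj_pt scale_form ` {x \<in> ?R - {0}. \<forall>P\<in>{Q}. P x = 0}"
  define B where "B = proj_pt scale_form ` {x \<in> ?R - {0}. \<forall>P\<in>SE. P x = 0}"
  have K_log: "K k (log_form f r p c) = coef_seq p r c k" for k c
    unfolding K_def coef_seq_def lform_def by (rule sum.cong) (simp_all add: \<kappa>(2))
  have Q_hom: "\<forall>P\<in>{Q}. \<exists>d. homogeneous_poly scale_form d P"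
  proof -
    have "homogeneous_poly scale_form (card ?S) Q"
      unfolding homogeneous_poly_def
    proof (intro conjI allI)
      show "polynomial_fun scale_form Q"
        unfolding Q_def[abs_def] by (rule polynomial_fun_prod) (auto intro: polynomial_fun.linear \<kappa>(1))
      show "Q (scale_form a x) = a ^ card ?S * Q x" for a x
        by (simp add: Q_def coef_scale prod.distrib)
    qed
    then show ?thesis by blast
  qed
  have K_poly: "polynomial_fun scale_form (K k)" for k
    unfolding K_def[abs_def] coef_seq_def lform_def
    by (intro polynomial_fun_sum polynomial_fun.mult polynomial_fun.const polynomial_fun.linear \<kappa>(1)) simp
  have K_scale: "K k (scale_form a x) = a * K k x" for k a x
    by (simp add: K_def coef_seq_def lform_def coef_scale sum_distrib_left mult.assoc)
  have E_hom: "\<forall>P\<in>SE. \<exists>d. homogeneous_poly scale_form d P"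
  proof
    fix P assume "P \<in> SE"
    then obtain v u j where P: "P = E v u j" by (auto simp: SE_def)
    have "E v u j = (\<lambda>x. K v x * K u x + (\<lambda>_. - 1) x * (\<Sum>i<p. K (v(i := u j)) x * K (u(j := v i)) x))"
      by (simp add: E_def fun_eq_iff)
    moreover have "polynomial_fun scale_form (\<lambda>x. K v x * K u x + (\<lambda>_. - 1) x * (\<Sum>i<p. K (v(i := u j)) x * K (u(j := v i)) x))"
      by (intro polynomial_fun.add polynomial_fun.mult polynomial_fun.const polynomial_fun_sum K_poly) simp
    moreover have "E v u j (scale_form a x) = a ^ 2 * E v u j x" for a x
      by (simp add: E_def K_scale power2_eq_square sum_distrib_left algebra_simps)
    ultimately have "homogeneous_poly scale_form 2 P" unfolding homogeneous_poly_def P by simp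
    then show "\<exists>d. homogeneous_poly scale_form d P" by blast
  qed
  have closed: "zariski_closed scale_form ?R A" "zariski_closed scale_form ?R B"
    unfolding zariski_closed_def A_def B_def using Q_hom E_hom by blast+
  have in_B: "proj_pt scale_form (log_form f r p c) \<in> B"
    if c: "log_form f r p c \<in> ?R - {0}" and L: "decomposed_by p r c L" for c L
  proof -
    have "P (log_form f r p c) = 0" if "P \<in> SE" for P
    proof -
      obtain v u j where P: "P = E v u j" "\<And>i. i < p \<Longrightarrow> v i < r" "\<And>i. i < p \<Longrightarrow> u i < r" "j < p"
        using \<open>P \<in> SE\<close> by (auto simp: SE_def)
      have "exchange_at p (coef_seq p r c) v u j"
        by (rule exchange_coef_seq_minors[OF P(2-4)]) (use L in \<open>auto simp: decomposed_by_def\<close>)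
      then show ?thesis by (simp add: P(1) E_def K_log exchange_at_def)
    qed
    then show ?thesis unfolding B_def using c by blast
  qed
  have "X' \<subseteq> A \<union> B"
  proof
    fix X assume "X \<in> X'"
    then have "X \<in> L_F f r p" using X' by blast
    then obtain c where c: "X = proj_pt scale_form (log_form f r p c)" "log_form f r p c \<in> ?R - {0}"
      "integrable_form (polar_divisor f r) p (log_form f r p c)" by (rule L_F_cases)
    show "X \<in> A \<union> B"
    proof (cases "\<forall>J. J \<subseteq> {..<r} \<and> card J = p \<longrightarrow> c J \<noteq> 0")
      case True
      then obtain L where "decomposed_by p r c L"
        using integrable_decomposed[OF p(1,2) _ c(3)] c(2) by auto
      then show ?thesis using in_B[OF c(2)] c(1) by blast
    next
      case False
      then obtain J where J: "J \<subseteq> {..<r}" "card J = p" "c J = 0" by blast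
      have "Q (log_form f r p c) = 0"
        unfolding Q_def using J by (intro prod_zero) (auto simp: \<kappa>(2))
      then show ?thesis unfolding A_def using c by blast
    qed
  qed
  then have "X' \<subseteq> A \<or> X' \<subseteq> B" by (rule irr[OF closed])
  moreover have "\<not> X' \<subseteq> A"
  proof
    assume sub: "X' \<subseteq> A"
    have "\<exists>L. (\<forall>i<p. (\<Sum>l<r. L i l * of_nat (deg l)) = 0) \<and> (\<forall>J\<in>?S. minors p L J \<noteq> 0)"
      by (rule rows_with_nonzero_minors[OF p(3)]) auto
    then obtain L where L: "\<forall>i<p. (\<Sum>l<r. L i l * of_nat (deg l)) = 0" "\<forall>J\<in>?S. minors p L J \<noteq> 0"
      by (elim exE conjE)
    have "{..<p} \<in> ?S" using p(3) by auto
    then have "minors p L {..<p} \<noteq> 0" using L(2) by blast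
    then have "proj_pt scale_form (log_form f r p (minors p L)) \<in> L_td f r p"
      by (rule L_td_of_rows(2)[OF p(1) pm L(1), rotated -1]) (use p(3) in auto)
    then have "proj_pt scale_form (log_form f r p (minors p L)) \<in> A" using X'(1) sub by blast
    then have "Q (log_form f r p (minors p L)) = 0"
      unfolding A_def by (rule proj_pt_mem_zero_locus[OF _ Q_hom]) simp
    then have "\<exists>J\<in>?S. \<kappa> J (log_form f r p (minors p L)) = 0"
      unfolding Q_def by (simp only: prod_zero_iff finite_subsets_card)
    then show False using L(2) \<kappa>(2) by auto
  qed
  moreover have "B \<subseteq> L_td f r p"
  proof
    fix X assume "X \<in> B"
    then obtain c where c: "X = proj_pt scale_form (log_form f r p c)" "log_form f r p c \<in> ?R - {0}"
      "\<forall>P\<in>SE. P (log_form f r p c) = 0"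
      unfolding B_def log_forms_R_def log_forms_def by blast
    have "exchange_at p (coef_seq p r c) v u j"
      if "\<And>i. i < p \<Longrightarrow> v i < r" "\<And>i. i < p \<Longrightarrow> u i < r" "j < p" for v u j
    proof -
      have "E v u j \<in> SE" using that by (auto simp: SE_def)
      then have "E v u j (log_form f r p c) = 0" using c(3) by blast
      then show ?thesis by (simp add: E_def K_log exchange_at_def)
    qed
    then obtain L where "decomposed_by p r c L"
      using exchange_imp_L_td_rows[OF p(1) pm c(2)] by blast
    then show "X \<in> L_td f r p" using mem_L_td[OF p(1) _ c(2)] c(1) by blast
  qed
  ultimately show "X' = L_td f r p" using X'(1) by blast
qed

end

theorem theorem2:
  fixes f :: "nat \<Rightarrow> complex^'m::finite \<Rightarrow> complex" and n p r :: nat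
  assumes "CARD('m) = n + 1"
    and "p \<ge> 1"
    and "\<forall>i<r. \<exists>d. homogeneous_poly (*s) d (f i)"
    and "strictly_ordinary f r"
  shows "(p = 2 \<and> p + 2 \<le> n \<or> r = p + 1 \<or> r = p + 2 \<longrightarrow> L_td f r p = L_F f r p) \<and>
    (2 < p \<and> p + 2 \<le> n \<and> r > p + 2 \<longrightarrow>
       irreducible_component scale_form (log_forms_R f r p) (L_td f r p) (L_F f r p) \<and>
       (zariski_irreducible scale_form (log_forms_R f r p) (L_F f r p) \<longrightarrow>
          L_td f r p = L_F f r p))"
proof -
  interpret ordinary_divisor f r by unfold_locales (rule assms)+
  show ?thesis
  proof (intro conjI impI)
    assume "p = 2 \<and> p + 2 \<le> n \<or> r = p + 1 \<or> r = p + 2"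
    then show "L_td f r p = L_F f r p" using L_td_eq_L_F[OF assms(2)] assms(1) by auto
  next
    assume "2 < p \<and> p + 2 \<le> n \<and> r > p + 2"
    then show comp: "irreducible_component scale_form (log_forms_R f r p) (L_td f r p) (L_F f r p)"
      using L_td_component[OF assms(2)] assms(1) by simp
    assume "zariski_irreducible scale_form (log_forms_R f r p) (L_F f r p)"
    with comp show "L_td f r p = L_F f r p" unfolding irreducible_component_def by blast
  qed
qed

end
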